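(* There is an algorithm which takes as input a graph $G$ on $n$ vertices with maximum degree $\Delta$ and enumerates a maximal (with respect to inclusion) independent set of $G$. The algorithm runs in time $n^{O(\Delta)}$ and uses $O(\Delta \log n)$ bits of space.
   Context: Model of computation: word RAM with words of $O(\log n)$ bits; the input is read-only; output is written to a write-only stream; space is measured as the number of bits of auxiliary read-write memory used. *)

theory Defs
  imports Complex_Main
begin

section \<open>Graphs\<close>

definition simple_graph :: "nat \<Rightarrow> (nat \<times> nat) set \<Rightarrow> bool" where
  "simple_graph n E \<longleftrightarrow> E \<subseteq> {..<n} \<times> {..<n} \<and> sym E \<and> irrefl E"

definition vertex_degree :: "(nat \<times> nat) set \<Rightarrow> nat \<Rightarrow> nat" where
  "vertex_degree E v = card (E `` {v})"

text \<open>The inserted 0 only matters for the graph without vertices.\<close>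

definition max_degree :: "nat \<Rightarrow> (nat \<times> nat) set \<Rightarrow> nat" where
  "max_degree n E = Max (insert 0 (vertex_degree E ` {..<n}))"

definition independent_set :: "nat \<Rightarrow> (nat \<times> nat) set \<Rightarrow> nat set \<Rightarrow> bool" where
  "independent_set n E S \<longleftrightarrow> S \<subseteq> {..<n} \<and> (\<forall>u\<in>S. \<forall>v\<in>S. (u, v) \<notin> E)"

definition maximal_independent_set :: "nat \<Rightarrow> (nat \<times> nat) set \<Rightarrow> nat set \<Rightarrow> bool" where
  "maximal_independent_set n E S \<longleftrightarrow>
     independent_set n E S \<and> (\<forall>T. independent_set n E T \<and> S \<subseteq> T \<longrightarrow> T = S)"

text \<open>
  Adjacency arrays, with the neighbours of each vertex in arbitrary order: word 0 is n, the
  neighbours of v occupy the input positions from word 1 + v (inclusive) to word 2 + v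
  (exclusive), and the concatenated neighbour lists start at position n + 2.  A graph has several
  encodings, and the maximum degree is not part of the input.
\<close>

definition encodes_graph :: "nat list \<Rightarrow> nat \<Rightarrow> (nat \<times> nat) set \<Rightarrow> bool" where
  "encodes_graph inp n E \<longleftrightarrow>
     (\<exists>nbrs :: nat list list.
        length nbrs = n \<and>
        (\<forall>v<n. distinct (nbrs ! v) \<and> set (nbrs ! v) = E `` {v}) \<and>
        inp = [n] @ map (\<lambda>v. n + 2 + sum_list (map length (take v nbrs))) [0..<n + 1] @ concat nbrs)"

section \<open>Word RAM with read-only input and write-only output\<close>

datatype binop = Add | Sub | Mul | Div | Mod | BitAnd | BitOr | BitXor | ShiftL | ShiftR

text \<open>
  There are no registers besides the memory cells, so all read-write storage is counted as space.
  Cell operands are constant addresses; \<^emph>\<open>Load\<close>, \<^emph>\<open>Store\<close> and \<^emph>\<open>Read\<close> address indirectly.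
\<close>

datatype instr =
    Const nat nat
  | Copy nat nat
  | Op binop nat nat nat
  | Load nat nat
  | Store nat nat
  | Read nat nat
  | Write nat
  | Jump nat
  | JumpZero nat nat
  | JumpLess nat nat nat

record config =
  pc :: nat
  mem :: "nat \<Rightarrow> nat"
  written :: "nat list"

text \<open>All arithmetic is on w-bit words, that is, modulo 2 to the power w.\<close>

fun apply_binop :: "nat \<Rightarrow> binop \<Rightarrow> nat \<Rightarrow> nat \<Rightarrow> nat" where
  "apply_binop w Add x y = take_bit w (x + y)"
| "apply_binop w Sub x y = take_bit w (2 ^ w + x - y)"
| "apply_binop w Mul x y = take_bit w (x * y)"
| "apply_binop w Div x y = take_bit w (x div y)"
| "apply_binop w Mod x y = take_bit w (x mod y)"
| "apply_binop w BitAnd x y = take_bit w (Bit_Operations.and x y)"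
| "apply_binop w BitOr x y = take_bit w (Bit_Operations.or x y)"
| "apply_binop w BitXor x y = take_bit w (Bit_Operations.xor x y)"
| "apply_binop w ShiftL x y = take_bit w (push_bit y x)"
| "apply_binop w ShiftR x y = take_bit w (drop_bit y x)"

definition assign :: "nat \<Rightarrow> nat \<Rightarrow> config \<Rightarrow> config" where
  "assign a x c = c\<lparr>pc := Suc (pc c), mem := (mem c)(a := x)\<rparr>"

fun exec_instr :: "nat \<Rightarrow> nat list \<Rightarrow> instr \<Rightarrow> config \<Rightarrow> config" where
  "exec_instr w inp (Const a k) c = assign a (take_bit w k) c"
| "exec_instr w inp (Copy a b) c = assign a (mem c b) c"
| "exec_instr w inp (Op f a b d) c = assign a (apply_binop w f (mem c b) (mem c d)) c"
| "exec_instr w inp (Load a b) c = assign a (mem c (mem c b)) c"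
| "exec_instr w inp (Store a b) c = assign (mem c a) (mem c b) c"
| "exec_instr w inp (Read a b) c =
     assign a (if mem c b < length inp then take_bit w (inp ! mem c b) else 0) c"
| "exec_instr w inp (Write a) c = c\<lparr>pc := Suc (pc c), written := written c @ [mem c a]\<rparr>"
| "exec_instr w inp (Jump l) c = c\<lparr>pc := l\<rparr>"
| "exec_instr w inp (JumpZero a l) c = c\<lparr>pc := (if mem c a = 0 then l else Suc (pc c))\<rparr>"
| "exec_instr w inp (JumpLess a b l) c =
     c\<lparr>pc := (if mem c a < mem c b then l else Suc (pc c))\<rparr>"

fun accessed_cells :: "instr \<Rightarrow> config \<Rightarrow> nat set" where
  "accessed_cells (Const a k) c = {a}"
| "accessed_cells (Copy a b) c = {a, b}"
| "accessed_cells (Op f a b d) c = {a, b, d}"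
| "accessed_cells (Load a b) c = {a, b, mem c b}"
| "accessed_cells (Store a b) c = {a, b, mem c a}"
| "accessed_cells (Read a b) c = {a, b}"
| "accessed_cells (Write a) c = {a}"
| "accessed_cells (Jump l) c = {}"
| "accessed_cells (JumpZero a l) c = {a}"
| "accessed_cells (JumpLess a b l) c = {a, b}"

text \<open>
  One step of program P with word length w and a memory consisting of the s cells 0, ..., s - 1:
  the machine is stuck if it tries to access any other cell.
\<close>

definition step :: "nat \<Rightarrow> nat \<Rightarrow> nat list \<Rightarrow> instr list \<Rightarrow> config rel" where
  "step w s inp P =
     {(c, c'). pc c < length P \<and> accessed_cells (P ! pc c) c \<subseteq> {..<s} \<and>
               c' = exec_instr w inp (P ! pc c) c}"

definition initial_config :: config where
  "initial_config = \<lparr>pc = 0, mem = (\<lambda>_. 0), written = []\<rparr>"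

text \<open>
  The program halts by leaving the program text, after exactly t executed instructions, and the
  s cells of w bits each are its entire read-write memory.
\<close>

definition halts_with ::
  "nat \<Rightarrow> nat list \<Rightarrow> instr list \<Rightarrow> nat \<Rightarrow> nat \<Rightarrow> nat list \<Rightarrow> bool" where
  "halts_with w inp P t s xs \<longleftrightarrow>
     (\<exists>c. (initial_config, c) \<in> step w s inp P ^^ t \<and> length P \<le> pc c \<and> written c = xs)"

text \<open>
  Words of O(log n) bits, with a constant factor k that may depend on the algorithm only.
  The summand 2 keeps the length positive for all n.
\<close>

definition word_length :: "nat \<Rightarrow> nat \<Rightarrow> nat" where
  "word_length k n = k * nat \<lceil>log 2 (real n + 2)\<rceil>"

end

theory Submission
  imports Defs "HOL-Computational_Algebra.Primes" "HOL-Computational_Algebra.Polynomial"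
    "HOL-Library.FuncSet"
begin

text \<open>
  The i-th neighbours with larger number form a forest, in which the parity of the depth is a proper
  2-colouring computable with O(1) words by following the path to the root.  The Delta parities
  together are a label of Delta bits, proper for the whole graph.  A label is reduced modulo the
  least r that separates v from its neighbours; since lcm(1, ..., r) is at least 2^(r-1), r is at
  most Delta^2 + 1.  The pair of r and the residue gives a quartic polynomial over a prime field of
  order q = O(Delta), different for adjacent vertices.  Let every vertex walk along the values of its
  polynomial and stop at the first time at which its value differs from the values of its neighbours
  and from the final values of those that have stopped; counting roots shows that every vertex stops
  before time q, so the final values are a proper colouring with q colours.  Taking vertices greedily
  in the order of their colours gives a maximal independent set.

  Both greedy processes are kernels of acyclic relations of height at most q, which are evaluated by a
  depth-first search with a stack of q words.  The number of steps needs no analysis: a halting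
  machine never repeats its program counter and memory, so it runs for at most n^O(Delta) steps.
\<close>

section \<open>Primes and least common multiples\<close>

text \<open>The obstacle is the stack: O(Delta) words allow a search of depth O(Delta), so the
  greedy process has to follow a colouring with O(Delta) colours, and colours cannot be stored but
  must be recomputed from the input whenever they are needed. Labels are therefore used only as
  residues, accumulated bit by bit, and only the two kernels need a stack; the vertex kernel calls
  the stop kernel but not conversely, so two stacks suffice.

  The degree four comes from two base-q digits for the modulus and two for the residue, below a
  leading coefficient 1 that keeps the polynomial non-constant modulo q. A neighbour thus excludes
  at most 3 times by a common value and at most 4 by its final value, and 7 Delta < q leaves a free
  time. Such a prime q = O(Delta) must exist for every Delta, hence the elementary prime
  estimates.\<close>

text \<open>Leibniz's harmonic triangle: \<open>1 / (Suc m * (Suc n choose Suc m))\<close> equals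
  \<open>1 / (m * (n choose m)) - 1 / (m * (Suc n choose m))\<close>. Multiplied by the least common
  multiple, the right-hand side is a difference of two integers, by the outer and the inner
  induction.\<close>

lemma binomial_dvd_Lcm:
  assumes "1 \<le> m" "m \<le> n"
  shows "m * (n choose m) dvd Lcm {1..n::nat}"
  using assms
proof (induction n arbitrary: m)
  case 0
  then show ?case by simp
next
  case (Suc n)
  have outer: "m * (Suc n choose m) dvd Lcm {1..Suc n}" if "1 \<le> m" "m \<le> Suc n" for m
    using that
  proof (induction m rule: dec_induct)
    case base
    show ?case by (simp add: dvd_Lcm)
  next
    case (step m)
    let ?L = "Lcm {1..Suc n}"
    have IH: "m * (Suc n choose m) dvd ?L" using step by simp
    have "m * (n choose m) dvd Lcm {1..n}" using Suc.IH step by simp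
    also have "Lcm {1..n} dvd ?L" by (rule Lcm_subset) auto
    finally have 2: "m * (n choose m) dvd ?L" .
    obtain a where a: "?L = m * (Suc n choose m) * a" using IH by (elim dvdE)
    obtain b where b: "?L = m * (n choose m) * b" using 2 by (elim dvdE)
    have "Suc m * (Suc n choose Suc m) * (int b - int a) = int ?L"
    proof -
      have A: "Suc m * (Suc n choose Suc m) = Suc n * (n choose m)"
        by (rule Suc_times_binomial)
      have B: "(Suc n - m) * (Suc n choose m) = Suc n * (n choose m)"
        by (simp add: binomial_absorb_comp)
      define X where "X = int (Suc n choose m)"
      define Y where "Y = int (n choose m)"
      have m: "int (Suc n - m) = int (Suc n) - int m" using step by linarith
      have B': "(int (Suc n) - int m) * X = int (Suc n) * Y"
        using arg_cong[OF B, of int] unfolding of_nat_mult m X_def Y_def .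
      have a': "int ?L = int m * X * int a" using a X_def by (metis of_nat_mult)
      have b': "int ?L = int m * Y * int b" using b Y_def by (metis of_nat_mult)
      have "int m * (int (Suc n) * Y * (int b - int a)) = int (Suc n) * int ?L - int a * (int m * (int (Suc n) * Y))"
        unfolding b' by (simp add: algebra_simps)
      also have "\<dots> = int (Suc n) * int ?L - (int (Suc n) - int m) * int ?L"
        unfolding a' B'[symmetric] by (simp add: algebra_simps)
      also have "\<dots> = int m * int ?L" by (simp add: algebra_simps)
      finally have "int (Suc n) * Y * (int b - int a) = int ?L"
        using step by simp
      then show ?thesis unfolding A Y_def by (simp only: of_nat_mult)
    qed
    then have "int (Suc m * (Suc n choose Suc m)) dvd int ?L"
      by (metis dvd_triv_left)
    then show ?case by (simp only: int_dvd_int_iff)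
  qed
  show ?case by (rule outer) (use Suc.prems in auto)
qed

lemma Lcm_atLeast1_pos: "0 < Lcm {1..n::nat}"
  by (rule Nat.gr0I) (auto simp: Lcm_0_iff)

text \<open>Averaging: the \<open>n\<close> numbers \<open>m * (n choose m)\<close> have sum
  \<open>n * 2 ^ (n - 1)\<close>, and each of them divides the least common multiple.\<close>

lemma Lcm_ge_power2: "2 ^ (n - 1) \<le> Lcm {1..n::nat}"
proof (cases n)
  case (Suc k)
  have "n * 2 ^ (n - 1) = (\<Sum>m\<le>n. m * (n choose m))"
    by (simp add: choose_linear_sum)
  also have "\<dots> = (\<Sum>m\<in>{1..n}. m * (n choose m))"
    by (rule sum.mono_neutral_right) auto
  also have "\<dots> \<le> (\<Sum>m\<in>{1..n}. Lcm {1..n})"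
    by (intro sum_mono dvd_imp_le[OF binomial_dvd_Lcm Lcm_atLeast1_pos]) auto
  also have "\<dots> = n * Lcm {1..n}" by simp
  finally show ?thesis using Suc by (simp only: mult_le_cancel1 zero_less_Suc simp_thms)
qed simp

section \<open>Chebyshev-type estimates for primes\<close>

lemma prod_primes_dvd:
  fixes m :: nat
  assumes "finite A" "\<And>p. p \<in> A \<Longrightarrow> prime p" "\<And>p. p \<in> A \<Longrightarrow> p dvd m"
  shows "\<Prod>A dvd m"
  using assms
proof (induction A rule: finite_induct)
  case (insert p A)
  have "coprime p (\<Prod>A)"
    using insert by (intro prod_coprime_right primes_coprime) auto
  then show ?case
    using insert by (simp add: divides_mult)
qed simp

text \<open>Erdos's induction. For \<open>n = 2 * m + 1\<close>, all primes above
  \<open>m + 1\<close> divide \<open>n choose m\<close>, which is at most \<open>4 ^ m\<close>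
  because it occurs twice in a row with sum \<open>2 * 4 ^ m\<close>. An even \<open>n\<close> above
  2 contributes no prime.\<close>

lemma primorial_le: "\<Prod>{p. prime p \<and> p \<le> n} \<le> 4 ^ (n :: nat)"
proof (induction n rule: less_induct)
  case (less n)
  have le2: "{p. prime p \<and> p \<le> n} = {}" if "n < 2"
    using that by (auto dest: prime_ge_2_nat)
  consider "n < 2" | "n = 2" | "2 < n" "even n" | "2 < n" "odd n" by linarith
  then show ?case
  proof cases
    case 1
    then show ?thesis by (simp only: le2 prod.empty) simp
  next
    case 2
    have "prime p \<and> p \<le> 2 \<longleftrightarrow> p = 2" for p :: nat
      using prime_ge_2_nat[of p] two_is_prime_nat by (cases "p = 2") auto
    with 2 have "{p. prime p \<and> p \<le> n} = {2}" by simp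
    then show ?thesis by (simp add: 2)
  next
    case 3
    then have "\<not> prime n" using prime_odd_nat by auto
    then have "{p. prime p \<and> p \<le> n} = {p. prime p \<and> p \<le> n - 1}"
      by (auto simp: le_less)
    moreover have "\<Prod>{p. prime p \<and> p \<le> n - 1} \<le> 4 ^ (n - 1)"
      using less 3 by simp
    moreover have "(4 :: nat) ^ (n - 1) \<le> 4 ^ n" by (rule power_increasing) auto
    ultimately show ?thesis by (simp only: order_trans)
  next
    case 4
    then obtain m where n: "n = 2 * m + 1" by (elim oddE)
    have m: "0 < m" using n 4 by simp
    let ?A = "{p. prime p \<and> p \<le> m + 1}" and ?B = "{p. prime p \<and> m + 1 < p \<and> p \<le> n}"
    let ?C = "n choose m"
    have fin: "finite ?A" "finite ?B"
      by (auto intro: finite_subset[of _ "{..n}"] finite_subset[of _ "{..m+1}"])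
    have "p dvd ?C" if p: "p \<in> ?B" for p
    proof -
      have "fact m * fact (n - m) * ?C = fact n"
        by (rule binomial_fact_lemma) (simp add: n)
      then have "p dvd fact m * fact (n - m) * ?C"
        using p by (simp add: prime_dvd_fact_iff)
      moreover have "n - m = m + 1" using n by simp
      ultimately show ?thesis
        using p by (auto simp: prime_dvd_mult_iff prime_dvd_fact_iff simp del: fact_Suc)
    qed
    then have "\<Prod>?B dvd ?C" using fin by (intro prod_primes_dvd) auto
    then have "\<Prod>?B \<le> ?C" by (rule dvd_imp_le) (simp add: n)
    also have "2 * ?C \<le> 2 * 4 ^ m"
    proof -
      have "n choose (n - m) = ?C" by (rule binomial_symmetric[symmetric]) (simp add: n)
      moreover have "n - m = m + 1" by (simp add: n)
      ultimately have "2 * ?C = (\<Sum>k\<in>{m, m + 1}. n choose k)" by simp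
      also have "\<dots> \<le> (\<Sum>k\<le>n. n choose k)" by (rule sum_mono2) (auto simp: n)
      also have "\<dots> = 2 * 4 ^ m" by (simp only: choose_row_sum) (simp add: n power_mult)
      finally show ?thesis .
    qed
    then have "?C \<le> 4 ^ m" by simp
    finally have B: "\<Prod>?B \<le> 4 ^ m" .
    have "{p. prime p \<and> p \<le> n} = ?A \<union> ?B" using n by auto
    then have "\<Prod>{p. prime p \<and> p \<le> n} = \<Prod>?A * \<Prod>?B"
      using fin by (simp add: prod.union_disjoint disjoint_iff)
    also have "\<dots> \<le> 4 ^ (m + 1) * 4 ^ m"
      using less[of "m + 1"] n m B by (intro mult_mono) auto
    also have "\<dots> = 4 ^ n" by (simp add: n flip: power_add)
    finally show ?thesis .
  qed
qed

text \<open>The multiplicity of a prime in a least common multiple is a maximum, so the prime power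
  already divides one of the numbers up to \<open>N\<close>.\<close>

lemma prime_power_dvd_Lcm:
  fixes p :: nat
  assumes p: "prime p" and dvd: "p ^ e dvd Lcm {1..N}" and e: "0 < e"
  shows "p ^ e \<le> N"
  using assms
proof (induction N)
  case 0
  then show ?case
    by (simp add: prime_nat_iff)
next
  case (Suc N)
  have "{1..Suc N} = insert (Suc N) {1..N}" by auto
  then have *: "Lcm {1..Suc N} = lcm (Suc N) (Lcm {1..N})" by simp
  have "p ^ e dvd Suc N \<or> p ^ e dvd Lcm {1..N}"
  proof -
    have "e \<le> multiplicity p (lcm (Suc N) (Lcm {1..N}))"
      using Suc.prems * Lcm_atLeast1_pos[of N]
      by (subst (asm) power_dvd_iff_le_multiplicity) (auto simp: prime_nat_iff)
    also have "\<dots> = max (multiplicity p (Suc N)) (multiplicity p (Lcm {1..N}))"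
      using p Lcm_atLeast1_pos[of N] by (intro multiplicity_lcm) auto
    finally have "e \<le> multiplicity p (Suc N) \<or> e \<le> multiplicity p (Lcm {1..N})"
      by linarith
    then show ?thesis by (auto intro: multiplicity_dvd')
  qed
  then show ?case
    using Suc by (auto dest: dvd_imp_le)
qed

lemma four_mult_square_le_power2:
  assumes "12 \<le> z"
  shows "4 * z ^ 2 \<le> (2 :: nat) ^ (z - 1)"
  using assms
proof (induction z rule: dec_induct)
  case (step z)
  have "4 * Suc z ^ 2 \<le> 2 * (4 * z ^ 2)"
  proof -
    have "12 * z \<le> z * z" using step by (intro mult_right_mono) auto
    then have "4 + 8 * z \<le> 4 * (z * z)" using step(1) by linarith
    then show ?thesis by (simp add: power2_eq_square)
  qed
  also have "\<dots> \<le> 2 * 2 ^ (z - 1)" using step by simp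
  also have "\<dots> = 2 ^ (Suc z - 1)" using step by (cases z) auto
  finally show ?case .
qed simp

text \<open>Without such a prime, the prime powers dividing the least common multiple of 1, ..., 4 z^2
  would be too small: those of primes above 2 z are simple, and the others are at most 4 z^2.\<close>

lemma ex_prime_between_square:
  fixes z :: nat
  assumes z: "12 \<le> z"
  shows "\<exists>p. prime p \<and> z ^ 2 < p \<and> p \<le> 4 * z ^ 2"
proof (rule ccontr)
  assume no: "\<nexists>p. prime p \<and> z ^ 2 < p \<and> p \<le> 4 * z ^ 2"
  define N where "N = 4 * z ^ 2"
  define L where "L = Lcm {1..N}"
  have L: "0 < L" unfolding L_def by (rule Lcm_atLeast1_pos)
  let ?e = "\<lambda>p. multiplicity p L"
  let ?A = "{p. prime p \<and> p \<le> z ^ 2}"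
  have fin: "finite ?A" by (rule finite_subset[of _ "{..z ^ 2}"]) auto
  have power_le: "p ^ ?e p \<le> N" if "p \<in> prime_factors L" for p
  proof -
    have "0 < ?e p" using that by (simp add: prime_factors_multiplicity)
    moreover have "p ^ ?e p dvd Lcm {1..N}" unfolding L_def by (rule multiplicity_dvd)
    ultimately show ?thesis using prime_power_dvd_Lcm that by auto
  qed
  have factors: "prime_factors L \<subseteq> ?A"
  proof
    fix p assume p: "p \<in> prime_factors L"
    then have "0 < ?e p" by (simp add: prime_factors_multiplicity)
    moreover have "1 \<le> p" using in_prime_factors_imp_prime[OF p] by (rule prime_ge_1_nat)
    ultimately have "p ^ 1 \<le> p ^ ?e p" by (intro power_increasing) auto
    then have "p \<le> N" using power_le[OF p] by simp
    then show "p \<in> ?A" using no p unfolding N_def by (auto simp: not_less)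
  qed
  have "L = (\<Prod>p\<in>prime_factors L. p ^ ?e p)"
    using prime_factorization_nat[OF L] by simp
  also have "\<dots> \<le> (\<Prod>p\<in>prime_factors L. p * (if p \<le> 2 * z then N else 1))"
  proof (intro prod_mono conjI)
    fix p assume p: "p \<in> prime_factors L"
    then have p1: "1 \<le> p" by (intro prime_ge_1_nat in_prime_factors_imp_prime)
    show "p ^ ?e p \<le> p * (if p \<le> 2 * z then N else 1)"
    proof (cases "p \<le> 2 * z")
      case True
      have "p ^ ?e p \<le> 1 * N" using power_le[OF p] by simp
      also have "\<dots> \<le> p * N" using p1 by (rule mult_right_mono) simp
      finally show ?thesis using True by simp
    next
      case False
      then have "(2 * z) ^ 2 < p ^ 2" by (intro power_strict_mono) auto
      then have "N < p ^ 2" by (simp add: N_def power_mult_distrib)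
      then have "p ^ ?e p < p ^ 2" using power_le[OF p] by linarith
      then have "?e p < 2" using p1 by (meson not_le power_increasing)
      then have "p ^ ?e p \<le> p ^ 1" using p1 by (intro power_increasing) auto
      then show ?thesis using False by simp
    qed
  qed simp
  also have "\<dots> \<le> (\<Prod>p\<in>?A. p * (if p \<le> 2 * z then N else 1))"
  proof (rule dvd_imp_le)
    show "(\<Prod>p\<in>prime_factors L. p * (if p \<le> 2 * z then N else 1))
        dvd (\<Prod>p\<in>?A. p * (if p \<le> 2 * z then N else 1))"
      by (rule prod_dvd_prod_subset[OF fin factors])
    show "0 < (\<Prod>p\<in>?A. p * (if p \<le> 2 * z then N else 1))"
      using z by (intro prod_pos) (auto simp: N_def prime_gt_0_nat)
  qed
  also have "\<dots> = \<Prod>?A * (\<Prod>p\<in>?A. if p \<le> 2 * z then N else 1)"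
    by (simp add: prod.distrib)
  also have "(\<Prod>p\<in>?A. if p \<le> 2 * z then N else 1) = (\<Prod>p\<in>{p\<in>?A. p \<le> 2 * z}. N)"
    using fin by (intro prod.mono_neutral_cong_right) auto
  \<comment> \<open>The primes themselves contribute at most the primorial of \<open>z ^ 2\<close>;
    the extra factor \<open>N\<close> occurs at most \<open>2 * z\<close> times.\<close>
  also have "\<Prod>?A * (\<Prod>p\<in>{p\<in>?A. p \<le> 2 * z}. N) \<le> 4 ^ (z ^ 2) * N ^ (2 * z)"
  proof (rule mult_mono[OF primorial_le])
    have "card {p\<in>?A. p \<le> 2 * z} \<le> card {1..2 * z}"
      by (rule card_mono) (auto simp: prime_ge_1_nat Suc_le_eq prime_gt_0_nat)
    then have "N ^ card {p\<in>?A. p \<le> 2 * z} \<le> N ^ (2 * z)"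
      using z by (intro power_increasing) (auto simp: N_def)
    then show "(\<Prod>p\<in>{p\<in>?A. p \<le> 2 * z}. N) \<le> N ^ (2 * z)" by simp
  qed auto
  \<comment> \<open>With \<open>N \<le> 2 ^ (z - 1)\<close> everything becomes a power of two with
    exponent \<open>4 * z ^ 2 - 2 * z\<close>, just below the exponent \<open>N - 1\<close> of the
    lower bound.\<close>
  also have "\<dots> \<le> 4 ^ (z ^ 2) * (2 ^ (z - 1)) ^ (2 * z)"
    unfolding N_def using four_mult_square_le_power2[OF z] by (intro mult_left_mono power_mono) auto
  also have "\<dots> = 2 ^ (2 * z ^ 2 + (z - 1) * (2 * z))"
    by (simp add: power_add power_mult flip: power_mult[of 2 2])
  also have "\<dots> < 2 ^ (N - 1)"
  proof (rule power_strict_increasing)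
    have "(z - 1) * (2 * z) = 2 * z ^ 2 - 2 * z"
      by (simp add: algebra_simps power2_eq_square)
    moreover have "2 * z \<le> 2 * z ^ 2" using z by (simp add: power2_eq_square)
    ultimately show "2 * z ^ 2 + (z - 1) * (2 * z) < N - 1"
      using z unfolding N_def by linarith
  qed simp
  also have "\<dots> \<le> L" unfolding L_def by (rule Lcm_ge_power2)
  finally show False by simp
qed

text \<open>The bound \<open>144 * x\<close> is rounded up to the next square \<open>z ^ 2\<close>.
  As \<open>z\<close> is at least 12, neighbouring squares are close,
  \<open>4 * z ^ 2 \<le> 5 * (z - 1) ^ 2\<close>, so the prime above \<open>z ^ 2\<close> is at most
  \<open>720 * x\<close>. The 7 is the number of times that a neighbour can exclude in the
  colouring; 2500 is a generous constant.\<close>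

lemma ex_prime_between_linear:
  fixes x :: nat
  assumes "1 \<le> x"
  shows "\<exists>p. prime p \<and> 7 * x < p \<and> p \<le> 2500 * x"
proof -
  define z where "z = (LEAST z. 144 * x \<le> z ^ 2)"
  have ex: "144 * x \<le> (144 * x) ^ 2" using self_le_power[of "144 * x" 2] assms by simp
  have z: "144 * x \<le> z ^ 2" unfolding z_def by (rule LeastI[of "\<lambda>z. 144 * x \<le> z ^ 2", OF ex])
  have z12: "12 \<le> z"
  proof (rule ccontr)
    assume "\<not> 12 \<le> z"
    then have "z ^ 2 < 12 ^ 2" by (intro power_strict_mono) auto
    then show False using z assms by simp
  qed
  have "\<not> 144 * x \<le> (z - 1) ^ 2"
    using not_less_Least[of "z - 1" "\<lambda>z. 144 * x \<le> z ^ 2"] z12 unfolding z_def[symmetric] by simp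
  moreover have "4 * z ^ 2 \<le> 5 * (z - 1) ^ 2"
  proof -
    obtain y where y: "z = y + 12" using z12 by (metis le_add_diff_inverse2)
    show ?thesis by (simp add: y power2_eq_square algebra_simps)
  qed
  ultimately have "4 * z ^ 2 \<le> 720 * x" by linarith
  moreover obtain p where "prime p" "z ^ 2 < p" "p \<le> 4 * z ^ 2"
    using ex_prime_between_square[OF z12] by blast
  ultimately show ?thesis
    using z by (intro exI[of _ p]) linarith
qed

section \<open>Roots of polynomials modulo a prime\<close>

text \<open>Lagrange's theorem, kept in the integers. Synthetic division at a root \<open>a\<close>
  gives a quotient with the same leading coefficient, and by primality every other root modulo
  \<open>q\<close> is a root of the quotient.\<close>

lemma card_poly_roots_mod_prime:
  fixes p :: "int poly" and q :: nat
  assumes q: "prime q" and lead: "\<not> int q dvd lead_coeff p"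
  shows "card {t. t < q \<and> int q dvd poly p (int t)} \<le> degree p"
  using lead
proof (induction "degree p" arbitrary: p)
  case 0
  then obtain c where "p = [:c:]" by (metis degree_eq_zeroE)
  then show ?case using 0 by simp
next
  case (Suc d)
  let ?R = "\<lambda>p. {t. t < q \<and> int q dvd poly p (int t)}"
  show ?case
  proof (cases "?R p = {}")
    case True
    then show ?thesis by (simp only: card.empty)
  next
    case False
    then obtain a where a: "a < q" "int q dvd poly p (int a)" by auto
    define s where "s = synthetic_div p (int a)"
    have p: "p + smult (int a) s = pCons (poly p (int a)) s"
      unfolding s_def by (rule synthetic_div_correct)
    have deg: "degree s = d" unfolding s_def using Suc by (simp add: degree_synthetic_div)
    have "coeff p (Suc d) + int a * coeff s (Suc d) = coeff s d"
      using arg_cong[OF p, of "\<lambda>p. coeff p (Suc d)"] by simp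
    then have "lead_coeff s = lead_coeff p"
      using deg Suc by (simp add: coeff_eq_0)
    then have IH: "card (?R s) \<le> d" using Suc deg by metis
    have "?R p \<subseteq> insert a (?R s)"
    proof
      fix t assume t: "t \<in> ?R p"
      have "poly p (int t) = (int t - int a) * poly s (int t) + poly p (int a)"
        using arg_cong[OF p, of "\<lambda>p. poly p (int t)"] by (simp add: algebra_simps)
      then have "int q dvd (int t - int a) * poly s (int t)"
        using t a(2) by (simp add: dvd_add_left_iff)
      then have "int q dvd (int t - int a) \<or> int q dvd poly s (int t)"
        using q by (simp add: prime_dvd_mult_iff)
      moreover have "t = a" if "int q dvd (int t - int a)"
      proof -
        have "int t mod int q = int a mod int q" using that by (simp add: mod_eq_dvd_iff)
        then show ?thesis using t a(1) by simp
      qed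
      ultimately show "t \<in> insert a (?R s)" using t by auto
    qed
    then have "card (?R p) \<le> card (insert a (?R s))" by (intro card_mono) auto
    also have "\<dots> \<le> Suc (card (?R s))" by (simp add: card_insert_if)
    finally show ?thesis using IH Suc by simp
  qed
qed

section \<open>Colouring with a linear number of colours\<close>

text \<open>Only larger numbers serve as parents: paths then increase strictly, and every edge
  occurs in the forest given by the position of its larger endpoint in the list of the smaller
  one.\<close>

function forest_parity :: "nat list list \<Rightarrow> nat \<Rightarrow> nat \<Rightarrow> nat" where
  "forest_parity nbrs i v =
    (if v < length nbrs \<and> i < length (nbrs ! v) \<and> v < nbrs ! v ! i
     then 1 - forest_parity nbrs i (nbrs ! v ! i) else 0)"
  by auto
termination
  by (relation "measure (\<lambda>(nbrs, i, v). length nbrs - v)") auto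

declare forest_parity.simps [simp del]

lemma forest_parity_le_1: "forest_parity nbrs i v \<le> 1"
  by (subst forest_parity.simps) auto

text \<open>The first parity is the most significant bit. In this order a residue of the label can
  be accumulated by Horner's rule, one parity at a time.\<close>

fun label :: "nat list list \<Rightarrow> nat \<Rightarrow> nat \<Rightarrow> nat" where
  "label nbrs 0 v = 0"
| "label nbrs (Suc i) v = 2 * label nbrs i v + forest_parity nbrs i v"

lemma label_less: "label nbrs k v < 2 ^ k"
proof (induction k)
  case (Suc k)
  then show ?case using forest_parity_le_1[of nbrs k v] by simp
qed simp

lemma label_eqD:
  assumes "label nbrs k u = label nbrs k v" "i < k"
  shows "forest_parity nbrs i u = forest_parity nbrs i v"
  using assms
proof (induction k)
  case (Suc k)
  have eq: "2 * label nbrs k u + forest_parity nbrs k u = 2 * label nbrs k v + forest_parity nbrs k v"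
    using Suc.prems(1) by simp
  have "label nbrs k u = label nbrs k v \<and> forest_parity nbrs k u = forest_parity nbrs k v"
    using eq forest_parity_le_1[of nbrs k v] forest_parity_le_1[of nbrs k u] by presburger
  then show ?case using Suc by (cases "i = k") auto
qed simp

section \<open>Kernels of acyclic relations\<close>

text \<open>The kernel of a directed graph in the sense of game theory: the positions from which no
  move \<open>R x y\<close> leads into the kernel. \<open>wfrec\<close> makes it a total definition;
  the recursion equation needs a rank that decreases along moves.\<close>

definition kernel :: "(nat \<Rightarrow> nat \<Rightarrow> bool) \<Rightarrow> nat \<Rightarrow> bool" where
  "kernel R = wfrec {(y, x). R x y} (\<lambda>f x. \<forall>y. R x y \<longrightarrow> \<not> f y)"

lemma kernel_iff:
  fixes rank :: "nat \<Rightarrow> nat"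
  assumes "\<And>x y. R x y \<Longrightarrow> rank y < rank x"
  shows "kernel R x \<longleftrightarrow> (\<forall>y. R x y \<longrightarrow> \<not> kernel R y)"
proof -
  have wf: "wf {(y, x). R x y}"
    by (rule wf_subset[OF wf_measure[of rank]]) (auto simp: assms)
  show ?thesis
    unfolding kernel_def by (subst wfrec[OF wf]) (simp add: cut_apply)
qed

text \<open>\<open>D\<close> stands for the maximum degree raised to at least 1. The factor 7 in
  \<open>q_gt\<close> is 3 + 4: times lost to a neighbour's walk and to its final value.\<close>

locale coloured_graph =
  fixes n :: nat and E :: "(nat \<times> nat) set" and nbrs :: "nat list list" and D q :: nat
  assumes graph: "simple_graph n E"
    and length_nbrs: "length nbrs = n"
    and set_nbrs: "v < n \<Longrightarrow> set (nbrs ! v) = E `` {v}"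
    and degree_le: "v < n \<Longrightarrow> length (nbrs ! v) \<le> D"
    and D_pos: "1 \<le> D"
    and prime_q: "prime q"
    and q_gt: "7 * D < q"
begin

lemma edge_less: "(u, v) \<in> E \<Longrightarrow> u < n \<and> v < n"
  using graph by (auto simp: simple_graph_def)

lemma edge_sym: "(u, v) \<in> E \<Longrightarrow> (v, u) \<in> E"
  using graph by (auto simp: simple_graph_def dest: symD)

lemma edge_irrefl: "(v, v) \<notin> E"
  using graph by (auto simp: simple_graph_def irrefl_def)

lemma finite_neighbours: "finite (E `` {v})"
  by (rule finite_subset[of _ "{..<n}"]) (auto dest: edge_less)

lemma card_neighbours: "v < n \<Longrightarrow> card (E `` {v}) \<le> D"
  using card_length[of "nbrs ! v"] degree_le[of v] set_nbrs[of v] by simp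

lemma q_pos: "0 < q"
  using q_gt by simp

lemma label_neq:
  assumes "(u, v) \<in> E"
  shows "label nbrs D u \<noteq> label nbrs D v"
proof -
  have *: "label nbrs D u \<noteq> label nbrs D v" if "(u, v) \<in> E" "u < v" for u v
  proof
    assume eq: "label nbrs D u = label nbrs D v"
    have u: "u < n" using that edge_less by blast
    then have "v \<in> set (nbrs ! u)" using that set_nbrs by auto
    then obtain i where i: "i < length (nbrs ! u)" "nbrs ! u ! i = v"
      by (auto simp: in_set_conv_nth)
    then have "i < D" using degree_le[OF u] by simp
    then have "forest_parity nbrs i u = forest_parity nbrs i v"
      by (rule label_eqD[OF eq])
    moreover have "forest_parity nbrs i u = 1 - forest_parity nbrs i v"
      using i u that length_nbrs by (subst forest_parity.simps) simp
    ultimately show False using forest_parity_le_1[of nbrs i v] by presburger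
  qed
  have "u \<noteq> v" using assms edge_irrefl by auto
  then show ?thesis
    using *[of u v] *[of v u] assms edge_sym[OF assms] by (cases "u < v") auto
qed

section \<open>Separating moduli and residues\<close>

definition separating_modulus :: "nat \<Rightarrow> nat" where
  "separating_modulus v = (LEAST r. 1 \<le> r \<and>
     (\<forall>u. (v, u) \<in> E \<longrightarrow> label nbrs D u mod r \<noteq> label nbrs D v mod r))"

text \<open>Otherwise the product of the label differences, which is less than 2^(D^2), would be
  divisible by the least common multiple of 1, ..., D^2 + 1.\<close>

lemma ex_separating_modulus:
  assumes v: "v < n"
  shows "\<exists>r. r \<le> D ^ 2 + 1 \<and> 1 \<le> r \<and>
    (\<forall>u. (v, u) \<in> E \<longrightarrow> label nbrs D u mod r \<noteq> label nbrs D v mod r)"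
proof (rule ccontr)
  assume no: "\<not> ?thesis"
  define d where "d = (\<lambda>u. nat \<bar>int (label nbrs D u) - int (label nbrs D v)\<bar>)"
  define M where "M = (\<Prod>u\<in>E `` {v}. d u)"
  have dpos: "0 < d u" if "u \<in> E `` {v}" for u
    using label_neq[of v u] that by (simp add: d_def)
  have dle: "d u \<le> 2 ^ D - 1" for u
    using label_less[of nbrs D u] label_less[of nbrs D v] unfolding d_def by linarith
  have "r dvd M" if r: "r \<in> {1..D ^ 2 + 1}" for r
  proof -
    obtain u where u: "(v, u) \<in> E" "label nbrs D u mod r = label nbrs D v mod r"
      using no r by auto
    then have "int (label nbrs D u) mod int r = int (label nbrs D v) mod int r"
      by (metis zmod_int)
    then have "int r dvd int (d u)"
      unfolding d_def by (simp add: mod_eq_dvd_iff)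
    then have "r dvd d u" by simp
    also have "d u dvd M" unfolding M_def using u finite_neighbours by (intro dvd_prodI) auto
    finally show ?thesis .
  qed
  then have "Lcm {1..D ^ 2 + 1} dvd M" by (intro Lcm_least) auto
  moreover have "0 < M" unfolding M_def by (intro prod_pos) (rule dpos)
  ultimately have "Lcm {1..D ^ 2 + 1} \<le> M" by (rule dvd_imp_le)
  moreover have "2 ^ D ^ 2 \<le> Lcm {1..D ^ 2 + 1}" using Lcm_ge_power2[of "D ^ 2 + 1"] by simp
  moreover have "M < 2 ^ D ^ 2"
  proof -
    \<comment> \<open>The base must not be 0 when the exponent is raised from the actual degree to
      \<open>D\<close>; \<open>D_pos\<close> ensures this, and the strictness of the last estimate
      as well.\<close>
    have one: "(1 :: nat) \<le> 2 ^ D - 1" using D_pos self_le_power[of "2 :: nat" D] by simp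
    have "M \<le> (\<Prod>u\<in>E `` {v}. 2 ^ D - 1)" unfolding M_def by (intro prod_mono conjI dle) simp
    also have "\<dots> = (2 ^ D - 1) ^ card (E `` {v})" by simp
    also have "\<dots> \<le> (2 ^ D - 1) ^ D" by (rule power_increasing[OF card_neighbours[OF v] one])
    also have "\<dots> < (2 ^ D) ^ D" using D_pos by (intro power_strict_mono) auto
    also have "\<dots> = 2 ^ D ^ 2" by (simp add: power2_eq_square flip: power_mult)
    finally show ?thesis .
  qed
  ultimately show False by simp
qed

lemma
  assumes v: "v < n"
  shows separating_modulus_le: "separating_modulus v \<le> D ^ 2 + 1"
    and separating_modulus_pos: "1 \<le> separating_modulus v"
    and separating_modulus: "(v, u) \<in> E \<Longrightarrow>
      label nbrs D u mod separating_modulus v \<noteq> label nbrs D v mod separating_modulus v"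
proof -
  let ?P = "\<lambda>r. 1 \<le> r \<and> (\<forall>u. (v, u) \<in> E \<longrightarrow> label nbrs D u mod r \<noteq> label nbrs D v mod r)"
  obtain r where r: "r \<le> D ^ 2 + 1" "?P r" using ex_separating_modulus[OF v] by blast
  have P: "?P (separating_modulus v)"
    unfolding separating_modulus_def by (rule LeastI[of ?P, OF r(2)])
  have "separating_modulus v \<le> r"
    unfolding separating_modulus_def by (rule Least_le[of ?P, OF r(2)])
  then show "separating_modulus v \<le> D ^ 2 + 1" using r(1) by simp
  show "1 \<le> separating_modulus v" "(v, u) \<in> E \<Longrightarrow>
      label nbrs D u mod separating_modulus v \<noteq> label nbrs D v mod separating_modulus v"
    using P by auto
qed

definition residue_label :: "nat \<Rightarrow> nat" where
  "residue_label v = label nbrs D v mod separating_modulus v"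

lemma D2_less_q2: "D ^ 2 + 1 < q ^ 2"
proof -
  have "D ^ 2 + 1 \<le> (D + 1) ^ 2" by (simp add: power2_eq_square)
  also have "\<dots> < q ^ 2" using q_gt D_pos by (intro power_strict_mono) auto
  finally show ?thesis .
qed

lemma separating_modulus_less: "v < n \<Longrightarrow> separating_modulus v < q ^ 2"
  using separating_modulus_le[of v] D2_less_q2 by simp

lemma residue_label_less: "v < n \<Longrightarrow> residue_label v < q ^ 2"
  using separating_modulus_pos[of v] separating_modulus_less[of v]
  unfolding residue_label_def by (meson less_trans mod_less_divisor less_le_trans zero_less_one)

text \<open>Adjacent vertices may use different moduli and then have equal residues, so only the
  pair of modulus and residue is a proper colour.\<close>

lemma residue_label_neq:
  assumes "(v, u) \<in> E" "separating_modulus v = separating_modulus u"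
  shows "residue_label v \<noteq> residue_label u"
  using separating_modulus[of v u] edge_less[OF assms(1)] assms unfolding residue_label_def by auto

section \<open>Polynomial walks\<close>

text \<open>Modulus and residue are below \<open>q ^ 2\<close>, so two base-\<open>q\<close> digits
  of each determine them; these are the four lower coefficients.\<close>

definition walk_poly :: "nat \<Rightarrow> int poly" where
  "walk_poly v = [:int (residue_label v mod q), int (residue_label v div q),
     int (separating_modulus v mod q), int (separating_modulus v div q), 1:]"

definition walk :: "nat \<Rightarrow> nat \<Rightarrow> nat" where
  "walk v t = ((((t + separating_modulus v div q) * t + separating_modulus v mod q) * t
     + residue_label v div q) * t + residue_label v mod q) mod q"

lemma walk_eq_poly: "int (walk v t) = poly (walk_poly v) (int t) mod int q"
  unfolding walk_def walk_poly_def of_nat_mod by (simp add: algebra_simps zmod_int)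

lemma walk_less: "walk v t < q"
  using q_pos by (simp add: walk_def)

text \<open>Subtracting a constant leaves a monic quartic, whatever the digits are.\<close>

lemma card_walk_eq_const: "card {t. t < q \<and> walk v t = c} \<le> 4"
proof -
  let ?p = "walk_poly v - [:int c:]"
  have deg: "degree ?p = 4" "lead_coeff ?p = 1"
    by (simp_all add: walk_poly_def)
  have "{t. t < q \<and> walk v t = c} \<subseteq> {t. t < q \<and> int q dvd poly ?p (int t)}"
    using walk_less[of v] by (auto simp: mod_eq_dvd_iff[symmetric] walk_eq_poly[symmetric])
  then have "card {t. t < q \<and> walk v t = c} \<le> card {t. t < q \<and> int q dvd poly ?p (int t)}"
    by (intro card_mono) auto
  also have "\<dots> \<le> degree ?p"
    using prime_gt_1_nat[OF prime_q] deg by (intro card_poly_roots_mod_prime[OF prime_q]) simp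
  finally show ?thesis by (simp only: deg)
qed

lemma digits_eqD:
  fixes a b :: nat
  assumes "a div q = b div q" "a mod q = b mod q"
  shows "a = b"
  using assms by (metis div_mult_mod_eq)

text \<open>The leading terms cancel. The remaining coefficients are differences of digits, smaller
  than \<open>q\<close> in absolute value, and not all zero because adjacent vertices have different
  pairs; hence the leading one is not divisible by \<open>q\<close>.\<close>

lemma card_walk_eq_walk:
  assumes e: "(v, u) \<in> E"
  shows "card {t. t < q \<and> walk u t = walk v t} \<le> 3"
proof -
  let ?p = "walk_poly u - walk_poly v"
  have less: "v < n" "u < n" using edge_less[OF e] by auto
  have digit: "separating_modulus w div q < q" "residue_label w div q < q" if "w < n" for w
    using separating_modulus_less[OF that] residue_label_less[OF that]
    by (simp_all add: less_mult_imp_div_less power2_eq_square)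
  have diff: "\<bar>int a - int b\<bar> < int q" if "a < q" "b < q" for a b
    using that by linarith
  have coeff_less: "\<bar>coeff ?p i\<bar> < int q" for i
    using digit[OF less(1)] digit[OF less(2)] q_pos
    by (auto simp: walk_poly_def coeff_pCons diff split: nat.split)
  have nz: "?p \<noteq> 0"
  proof
    assume "?p = 0"
    then have "residue_label u = residue_label v \<and> separating_modulus u = separating_modulus v"
      by (auto simp: walk_poly_def intro: digits_eqD)
    then show False using residue_label_neq[OF e] by simp
  qed
  have deg: "degree ?p \<le> 3"
    by (simp add: walk_poly_def degree_pCons_le)
  have "\<not> int q dvd lead_coeff ?p"
    using coeff_less[of "degree ?p"] dvd_imp_le_int[of "lead_coeff ?p" "int q"] nz
    by (metis abs_of_nat leading_coeff_0_iff not_le)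
  then have "card {t. t < q \<and> int q dvd poly ?p (int t)} \<le> degree ?p"
    by (rule card_poly_roots_mod_prime[OF prime_q])
  moreover have "{t. t < q \<and> walk u t = walk v t} \<subseteq> {t. t < q \<and> int q dvd poly ?p (int t)}"
    by (auto simp: mod_eq_dvd_iff[symmetric] walk_eq_poly[symmetric])
  then have "card {t. t < q \<and> walk u t = walk v t} \<le> card {t. t < q \<and> int q dvd poly ?p (int t)}"
    by (intro card_mono) auto
  ultimately show ?thesis using deg by simp
qed

section \<open>Stopping times and the colouring\<close>

definition valid_time :: "nat \<Rightarrow> nat \<Rightarrow> bool" where
  "valid_time v t \<longleftrightarrow> (\<forall>u. (v, u) \<in> E \<longrightarrow> walk u t \<noteq> walk v t)"

text \<open>The node v * q + t stands for the attempt of vertex v to stop its walk at time t.\<close>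

definition blocks_stop :: "nat \<Rightarrow> nat \<Rightarrow> bool" where
  "blocks_stop x y \<longleftrightarrow> y < n * q \<and> y mod q < x mod q \<and> valid_time (y div q) (y mod q) \<and>
     (y div q = x div q \<or>
      (x div q, y div q) \<in> E \<and> walk (y div q) (y mod q) = walk (x div q) (x mod q))"

definition stops_at :: "nat \<Rightarrow> nat \<Rightarrow> bool" where
  "stops_at v t \<longleftrightarrow> valid_time v t \<and> kernel blocks_stop (v * q + t)"

lemma blocks_stop_rank: "blocks_stop x y \<Longrightarrow> y mod q < x mod q"
  by (simp add: blocks_stop_def)

lemmas kernel_blocks_stop = kernel_iff[of blocks_stop "\<lambda>x. x mod q", OF blocks_stop_rank]

lemma node_less: "v < n \<Longrightarrow> t < q \<Longrightarrow> v * q + t < n * q"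
proof -
  assume "v < n" "t < q"
  then have "v * q + t < Suc v * q" by simp
  also have "\<dots> \<le> n * q" using \<open>v < n\<close> by (intro mult_right_mono) auto
  finally show ?thesis .
qed

lemma blocks_stop_node:
  assumes "u < n" "s < q" "t < q"
  shows "blocks_stop (v * q + t) (u * q + s) \<longleftrightarrow> s < t \<and> valid_time u s \<and>
    (u = v \<or> (v, u) \<in> E \<and> walk u s = walk v t)"
  using assms node_less[of u s] q_pos by (simp add: blocks_stop_def)

text \<open>The clause for equal vertices in \<open>blocks_stop\<close> lets a successful stop block
  all later attempts of the same vertex.\<close>

lemma stops_at_unique:
  assumes "v < n" "s < q" "t < q" "stops_at v s" "stops_at v t"
  shows "s = t"
proof -
  have False if "s < t" "t < q" "stops_at v s" "stops_at v t" for s t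
    using that assms(1) kernel_blocks_stop[of "v * q + t"] blocks_stop_node[of v s t v]
    by (auto simp: stops_at_def)
  from this[of s t] this[of t s] show ?thesis
    using assms by (cases s t rule: linorder_cases) auto
qed

text \<open>A vertex that never stops has at most 3 D invalid times, and each neighbour blocks at most
  4 further times.\<close>

lemma ex_stops_at:
  assumes v: "v < n"
  shows "\<exists>t<q. stops_at v t"
proof (rule ccontr)
  assume never: "\<not> (\<exists>t<q. stops_at v t)"
  define A where "A = (\<lambda>u. {t. t < q \<and> walk u t = walk v t})"
  define B where "B = (\<lambda>u. {t. t < q \<and> (\<exists>s<q. stops_at u s \<and> walk u s = walk v t)})"
  have A: "card (A u) \<le> 3" if "u \<in> E `` {v}" for u
    using card_walk_eq_walk[of v u] that unfolding A_def by simp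
  have B: "card (B u) \<le> 4" if "u \<in> E `` {v}" for u
  proof (cases "\<exists>s<q. stops_at u s")
    case True
    then obtain s where s: "s < q" "stops_at u s" by blast
    have "u < n" using that edge_less by auto
    \<comment> \<open>The neighbour stops only once, so it blocks a single value, which the walk of
      \<open>v\<close> takes at most four times.\<close>
    then have "B u \<subseteq> {t. t < q \<and> walk v t = walk u s}"
      unfolding B_def using stops_at_unique s by fastforce
    then have "card (B u) \<le> card {t. t < q \<and> walk v t = walk u s}"
      by (intro card_mono) auto
    then show ?thesis using card_walk_eq_const[of v "walk u s"] by simp
  next
    case False
    then have "B u = {}" unfolding B_def by auto
    then show ?thesis by simp
  qed
  have "card (\<Union>u\<in>E `` {v}. A u \<union> B u) \<le> (\<Sum>u\<in>E `` {v}. card (A u \<union> B u))"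
    by (rule card_UN_le[OF finite_neighbours])
  also have "\<dots> \<le> (\<Sum>u\<in>E `` {v}. 7)"
  proof (rule sum_mono)
    fix u assume "u \<in> E `` {v}"
    then show "card (A u \<union> B u) \<le> 7"
      using A[of u] B[of u] card_Un_le[of "A u" "B u"] by simp
  qed
  also have "\<dots> \<le> 7 * D" using card_neighbours[OF v] by simp
  also have "\<dots> < card {..<q}" using q_gt by simp
  finally have "card (\<Union>u\<in>E `` {v}. A u \<union> B u) < card {..<q}" .
  moreover have "finite (\<Union>u\<in>E `` {v}. A u \<union> B u)"
    using finite_neighbours by (auto simp: A_def B_def)
  ultimately have "\<not> {..<q} \<subseteq> (\<Union>u\<in>E `` {v}. A u \<union> B u)"
    by (meson card_mono not_le)
  then obtain t where t: "t < q" "\<And>u. (v, u) \<in> E \<Longrightarrow> t \<notin> A u \<and> t \<notin> B u"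
    by auto
  have valid: "valid_time v t"
    using t unfolding valid_time_def A_def by auto
  have "\<not> kernel blocks_stop y" if y: "blocks_stop (v * q + t) y" for y
  proof
    assume k: "kernel blocks_stop y"
    define u s where "u = y div q" and "s = y mod q"
    have y': "y = u * q + s" by (simp add: u_def s_def)
    have s: "s < q" using q_pos by (simp add: s_def)
    have u: "u < n" using y unfolding u_def blocks_stop_def by (simp add: less_mult_imp_div_less)
    have b: "s < t" "valid_time u s" "u = v \<or> (v, u) \<in> E \<and> walk u s = walk v t"
      using y t(1) s u by (simp_all add: y' blocks_stop_node)
    have stop: "stops_at u s" using k b(2) by (simp add: stops_at_def y')
    show False
      using b(3)
    proof
      assume "u = v"
      then show False using never stop s by auto
    next
      assume "(v, u) \<in> E \<and> walk u s = walk v t"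
      then show False using t s stop unfolding B_def by auto
    qed
  qed
  then have "kernel blocks_stop (v * q + t)" using kernel_blocks_stop by blast
  then show False using never t(1) valid by (auto simp: stops_at_def)
qed

definition stop_time :: "nat \<Rightarrow> nat" where
  "stop_time v = (LEAST t. stops_at v t)"

definition colour :: "nat \<Rightarrow> nat" where
  "colour v = walk v (stop_time v)"

lemma
  assumes "v < n"
  shows stops_at_stop_time: "stops_at v (stop_time v)"
    and stop_time_less: "stop_time v < q"
proof -
  obtain t where t: "t < q" "stops_at v t" using ex_stops_at[OF assms] by blast
  show "stops_at v (stop_time v)" unfolding stop_time_def by (rule LeastI[of "stops_at v", OF t(2)])
  have "stop_time v \<le> t" unfolding stop_time_def by (rule Least_le[of "stops_at v", OF t(2)])
  then show "stop_time v < q" using t(1) by simp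
qed

lemma colour_less: "colour v < q"
  by (simp add: colour_def walk_less)

text \<open>If both vertices stop at the same time, validity of that time separates their values;
  otherwise the earlier stop would block the later one with the same value.\<close>

lemma colour_neq:
  assumes e: "(v, u) \<in> E"
  shows "colour v \<noteq> colour u"
proof
  assume eq: "colour v = colour u"
  have less: "v < n" "u < n" using edge_less[OF e] by auto
  have False if "(v, u) \<in> E" "colour v = colour u" "stop_time u \<le> stop_time v" "v < n" "u < n" for u v
  proof (cases "stop_time u = stop_time v")
    case True
    then show False
      using that stops_at_stop_time[of v] unfolding stops_at_def valid_time_def colour_def by auto
  next
    case False
    have "blocks_stop (v * q + stop_time v) (u * q + stop_time u)"
      using that False stop_time_less stops_at_stop_time[of u]
      by (auto simp: blocks_stop_node stops_at_def colour_def)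
    then show False
      using that stops_at_stop_time kernel_blocks_stop unfolding stops_at_def by blast
  qed
  from this[of v u] this[of u v] show False
    using e edge_sym[OF e] eq less by (cases "stop_time u \<le> stop_time v") auto
qed

section \<open>The greedy maximal independent set\<close>

definition blocks_vertex :: "nat \<Rightarrow> nat \<Rightarrow> bool" where
  "blocks_vertex v u \<longleftrightarrow> (v, u) \<in> E \<and> colour u < colour v"

lemma blocks_vertex_rank: "blocks_vertex v u \<Longrightarrow> colour u < colour v"
  by (simp add: blocks_vertex_def)

lemmas kernel_blocks_vertex = kernel_iff[of blocks_vertex colour, OF blocks_vertex_rank]

text \<open>Colours of adjacent vertices differ, so each edge is a blocking pair in one direction
  and cannot join two members of the kernel. A vertex outside the kernel is blocked by a neighbour
  inside.\<close>

lemma maximal_independent_set_kernel: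
  "maximal_independent_set n E {v. v < n \<and> kernel blocks_vertex v}"
proof -
  let ?S = "{v. v < n \<and> kernel blocks_vertex v}"
  have indep: "(u, v) \<notin> E" if "u \<in> ?S" "v \<in> ?S" for u v
  proof
    assume e: "(u, v) \<in> E"
    then have "blocks_vertex u v \<or> blocks_vertex v u"
      using colour_neq[OF e] edge_sym[OF e] by (auto simp: blocks_vertex_def)
    then show False using that kernel_blocks_vertex by blast
  qed
  moreover have "T = ?S" if T: "independent_set n E T" "?S \<subseteq> T" for T
  proof -
    have "v \<in> ?S" if v: "v \<in> T" for v
    proof (rule ccontr)
      assume "v \<notin> ?S"
      moreover have "v < n" using T v by (auto simp: independent_set_def)
      ultimately obtain u where u: "blocks_vertex v u" "kernel blocks_vertex u"
        using kernel_blocks_vertex by blast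
      then have "(v, u) \<in> E" by (simp add: blocks_vertex_def)
      moreover from this have "u \<in> T" using u T(2) edge_less by auto
      ultimately show False using T(1) v by (auto simp: independent_set_def)
    qed
    then show ?thesis using T(2) by blast
  qed
  ultimately show ?thesis
    by (auto simp: maximal_independent_set_def independent_set_def)
qed

end

section \<open>Structured programs\<close>

definition exec_at :: "nat \<Rightarrow> nat list \<Rightarrow> instr list \<Rightarrow> config \<Rightarrow> config" where
  "exec_at w inp P c = exec_instr w inp (P ! pc c) c"

definition same_cells :: "nat \<Rightarrow> config \<Rightarrow> config \<Rightarrow> bool" where
  "same_cells s c d \<longleftrightarrow> pc c = pc d \<and> (\<forall>a<s. mem c a = mem d a)"

text \<open>Instructions never read the output, and cells beyond the accessible ones cannot
  influence the step, so program counter and accessible cells determine their successors.\<close>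

lemma exec_instr_same_cells:
  assumes "same_cells s c d" "accessed_cells i c \<subseteq> {..<s}"
  shows "same_cells s (exec_instr w inp i c) (exec_instr w inp i d)"
  using assms by (cases i) (auto simp: same_cells_def assign_def)

lemma exec_instr_mem_less:
  assumes "\<forall>a. mem c a < 2 ^ w"
  shows "mem (exec_instr w inp i c) a < 2 ^ w"
proof -
  have "apply_binop w f x y < 2 ^ w" for f x y
    by (cases f) (simp_all only: apply_binop.simps take_bit_nat_less_exp)
  then show ?thesis using assms
    by (cases i) (auto simp: assign_def)
qed

lemma relpow_step_eq_funpow:
  assumes "(c, d) \<in> step w s inp P ^^ t"
  shows "d = (exec_at w inp P ^^ t) c"
  using assms by (induction t arbitrary: d) (auto simp: step_def exec_at_def)

lemma relpow_step_prefix: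
  assumes "(c, d) \<in> step w s inp P ^^ t" "i < t"
  shows "pc ((exec_at w inp P ^^ i) c) < length P \<and>
    accessed_cells (P ! pc ((exec_at w inp P ^^ i) c)) ((exec_at w inp P ^^ i) c) \<subseteq> {..<s}"
proof -
  obtain k where t: "t = i + Suc k"
    using assms(2) by (metis less_imp_Suc_add add_Suc_right)
  obtain e where e: "(c, e) \<in> step w s inp P ^^ i" "(e, d) \<in> step w s inp P ^^ Suc k"
    using assms(1) unfolding t by (auto simp: relpow_add)
  obtain e' where "(e, e') \<in> step w s inp P"
    using e(2) by (rule relpow_Suc_E2)
  then show ?thesis
    using relpow_step_eq_funpow[OF e(1)] by (auto simp: step_def)
qed

text \<open>A halting computation repeats no pair of program counter and memory contents.\<close>

lemma halting_time_le:
  assumes "halts_with w inp P t s xs"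
  shows "t \<le> length P * (2 ^ w) ^ s"
proof -
  define f where "f = exec_at w inp P"
  define c where "c = (\<lambda>i. (f ^^ i) initial_config)"
  obtain d where d: "(initial_config, d) \<in> step w s inp P ^^ t" "length P \<le> pc d"
    using assms by (auto simp: halts_with_def)
  have ct: "c t = d"
    using relpow_step_eq_funpow[OF d(1)] by (simp add: c_def f_def)
  have ok: "pc (c i) < length P" "accessed_cells (P ! pc (c i)) (c i) \<subseteq> {..<s}" if "i < t" for i
    using relpow_step_prefix[OF d(1) that] by (auto simp: c_def f_def)
  have Suc_c: "c (Suc i) = exec_instr w inp (P ! pc (c i)) (c i)" for i
    by (simp add: c_def f_def exec_at_def)
  have bound: "mem (c i) a < 2 ^ w" for i a
    by (induction i arbitrary: a)
      (auto simp: Suc_c exec_instr_mem_less, simp add: c_def initial_config_def)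
  have distinct_cells: False if "i < j" "j < t" "same_cells s (c i) (c j)" for i j
  proof -
    have "same_cells s (c (i + k)) (c (j + k))" if "j + k \<le> t" for k
      using that
    proof (induction k)
      case 0
      then show ?case using \<open>same_cells s (c i) (c j)\<close> by simp
    next
      case (Suc k)
      then have IH: "same_cells s (c (i + k)) (c (j + k))" by simp
      have "accessed_cells (P ! pc (c (i + k))) (c (i + k)) \<subseteq> {..<s}"
        using ok(2) Suc.prems \<open>i < j\<close> by simp
      moreover have "pc (c (j + k)) = pc (c (i + k))"
        using IH by (simp add: same_cells_def)
      ultimately show ?case
        using exec_instr_same_cells[OF IH] by (simp add: Suc_c)
    qed
    \<comment> \<open>The repetition is shifted to the end: the halting program counter of
      \<open>d\<close> would already occur at time \<open>i + (t - j)\<close>, which is less than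
      \<open>t\<close>, while the machine still runs.\<close>
    from this[of "t - j"] have "pc (c (i + (t - j))) = pc d"
      using that ct by (simp add: same_cells_def)
    moreover have "pc (c (i + (t - j))) < length P"
      using ok(1) that by simp
    ultimately show False using d(2) by simp
  qed
  define key where "key = (\<lambda>i. (pc (c i), restrict (mem (c i)) {..<s}))"
  have "inj_on key {..<t}"
  proof (rule linorder_inj_onI)
    fix i j assume ij: "i < j" "i \<in> {..<t}" "j \<in> {..<t}"
    show "key i \<noteq> key j"
    proof
      assume "key i = key j"
      then have "pc (c i) = pc (c j)" "\<And>a. restrict (mem (c i)) {..<s} a = restrict (mem (c j)) {..<s} a"
        by (auto simp: key_def)
      then have "same_cells s (c i) (c j)"
        unfolding same_cells_def by (metis restrict_apply' lessThan_iff)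
      then show False using distinct_cells ij by auto
    qed
  qed auto
  moreover have "key ` {..<t} \<subseteq> {..<length P} \<times> ({..<s} \<rightarrow>\<^sub>E {..<2 ^ w})"
    using ok(1) bound by (auto simp: key_def PiE_iff extensional_def split: if_splits)
  ultimately have "card {..<t} \<le> card ({..<length P} \<times> ({..<s} \<rightarrow>\<^sub>E {..<2 ^ w :: nat}))"
    by (intro card_inj_on_le) (auto intro!: finite_PiE)
  then show ?thesis
    by (simp add: card_cartesian_product card_PiE)
qed

section \<open>A structured language and its compilation\<close>

text \<open>Less-than is the only test. As cells 0 and 2 will hold 0 and 1,
  \<open>IfLess 0 b\<close> tests cell \<open>b\<close> for being nonzero and
  \<open>WhileLess a 2\<close> repeats while cell \<open>a\<close> is 0.\<close>

datatype com =
    Skip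
  | Basic instr
  | Seq com com (infixr ";;" 60)
  | IfLess nat nat com com
  | WhileLess nat nat com

fun code_size :: "com \<Rightarrow> nat" where
  "code_size Skip = 0"
| "code_size (Basic i) = 1"
| "code_size (c ;; d) = code_size c + code_size d"
| "code_size (IfLess a b c d) = code_size c + code_size d + 2"
| "code_size (WhileLess a b c) = code_size c + 3"

text \<open>Jump targets are absolute, so the start address \<open>p\<close> is passed along. The
  else branch comes first because \<open>JumpLess\<close> falls through when the comparison
  fails.\<close>

fun compile :: "nat \<Rightarrow> com \<Rightarrow> instr list" where
  "compile p Skip = []"
| "compile p (Basic i) = [i]"
| "compile p (c ;; d) = compile p c @ compile (p + code_size c) d"
| "compile p (IfLess a b c d) =
     [JumpLess a b (p + 2 + code_size d)] @ compile (p + 1) d @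
     [Jump (p + 2 + code_size d + code_size c)] @ compile (p + 2 + code_size d) c"
| "compile p (WhileLess a b c) =
     [JumpLess a b (p + 2), Jump (p + 3 + code_size c)] @ compile (p + 2) c @ [Jump p]"

lemma length_compile [simp]: "length (compile p c) = code_size c"
  by (induction c arbitrary: p) auto

fun is_jump :: "instr \<Rightarrow> bool" where
  "is_jump (Jump l) = True"
| "is_jump (JumpZero a l) = True"
| "is_jump (JumpLess a b l) = True"
| "is_jump _ = False"

type_synonym state = "(nat \<Rightarrow> nat) \<times> nat list"

definition conf :: "nat \<Rightarrow> state \<Rightarrow> config" where
  "conf p \<sigma> = \<lparr>pc = p, mem = fst \<sigma>, written = snd \<sigma>\<rparr>"

text \<open>The access condition of \<open>step\<close> is part of the rules for instructions and
  tests, so a derivation certifies termination within \<open>s\<close> cells.\<close>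

inductive big_step :: "nat \<Rightarrow> nat \<Rightarrow> nat list \<Rightarrow> com \<Rightarrow> state \<Rightarrow> state \<Rightarrow> bool"
  for w s inp where
  Skip: "big_step w s inp Skip \<sigma> \<sigma>"
| Basic: "\<not> is_jump i \<Longrightarrow> accessed_cells i (conf 0 \<sigma>) \<subseteq> {..<s} \<Longrightarrow>
    exec_instr w inp i (conf 0 \<sigma>) = conf 1 \<sigma>' \<Longrightarrow> big_step w s inp (Basic i) \<sigma> \<sigma>'"
| Seq: "big_step w s inp c \<sigma> \<sigma>' \<Longrightarrow> big_step w s inp d \<sigma>' \<sigma>'' \<Longrightarrow>
    big_step w s inp (c ;; d) \<sigma> \<sigma>''"
| IfTrue: "a < s \<Longrightarrow> b < s \<Longrightarrow> fst \<sigma> a < fst \<sigma> b \<Longrightarrow> big_step w s inp c \<sigma> \<sigma>' \<Longrightarrow>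
    big_step w s inp (IfLess a b c d) \<sigma> \<sigma>'"
| IfFalse: "a < s \<Longrightarrow> b < s \<Longrightarrow> \<not> fst \<sigma> a < fst \<sigma> b \<Longrightarrow> big_step w s inp d \<sigma> \<sigma>' \<Longrightarrow>
    big_step w s inp (IfLess a b c d) \<sigma> \<sigma>'"
| WhileTrue: "a < s \<Longrightarrow> b < s \<Longrightarrow> fst \<sigma> a < fst \<sigma> b \<Longrightarrow> big_step w s inp c \<sigma> \<sigma>' \<Longrightarrow>
    big_step w s inp (WhileLess a b c) \<sigma>' \<sigma>'' \<Longrightarrow>
    big_step w s inp (WhileLess a b c) \<sigma> \<sigma>''"
| WhileFalse: "a < s \<Longrightarrow> b < s \<Longrightarrow> \<not> fst \<sigma> a < fst \<sigma> b \<Longrightarrow>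
    big_step w s inp (WhileLess a b c) \<sigma> \<sigma>"

inductive_cases SkipE: "big_step w s inp Skip \<sigma> \<sigma>'"
inductive_cases BasicE: "big_step w s inp (Basic i) \<sigma> \<sigma>'"
inductive_cases SeqE: "big_step w s inp (c ;; d) \<sigma> \<sigma>'"
inductive_cases IfLessE: "big_step w s inp (IfLess a b c d) \<sigma> \<sigma>'"

lemma exec_instr_conf:
  assumes "\<not> is_jump i" "exec_instr w inp i (conf 0 \<sigma>) = conf 1 \<sigma>'"
  shows "exec_instr w inp i (conf p \<sigma>) = conf (Suc p) \<sigma>'"
  using assms by (cases i) (auto simp: conf_def assign_def prod_eq_iff)

lemma accessed_cells_conf: "accessed_cells i (conf p \<sigma>) = accessed_cells i (conf 0 \<sigma>)"
  by (cases i) (auto simp: conf_def)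

lemma step_conf_iff:
  "(conf p \<sigma>, c') \<in> step w s inp P \<longleftrightarrow> p < length P \<and>
     accessed_cells (P ! p) (conf p \<sigma>) \<subseteq> {..<s} \<and> c' = exec_instr w inp (P ! p) (conf p \<sigma>)"
  by (auto simp: step_def conf_def)

text \<open>The surrounding code \<open>xs\<close> and \<open>ys\<close> is arbitrary because the
  induction meets subprograms in the middle of larger ones.\<close>

lemma compile_correct:
  assumes "big_step w s inp c \<sigma> \<sigma>'" "P = xs @ compile (length xs) c @ ys"
  shows "(conf (length xs) \<sigma>, conf (length xs + code_size c) \<sigma>') \<in> (step w s inp P)\<^sup>*"
  using assms
proof (induction arbitrary: xs ys rule: big_step.induct)
  case (Skip \<sigma>)
  then show ?case by simp
next
  case (Basic i \<sigma> \<sigma>')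
  have "(conf (length xs) \<sigma>, conf (Suc (length xs)) \<sigma>') \<in> step w s inp P"
    using Basic.hyps(2) Basic.prems exec_instr_conf[OF Basic.hyps(1,3), of "length xs"]
    by (simp add: step_conf_iff accessed_cells_conf[of _ "length xs"])
  then show ?case by (simp add: r_into_rtrancl)
next
  case (Seq c \<sigma> \<sigma>' d \<sigma>'')
  have "(conf (length xs) \<sigma>, conf (length xs + code_size c) \<sigma>') \<in> (step w s inp P)\<^sup>*"
    using Seq.IH(1)[of xs "compile (length xs + code_size c) d @ ys"] Seq.prems by simp
  moreover have "(conf (length xs + code_size c) \<sigma>',
      conf (length xs + code_size c + code_size d) \<sigma>'') \<in> (step w s inp P)\<^sup>*"
    using Seq.IH(2)[of "xs @ compile (length xs) c" ys] Seq.prems by simp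
  ultimately show ?case by (simp add: add.assoc)
next
  case (IfTrue a b \<sigma> c \<sigma>' d)
  let ?p = "length xs + 2 + code_size d"
  have "(conf (length xs) \<sigma>, conf ?p \<sigma>) \<in> step w s inp P"
    using IfTrue.hyps IfTrue.prems by (simp add: step_conf_iff) (simp add: conf_def)
  moreover have "(conf ?p \<sigma>, conf (?p + code_size c) \<sigma>') \<in> (step w s inp P)\<^sup>*"
    using IfTrue.IH[of "xs @ [JumpLess a b ?p] @ compile (length xs + 1) d @ [Jump (?p + code_size c)]" ys]
      IfTrue.prems by simp
  ultimately show ?case
    by (simp add: add_ac)
next
  case (IfFalse a b \<sigma> d \<sigma>' c)
  let ?p = "length xs + 2 + code_size d"
  have "(conf (length xs) \<sigma>, conf (length xs + 1) \<sigma>) \<in> step w s inp P"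
    using IfFalse.hyps IfFalse.prems by (simp add: step_conf_iff) (simp add: conf_def)
  moreover have "(conf (length xs + 1) \<sigma>, conf (length xs + 1 + code_size d) \<sigma>') \<in> (step w s inp P)\<^sup>*"
    using IfFalse.IH[of "xs @ [JumpLess a b ?p]" "[Jump (?p + code_size c)] @ compile ?p c @ ys"]
      IfFalse.prems by simp
  moreover have "(conf (length xs + 1 + code_size d) \<sigma>', conf (?p + code_size c) \<sigma>') \<in> step w s inp P"
    using IfFalse.prems by (simp add: step_conf_iff nth_append) (simp add: conf_def)
  ultimately show ?case
    by (simp add: add_ac)
next
  case (WhileTrue a b \<sigma> c \<sigma>' \<sigma>'')
  let ?p = "length xs + 2"
  have "(conf (length xs) \<sigma>, conf ?p \<sigma>) \<in> step w s inp P"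
    using WhileTrue.hyps WhileTrue.prems by (simp add: step_conf_iff) (simp add: conf_def)
  moreover have "(conf ?p \<sigma>, conf (?p + code_size c) \<sigma>') \<in> (step w s inp P)\<^sup>*"
    using WhileTrue.IH(1)[of "xs @ [JumpLess a b ?p, Jump (?p + 1 + code_size c)]" "[Jump (length xs)] @ ys"]
      WhileTrue.prems by simp
  moreover have "(conf (?p + code_size c) \<sigma>', conf (length xs) \<sigma>') \<in> step w s inp P"
    using WhileTrue.prems by (simp add: step_conf_iff nth_append) (simp add: conf_def)
  moreover have "(conf (length xs) \<sigma>', conf (length xs + code_size (WhileLess a b c)) \<sigma>'')
      \<in> (step w s inp P)\<^sup>*"
    by (rule WhileTrue.IH(2)[OF WhileTrue.prems])
  ultimately show ?case
    by (meson rtrancl.rtrancl_into_rtrancl rtrancl_trans r_into_rtrancl)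
next
  case (WhileFalse a b \<sigma> c)
  have "(conf (length xs) \<sigma>, conf (length xs + 1) \<sigma>) \<in> step w s inp P"
    using WhileFalse.hyps WhileFalse.prems by (simp add: step_conf_iff) (simp add: conf_def)
  moreover have "(conf (length xs + 1) \<sigma>, conf (length xs + code_size (WhileLess a b c)) \<sigma>) \<in> step w s inp P"
    using WhileFalse.prems by (simp add: step_conf_iff nth_append) (simp add: conf_def)
  ultimately show ?case
    by (meson converse_rtrancl_into_rtrancl r_into_rtrancl)
qed

section \<open>Weakest preconditions for total correctness\<close>

text \<open>In this form the equations below act as rewrite rules, and the simplifier executes
  straight-line code symbolically.\<close>

definition wp :: "nat \<Rightarrow> nat \<Rightarrow> nat list \<Rightarrow> com \<Rightarrow> (state \<Rightarrow> bool) \<Rightarrow> state \<Rightarrow> bool" where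
  "wp w s inp c Q \<sigma> \<longleftrightarrow> (\<exists>\<sigma>'. big_step w s inp c \<sigma> \<sigma>' \<and> Q \<sigma>')"

lemma wp_halts:
  assumes "wp w s inp c (\<lambda>(m, out). out = xs) (\<lambda>_. 0, [])"
  shows "\<exists>t. halts_with w inp (compile 0 c) t s xs"
proof -
  obtain m where "big_step w s inp c (\<lambda>_. 0, []) (m, xs)"
    using assms by (auto simp: wp_def)
  from compile_correct[OF this, of _ "[]" "[]"]
  have "(initial_config, conf (code_size c) (m, xs)) \<in> (step w s inp (compile 0 c))\<^sup>*"
    by (simp add: conf_def initial_config_def)
  then obtain t where "(initial_config, conf (code_size c) (m, xs)) \<in> step w s inp (compile 0 c) ^^ t"
    by (auto simp: rtrancl_is_UN_relpow)
  then show ?thesis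
    unfolding halts_with_def by (intro exI[of _ t] exI conjI) (auto simp: conf_def)
qed

lemma wp_Skip [simp]: "wp w s inp Skip Q \<sigma> = Q \<sigma>"
  unfolding wp_def by (metis SkipE big_step.Skip)

lemma wp_Seq [simp]: "wp w s inp (c ;; d) Q = wp w s inp c (wp w s inp d Q)"
  by (rule ext) (auto simp: wp_def intro: big_step.intros elim!: SeqE)

lemma big_step_IfLess_iff: "big_step w s inp (IfLess a b c d) \<sigma> \<sigma>' \<longleftrightarrow> a < s \<and> b < s \<and>
    (if fst \<sigma> a < fst \<sigma> b then big_step w s inp c \<sigma> \<sigma>' else big_step w s inp d \<sigma> \<sigma>')"
  by (rule iffI, erule IfLessE)
    (simp_all add: big_step.IfTrue big_step.IfFalse split: if_splits)

lemma wp_IfLess [simp]: "wp w s inp (IfLess a b c d) Q (m, out) \<longleftrightarrow> a < s \<and> b < s \<and>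
    (if m a < m b then wp w s inp c Q (m, out) else wp w s inp d Q (m, out))"
  unfolding wp_def by (simp only: fst_conv big_step_IfLess_iff) auto

lemma wp_Basic:
  assumes "\<not> is_jump i" "exec_instr w inp i (conf 0 (m, out)) = conf 1 \<sigma>'"
  shows "wp w s inp (Basic i) Q (m, out) \<longleftrightarrow> accessed_cells i (conf 0 (m, out)) \<subseteq> {..<s} \<and> Q \<sigma>'"
proof -
  have "big_step w s inp (Basic i) (m, out) \<sigma>'' \<longleftrightarrow>
      accessed_cells i (conf 0 (m, out)) \<subseteq> {..<s} \<and> \<sigma>'' = \<sigma>'" for \<sigma>''
  proof
    assume "big_step w s inp (Basic i) (m, out) \<sigma>''"
    then show "accessed_cells i (conf 0 (m, out)) \<subseteq> {..<s} \<and> \<sigma>'' = \<sigma>'"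
      by (rule BasicE) (use assms in \<open>simp add: conf_def prod_eq_iff\<close>)
  next
    assume "accessed_cells i (conf 0 (m, out)) \<subseteq> {..<s} \<and> \<sigma>'' = \<sigma>'"
    then show "big_step w s inp (Basic i) (m, out) \<sigma>''"
      using assms by (intro big_step.Basic) auto
  qed
  then show ?thesis unfolding wp_def by (simp only:) blast
qed

lemma wp_Const [simp]: "wp w s inp (Basic (Const a k)) Q (m, out) \<longleftrightarrow>
    a < s \<and> Q (m(a := take_bit w k), out)"
  by (subst wp_Basic) (auto simp: conf_def assign_def)

lemma wp_Copy [simp]: "wp w s inp (Basic (Copy a b)) Q (m, out) \<longleftrightarrow>
    a < s \<and> b < s \<and> Q (m(a := m b), out)"
  by (subst wp_Basic) (auto simp: conf_def assign_def)

lemma wp_Op [simp]: "wp w s inp (Basic (Op f a b d)) Q (m, out) \<longleftrightarrow>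
    a < s \<and> b < s \<and> d < s \<and> Q (m(a := apply_binop w f (m b) (m d)), out)"
  by (subst wp_Basic) (auto simp: conf_def assign_def)

lemma wp_Load [simp]: "wp w s inp (Basic (Load a b)) Q (m, out) \<longleftrightarrow>
    a < s \<and> b < s \<and> m b < s \<and> Q (m(a := m (m b)), out)"
  by (subst wp_Basic) (auto simp: conf_def assign_def)

lemma wp_Store [simp]: "wp w s inp (Basic (Store a b)) Q (m, out) \<longleftrightarrow>
    a < s \<and> b < s \<and> m a < s \<and> Q (m(m a := m b), out)"
  by (subst wp_Basic) (auto simp: conf_def assign_def)

lemma wp_Read [simp]: "wp w s inp (Basic (Read a b)) Q (m, out) \<longleftrightarrow>
    a < s \<and> b < s \<and> Q (m(a := (if m b < length inp then take_bit w (inp ! m b) else 0)), out)"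
  by (subst wp_Basic) (auto simp: conf_def assign_def)

lemma wp_Write [simp]: "wp w s inp (Basic (Write a)) Q (m, out) \<longleftrightarrow>
    a < s \<and> Q (m, out @ [m a])"
  by (subst wp_Basic) (auto simp: conf_def assign_def)

lemma wp_mono:
  assumes "wp w s inp c Q \<sigma>" "\<And>m out. Q (m, out) \<Longrightarrow> Q' (m, out)"
  shows "wp w s inp c Q' \<sigma>"
  using assms unfolding wp_def by (metis surj_pair)

lemma wp_WhileLess:
  fixes f :: "(nat \<Rightarrow> nat) \<Rightarrow> nat"
  assumes I: "I m out" and ab: "a < s" "b < s"
    and body: "\<And>m out. I m out \<Longrightarrow> m a < m b \<Longrightarrow>
      wp w s inp c (\<lambda>(m', out'). I m' out' \<and> f m' < f m) (m, out)"
    and exit: "\<And>m out. I m out \<Longrightarrow> \<not> m a < m b \<Longrightarrow> Q (m, out)"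
  shows "wp w s inp (WhileLess a b c) Q (m, out)"
  using I
proof (induction "f m" arbitrary: m out rule: less_induct)
  case less
  show ?case
  proof (cases "m a < m b")
    case True
    obtain m' out' where step: "big_step w s inp c (m, out) (m', out')" "I m' out'" "f m' < f m"
      using body[OF less.prems True] by (auto simp: wp_def)
    from less.hyps[OF this(3,2)] obtain \<sigma>
      where "big_step w s inp (WhileLess a b c) (m', out') \<sigma>" "Q \<sigma>"
      unfolding wp_def by blast
    with step(1) True ab show ?thesis
      unfolding wp_def by (metis big_step.WhileTrue fst_conv)
  next
    case False
    then show ?thesis
      using exit[OF less.prems] ab unfolding wp_def by (metis big_step.WhileFalse fst_conv)
  qed
qed

section \<open>Input lookup and frame conditions\<close>

lemma neighbours_in_concat:
  assumes "v < length xss" "j < length (xss ! v)"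
  shows "concat xss ! (sum_list (map length (take v xss)) + j) = xss ! v ! j"
    and "sum_list (map length (take v xss)) + j < length (concat xss)"
proof -
  have "xss = take v xss @ xss ! v # drop (Suc v) xss"
    using assms(1) by (rule id_take_nth_drop)
  then have *: "concat xss = concat (take v xss) @ xss ! v @ concat (drop (Suc v) xss)"
    by (metis concat.simps(2) concat_append)
  have len: "length (concat (take v xss)) = sum_list (map length (take v xss))"
    by (simp add: length_concat)
  show "concat xss ! (sum_list (map length (take v xss)) + j) = xss ! v ! j"
    unfolding * using assms len by (simp add: nth_append)
  show "sum_list (map length (take v xss)) + j < length (concat xss)"
    unfolding * using assms len by simp
qed

text \<open>A frame condition: cells from \<open>l\<close> to 101 are scratch space, and from 102
  on, where the stacks lie, only the cells in \<open>S\<close> are guaranteed to survive. The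
  instance \<open>even\<close> protects the vertex stack.\<close>

definition keeps :: "nat \<Rightarrow> (nat \<Rightarrow> bool) \<Rightarrow> (nat \<Rightarrow> nat) \<Rightarrow> (nat \<Rightarrow> nat) \<Rightarrow> bool" where
  "keeps l S \<mu> m \<longleftrightarrow> (\<forall>a<l. \<mu> a = m a) \<and> (\<forall>a\<ge>102. S a \<longrightarrow> \<mu> a = m a)"

lemma keeps_refl [simp]: "keeps l S m m"
  by (simp add: keeps_def)

lemma keeps_upd [simp]: "l \<le> a \<Longrightarrow> a < 102 \<Longrightarrow> keeps l S (\<mu>(a := x)) m = keeps l S \<mu> m"
  by (auto simp: keeps_def)

lemma keeps_less: "keeps l S \<mu> m \<Longrightarrow> a < l \<Longrightarrow> \<mu> a = m a"
  by (simp add: keeps_def)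

lemma keeps_trans: "keeps l' S' \<mu>' \<mu> \<Longrightarrow> keeps l S \<mu> m \<Longrightarrow> l \<le> l' \<Longrightarrow>
    (\<And>a. S a \<Longrightarrow> S' a) \<Longrightarrow> keeps l S \<mu>' m"
  by (auto simp: keeps_def)

text \<open>The numerical constants alone, without the parameters in cells 4 to 7, since loops
  already run while the initialisation is still computing those.\<close>

definition base :: "(nat \<Rightarrow> nat) \<Rightarrow> bool" where
  "base m \<longleftrightarrow> m 0 = 0 \<and> m 2 = 1 \<and> m 3 = 2"

lemma base_upd [simp]: "4 \<le> a \<Longrightarrow> base (m(a := x)) = base m"
  by (auto simp: base_def)

lemma base_simps [simp]: "base m \<Longrightarrow> m 0 = 0" "base m \<Longrightarrow> m 2 = Suc 0" "base m \<Longrightarrow> m 3 = 2"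
  by (simp_all add: base_def)

section \<open>The program\<close>

text \<open>
  Cells 0, 2, 3 hold the constants 0, 1, 2, and cells 4, 5, 6, 7 hold n, D, q, n * q (cell 1 is not
  used).  Each program fragment writes only to cells from some bound on, larger for fragments that
  are called by others, and leaves its result in a cell of its own: adj_code in 92, parity_code in 86,
  label_mod_code in 80, test_modulus_code in 71, modulus_code in 70, walk_code in 60, valid_code in 50,
  blocks_stop_code in 40, stop_kernel_code in 30, colour_code in 20, blocks_vertex_code in 16,
  vertex_kernel_code in 9.  The stacks of the two kernel evaluations are interleaved: cells 102, 104,
  ... for vertices, and cells 103, 105, ... for pairs of a vertex and a time.
\<close>

definition eq_code :: "nat \<Rightarrow> nat \<Rightarrow> nat \<Rightarrow> com" where
  "eq_code r x y = Basic (Copy r 2);; IfLess x y (Basic (Copy r 0)) Skip;;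
     IfLess y x (Basic (Copy r 0)) Skip"

definition for_code :: "nat \<Rightarrow> nat \<Rightarrow> com \<Rightarrow> com" where
  "for_code j hi body = Basic (Copy j 0);; WhileLess j hi (body;; Basic (Op Add j j 2))"

definition adj_code :: "nat \<Rightarrow> nat \<Rightarrow> com" where
  "adj_code v u = Basic (Copy 92 0);; Basic (Op Add 90 v 2);; Basic (Read 93 90);;
     Basic (Op Add 90 90 2);; Basic (Read 91 90);;
     WhileLess 93 91
       (Basic (Read 94 93);; eq_code 95 94 u;; IfLess 0 95 (Basic (Copy 92 2)) Skip;;
        Basic (Op Add 93 93 2))"

text \<open>Cell 85 moves along the path to the root, cell 86 is flipped at each move, and cell 87
  is set when the root is reached.\<close>

definition parity_code :: "nat \<Rightarrow> nat \<Rightarrow> com" where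
  "parity_code v i = Basic (Copy 86 0);; Basic (Copy 85 v);; Basic (Copy 87 0);;
     WhileLess 87 2
       (Basic (Op Add 88 85 2);; Basic (Read 89 88);; Basic (Op Add 89 89 i);;
        Basic (Op Add 88 88 2);; Basic (Read 88 88);;
        IfLess 89 88
          (Basic (Read 88 89);;
           IfLess 85 88
             (Basic (Copy 85 88);; IfLess 0 86 (Basic (Copy 86 0)) (Basic (Copy 86 2)))
             (Basic (Copy 87 2)))
          (Basic (Copy 87 2)))"

definition label_mod_code :: "nat \<Rightarrow> nat \<Rightarrow> com" where
  "label_mod_code v r = Basic (Copy 80 0);;
     for_code 81 5 (parity_code v 81;; Basic (Op Add 80 80 80);; Basic (Op Add 80 80 86);;
       Basic (Op Mod 80 80 r))"

definition test_modulus_code :: "nat \<Rightarrow> com" where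
  "test_modulus_code v = label_mod_code v 70;; Basic (Copy 72 80);; Basic (Copy 71 2);;
     for_code 73 4
       (adj_code v 73;;
        IfLess 0 92
          (label_mod_code 73 70;; eq_code 74 80 72;; IfLess 0 74 (Basic (Copy 71 0)) Skip)
          Skip)"

definition modulus_code :: "nat \<Rightarrow> com" where
  "modulus_code v = Basic (Copy 70 0);; Basic (Copy 71 0);;
     WhileLess 71 2 (Basic (Op Add 70 70 2);; test_modulus_code v)"

definition walk_arith_code :: "nat \<Rightarrow> com" where
  "walk_arith_code t =
     Basic (Op Div 61 70 6);; Basic (Op Mod 62 70 6);;
     Basic (Op Div 63 80 6);; Basic (Op Mod 64 80 6);;
     Basic (Op Add 60 t 61);; Basic (Op Mul 60 60 t);; Basic (Op Mod 60 60 6);;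
     Basic (Op Add 60 60 62);; Basic (Op Mul 60 60 t);; Basic (Op Mod 60 60 6);;
     Basic (Op Add 60 60 63);; Basic (Op Mul 60 60 t);; Basic (Op Mod 60 60 6);;
     Basic (Op Add 60 60 64);; Basic (Op Mod 60 60 6)"

definition walk_code :: "nat \<Rightarrow> nat \<Rightarrow> com" where
  "walk_code v t = modulus_code v;; label_mod_code v 70;; walk_arith_code t"

definition valid_code :: "nat \<Rightarrow> nat \<Rightarrow> com" where
  "valid_code v t = walk_code v t;; Basic (Copy 51 60);; Basic (Copy 50 2);;
     for_code 52 4
       (adj_code v 52;;
        IfLess 0 92
          (walk_code 52 t;; eq_code 53 60 51;; IfLess 0 53 (Basic (Copy 50 0)) Skip)
          Skip)"

definition blocks_stop_code :: "nat \<Rightarrow> nat \<Rightarrow> com" where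
  "blocks_stop_code x y = Basic (Copy 40 0);;
     Basic (Op Div 41 x 6);; Basic (Op Mod 42 x 6);; Basic (Op Div 43 y 6);; Basic (Op Mod 44 y 6);;
     IfLess 44 42
       (valid_code 43 44;;
        IfLess 0 50
          (eq_code 40 43 41;;
           IfLess 0 40 Skip
             (adj_code 41 43;;
              IfLess 0 92
                (walk_code 43 44;; Basic (Copy 45 60);; walk_code 41 42;; eq_code 40 45 60)
                Skip))
          Skip)
       Skip"

text \<open>A search that stores no truth values. Cell \<open>r + 1\<close> points to the top of the
  stack, \<open>r + 2\<close> holds the next candidate for a successor of the top,
  \<open>r + 3\<close> the end flag, \<open>r + 4\<close> the bottom of the stack, and
  \<open>r + 5\<close>, \<open>r + 6\<close> the arguments of \<open>body\<close>. A successor is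
  pushed as soon as it is found. When the candidates are exhausted, the top is in the kernel, so the
  entry below it is not; both are popped, and the search resumes one level further down with the
  candidate after the refuted one. If the bottom entry exhausts its candidates, the result is 1; if
  it is refuted, 0.\<close>

definition kernel_code :: "nat \<Rightarrow> nat \<Rightarrow> nat \<Rightarrow> nat \<Rightarrow> nat \<Rightarrow> com \<Rightarrow> com" where
  "kernel_code b r x hi e body =
     Basic (Const (r + 4) b);; Basic (Copy (r + 1) (r + 4));; Basic (Store (r + 1) x);;
     Basic (Copy (r + 2) 0);; Basic (Copy (r + 3) 0);;
     WhileLess (r + 3) 2
       (IfLess (r + 2) hi
          (Basic (Load (r + 5) (r + 1));; Basic (Copy (r + 6) (r + 2));; body;;
           IfLess 0 e
             (Basic (Op Add (r + 1) (r + 1) 3);; Basic (Store (r + 1) (r + 2));;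
              Basic (Copy (r + 2) 0))
             (Basic (Op Add (r + 2) (r + 2) 2)))
          (IfLess (r + 4) (r + 1)
             (Basic (Op Sub (r + 1) (r + 1) 3);;
              IfLess (r + 4) (r + 1)
                (Basic (Load (r + 2) (r + 1));; Basic (Op Add (r + 2) (r + 2) 2);;
                 Basic (Op Sub (r + 1) (r + 1) 3))
                (Basic (Copy r 0);; Basic (Copy (r + 3) 2)))
             (Basic (Copy r 2);; Basic (Copy (r + 3) 2))))"

definition stop_kernel_code :: com where
  "stop_kernel_code = kernel_code 103 30 23 7 40 (blocks_stop_code 35 36)"

definition colour_code :: "nat \<Rightarrow> com" where
  "colour_code v = Basic (Copy 21 0);; Basic (Copy 22 0);;
     WhileLess 21 2
       (valid_code v 22;;
        IfLess 0 50
          (Basic (Op Mul 23 v 6);; Basic (Op Add 23 23 22);; stop_kernel_code;;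
           IfLess 0 30
             (walk_code v 22;; Basic (Copy 20 60);; Basic (Copy 21 2))
             Skip)
          Skip;;
        Basic (Op Add 22 22 2))"

definition blocks_vertex_code :: "nat \<Rightarrow> nat \<Rightarrow> com" where
  "blocks_vertex_code v u = Basic (Copy 16 0);; adj_code v u;;
     IfLess 0 92
       (colour_code v;; Basic (Copy 17 20);; colour_code u;;
        IfLess 20 17 (Basic (Copy 16 2)) Skip)
       Skip"

definition vertex_kernel_code :: com where
  "vertex_kernel_code = kernel_code 102 9 8 4 16 (blocks_vertex_code 14 15)"

definition test_prime_code :: com where
  "test_prime_code = Basic (Copy 10 2);; Basic (Copy 11 3);;
     WhileLess 11 6
       (Basic (Op Mod 12 6 11);; IfLess 12 2 (Basic (Copy 10 0)) Skip;; Basic (Op Add 11 11 2))"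

text \<open>The maximum degree, raised to at least 1, is found as the largest difference of
  consecutive offsets, starting from 1. The search for \<open>q\<close> then tries the numbers above
  seven times this value in order.\<close>

definition init_code :: com where
  "init_code = Basic (Const 2 1);; Basic (Const 3 2);; Basic (Read 4 0);; Basic (Copy 5 2);;
     for_code 10 4
       (Basic (Op Add 11 10 2);; Basic (Read 12 11);; Basic (Op Add 11 11 2);; Basic (Read 11 11);;
        Basic (Op Sub 11 11 12);; IfLess 5 11 (Basic (Copy 5 11)) Skip);;
     Basic (Const 11 7);; Basic (Op Mul 6 5 11);; Basic (Copy 10 0);;
     WhileLess 10 2 (Basic (Op Add 6 6 2);; test_prime_code);;
     Basic (Op Mul 7 4 6)"

definition mis_code :: com where
  "mis_code = init_code;;
     for_code 8 4 (vertex_kernel_code;; IfLess 0 9 (Basic (Write 8)) Skip)"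

section \<open>Correctness of the program\<close>

lemma wp_eq_code [simp]:
  assumes "base m" "8 \<le> r" "r < s" "x < s" "y < s" "x \<noteq> r" "y \<noteq> r"
  shows "wp w s inp (eq_code r x y) Q (m, out) = Q (m(r := of_bool (m x = m y)), out)"
  using assms by (auto simp: eq_code_def)

text \<open>The invariant is asked for with the counter already advanced; the increment and its
  possible overflow are thus treated here once for all loops.\<close>

lemma wp_for_code:
  assumes j: "8 \<le> j" "j < s" "hi < s" "hi \<noteq> j" and N: "N < 2 ^ w" and m0: "m 0 = 0"
    and init: "I 0 (m(j := 0)) out"
    and inv: "\<And>i \<mu> out'. I i \<mu> out' \<Longrightarrow> base \<mu> \<and> \<mu> hi = N"
    and body: "\<And>i \<mu> out'. I i \<mu> out' \<Longrightarrow> \<mu> j = i \<Longrightarrow> i < N \<Longrightarrow>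
      wp w s inp body (\<lambda>(\<mu>', out''). \<mu>' j = i \<and> I (Suc i) (\<mu>'(j := Suc i)) out'') (\<mu>, out')"
    and exit: "\<And>\<mu> out'. I N \<mu> out' \<Longrightarrow> \<mu> j = N \<Longrightarrow> Q (\<mu>, out')"
  shows "wp w s inp (for_code j hi body) Q (m, out)"
proof -
  have "wp w s inp (WhileLess j hi (body;; Basic (Op Add j j 2))) Q (m(j := 0), out)"
  proof (rule wp_WhileLess[where I = "\<lambda>\<mu> out'. \<exists>i\<le>N. \<mu> j = i \<and> I i \<mu> out'" and f = "\<lambda>\<mu>. N - \<mu> j"])
    show "\<exists>i\<le>N. (m(j := 0)) j = i \<and> I i (m(j := 0)) out" using init by auto
  next
    fix \<mu> out' assume "\<exists>i\<le>N. \<mu> j = i \<and> I i \<mu> out'" and less: "\<mu> j < \<mu> hi"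
    then obtain i where i: "\<mu> j = i" "I i \<mu> out'" by auto
    have iN: "i < N" using inv[OF i(2)] less i(1) by simp
    show "wp w s inp (body;; Basic (Op Add j j 2))
      (\<lambda>(m', out''). (\<exists>i\<le>N. m' j = i \<and> I i m' out'') \<and> N - m' j < N - \<mu> j) (\<mu>, out')"
      unfolding wp_Seq
    proof (rule wp_mono[OF body[OF i(2) i(1) iN]])
      fix \<mu>' out'' assume "case (\<mu>', out'') of (\<mu>', out'') \<Rightarrow> \<mu>' j = i \<and> I (Suc i) (\<mu>'(j := Suc i)) out''"
      then have *: "\<mu>' j = i" "I (Suc i) (\<mu>'(j := Suc i)) out''" by auto
      have "base (\<mu>'(j := Suc i))" using inv[OF *(2)] by simp
      then have "base \<mu>'" using j by simp
      moreover have "take_bit w (Suc i) = Suc i" using iN N by (intro take_bit_nat_eq_self) simp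
      moreover have "3 < s" "2 < s" using j by auto
      ultimately show "wp w s inp (Basic (Op Add j j 2))
          (\<lambda>(m', out''). (\<exists>i\<le>N. m' j = i \<and> I i m' out'') \<and> N - m' j < N - \<mu> j) (\<mu>', out'')"
        using * iN i j by simp
    qed
  next
    fix \<mu> out' assume "\<exists>i\<le>N. \<mu> j = i \<and> I i \<mu> out'" and "\<not> \<mu> j < \<mu> hi"
    then show "Q (\<mu>, out')" using inv exit by (metis le_antisym not_le)
  qed (use j in auto)
  then show ?thesis using j m0 by (simp add: for_code_def)
qed

text \<open>\<open>D_max\<close> and \<open>q_least\<close> pin \<open>D\<close> and
  \<open>q\<close> down to the values that the initialisation finds. \<open>s_eq\<close> covers the
  102 fixed cells and two stacks of \<open>q\<close> cells each. The single inequality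
  \<open>big\<close> dominates the intermediate values, so that no sum or product wraps
  around.\<close>

locale mis_program = coloured_graph +
  fixes inp :: "nat list" and w s :: nat
  assumes inp_eq: "inp = [n] @ map (\<lambda>v. n + 2 + sum_list (map length (take v nbrs))) [0..<n + 1] @ concat nbrs"
    and D_max: "D = 1 \<or> (\<exists>v<n. length (nbrs ! v) = D)"
    and q_least: "\<And>p. prime p \<Longrightarrow> 7 * D < p \<Longrightarrow> q \<le> p"
    and s_eq: "s = 104 + 2 * q"
    and big: "(n + 2) * q + 4 * q ^ 2 + length inp + s + n < 2 ^ w"
begin

definition off :: "nat \<Rightarrow> nat" where
  "off v = n + 2 + sum_list (map length (take v nbrs))"

lemma length_inp: "length inp = n + 2 + length (concat nbrs)"
  by (simp add: inp_eq)

lemma inp_off: "v \<le> n \<Longrightarrow> inp ! Suc v = off v" "v \<le> n \<Longrightarrow> Suc v < length inp"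
proof -
  assume v: "v \<le> n"
  have "inp ! Suc v = (map off [0..<n + 1] @ concat nbrs) ! v"
    unfolding inp_eq off_def by simp
  also have "\<dots> = off v" using v by (simp add: nth_append del: upt_Suc)
  finally show "inp ! Suc v = off v" .
  show "Suc v < length inp" using v by (simp add: length_inp)
qed

lemma off_Suc: "v < n \<Longrightarrow> off (Suc v) = off v + length (nbrs ! v)"
  using length_nbrs by (simp add: off_def take_Suc_conv_app_nth)

lemma inp_nbr:
  assumes "v < n" "j < length (nbrs ! v)"
  shows "inp ! (off v + j) = nbrs ! v ! j" "off v + j < length inp"
proof -
  let ?k = "sum_list (map length (take v nbrs)) + j"
  have k: "concat nbrs ! ?k = nbrs ! v ! j" "?k < length (concat nbrs)"
    using neighbours_in_concat[of v nbrs j] assms length_nbrs by auto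
  have "inp ! (off v + j) = (map off [0..<n + 1] @ concat nbrs) ! (n + 1 + ?k)"
    unfolding inp_eq off_def by (simp add: add.assoc)
  also have "\<dots> = concat nbrs ! ?k" by (simp add: nth_append del: upt_Suc)
  finally show "inp ! (off v + j) = nbrs ! v ! j" using k by simp
  show "off v + j < length inp" using k(2) by (simp add: off_def length_inp)
qed

lemma off_le: "v \<le> n \<Longrightarrow> off v \<le> length inp"
proof -
  have "sum_list (map length (take v nbrs)) \<le> sum_list (map length (take v nbrs)) + sum_list (map length (drop v nbrs))"
    by simp
  also have "\<dots> = sum_list (map length (take v nbrs @ drop v nbrs))"
    by (simp only: map_append sum_list_append)
  also have "\<dots> = length (concat nbrs)" by (simp add: length_concat)
  finally show ?thesis by (simp add: off_def length_inp)
qed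

lemma nbr_less:
  assumes "v < n" "j < length (nbrs ! v)"
  shows "nbrs ! v ! j < n"
proof -
  have "nbrs ! v ! j \<in> E `` {v}" using assms set_nbrs[of v] nth_mem[of j "nbrs ! v"] by simp
  then show ?thesis using edge_less by auto
qed

lemma big_simps:
  "n < 2 ^ w" "Suc n < 2 ^ w" "length inp < 2 ^ w" "q < 2 ^ w" "4 * q ^ 2 < 2 ^ w" "n * q < 2 ^ w" "s < 2 ^ w"
proof -
  have "(n + 2) * q = n * q + 2 * q" by (simp add: algebra_simps)
  moreover have "Suc n \<le> length inp" by (simp add: length_inp)
  ultimately show "n < 2 ^ w" "Suc n < 2 ^ w" "length inp < 2 ^ w" "q < 2 ^ w" "4 * q ^ 2 < 2 ^ w" "n * q < 2 ^ w" "s < 2 ^ w"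
    using big q_pos by linarith+
qed

lemma cell_less [simp]: "a < 102 \<Longrightarrow> a < s"
  by (simp add: s_eq)

definition glob :: "(nat \<Rightarrow> nat) \<Rightarrow> bool" where
  "glob m \<longleftrightarrow> base m \<and> m 4 = n \<and> m 5 = D \<and> m 6 = q \<and> m 7 = n * q"

lemma glob_upd [simp]: "8 \<le> a \<Longrightarrow> glob (m(a := x)) = glob m"
  by (auto simp: glob_def)

lemma keeps_glob: "keeps l S \<mu> m \<Longrightarrow> glob m \<Longrightarrow> 8 \<le> l \<Longrightarrow> glob \<mu>"
  by (simp add: keeps_def glob_def base_def del: base_simps)

lemma glob_base [simp]: "glob m \<Longrightarrow> base m"
  by (simp add: glob_def)

lemma glob_simps [simp]: "glob m \<Longrightarrow> m 4 = n" "glob m \<Longrightarrow> m 5 = D" "glob m \<Longrightarrow> m 6 = q" "glob m \<Longrightarrow> m 7 = n * q"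
  by (simp_all add: glob_def)

abbreviation "keep l \<equiv> keeps l (\<lambda>_. True)"

abbreviation "wpp \<equiv> wp w s inp"

section \<open>Adjacency, labels, walks and blocking\<close>

lemma wp_adj_code:
  assumes m: "glob m" "m v < n" and reg: "v < 90" "u < 90"
    and Q: "\<And>\<mu>. keep 90 \<mu> m \<Longrightarrow> \<mu> 92 = of_bool ((m v, m u) \<in> E) \<Longrightarrow> Q (\<mu>, out)"
  shows "wpp (adj_code v u) Q (m, out)"
proof -
  define x where "x = m v"
  have x: "x < n" using m by (simp add: x_def)
  have tb: "take_bit w (Suc x) = Suc x" "take_bit w (Suc (Suc x)) = Suc (Suc x)"
    "take_bit w (off x) = off x" "take_bit w (off (Suc x)) = off (Suc x)"
    using x big_simps(1-3) off_le[of x] off_le[of "Suc x"] by (auto intro!: take_bit_nat_eq_self)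
  have offs: "inp ! Suc x = off x" "inp ! Suc (Suc x) = off (Suc x)"
      "Suc x < length inp" "Suc (Suc x) < length inp" "off (Suc x) = off x + length (nbrs ! x)"
    using inp_off[of x] inp_off[of "Suc x"] x off_Suc[OF x] by auto
  have *: "wpp (WhileLess 93 91
       (Basic (Read 94 93);; eq_code 95 94 u;; IfLess 0 95 (Basic (Copy 92 2)) Skip;;
        Basic (Op Add 93 93 2))) Q (m(92 := 0, 90 := Suc x, 93 := off x, 90 := Suc (Suc x), 91 := off (Suc x)), out)"
  proof (rule wp_WhileLess[where f = "\<lambda>\<mu>. off (Suc x) - \<mu> 93" and
        I = "\<lambda>\<mu> out'. out' = out \<and> keep 90 \<mu> m \<and> \<mu> 91 = off (Suc x) \<and>
          (\<exists>j\<le>length (nbrs ! x). \<mu> 93 = off x + j \<and> \<mu> 92 = of_bool (m u \<in> set (take j (nbrs ! x))))"])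
    fix \<mu> out' assume I: "out' = out \<and> keep 90 \<mu> m \<and> \<mu> 91 = off (Suc x) \<and>
          (\<exists>j\<le>length (nbrs ! x). \<mu> 93 = off x + j \<and> \<mu> 92 = of_bool (m u \<in> set (take j (nbrs ! x))))"
      and less: "\<mu> 93 < \<mu> 91"
    then obtain j where j: "\<mu> 93 = off x + j" "\<mu> 92 = of_bool (m u \<in> set (take j (nbrs ! x)))" by auto
    have jl: "j < length (nbrs ! x)" using less I j(1) offs by simp
    have k: "keep 90 \<mu> m" and out: "out' = out" using I by auto
    have g: "glob \<mu>" using keeps_glob[OF k] m by simp
    have nb: "inp ! (off x + j) = nbrs ! x ! j" "off x + j < length inp" "nbrs ! x ! j < n"
      using inp_nbr[OF x jl] nbr_less[OF x jl] by auto
    have tb': "take_bit w (nbrs ! x ! j) = nbrs ! x ! j" "take_bit w (Suc (off x + j)) = Suc (off x + j)"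
      using nb big_simps by (auto intro!: take_bit_nat_eq_self)
    have tk: "set (take (Suc j) (nbrs ! x)) = insert (nbrs ! x ! j) (set (take j (nbrs ! x)))"
      using jl by (simp add: take_Suc_conv_app_nth)
    show "wpp (Basic (Read 94 93);; eq_code 95 94 u;; IfLess 0 95 (Basic (Copy 92 2)) Skip;;
        Basic (Op Add 93 93 2)) (\<lambda>(\<mu>', out'). (out' = out \<and> keep 90 \<mu>' m \<and> \<mu>' 91 = off (Suc x) \<and>
          (\<exists>j\<le>length (nbrs ! x). \<mu>' 93 = off x + j \<and> \<mu>' 92 = of_bool (m u \<in> set (take j (nbrs ! x))))) \<and>
          off (Suc x) - \<mu>' 93 < off (Suc x) - \<mu> 93) (\<mu>, out')"
      using g k reg I j nb jl tb' tk keeps_less[OF k, of u] less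
      by (auto intro!: exI[of _ "Suc j"])
  next
    fix \<mu> out' assume I: "out' = out \<and> keep 90 \<mu> m \<and> \<mu> 91 = off (Suc x) \<and>
          (\<exists>j\<le>length (nbrs ! x). \<mu> 93 = off x + j \<and> \<mu> 92 = of_bool (m u \<in> set (take j (nbrs ! x))))"
      and "\<not> \<mu> 93 < \<mu> 91"
    then have "\<mu> 92 = of_bool (m u \<in> set (nbrs ! x))" using offs by auto
    then show "Q (\<mu>, out')" using I Q set_nbrs[OF x] by (simp add: x_def)
  qed (use m in \<open>auto simp: x_def intro: exI[of _ 0]\<close>)
  show ?thesis
    unfolding adj_code_def using m reg * offs tb by (simp add: x_def)
qed

lemma wp_parity_code:
  assumes m: "glob m" "m v < n" "m i < D" and reg: "v < 85" "i < 85"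
    and Q: "\<And>\<mu>. keep 85 \<mu> m \<Longrightarrow> \<mu> 86 = forest_parity nbrs (m i) (m v) \<Longrightarrow> Q (\<mu>, out)"
  shows "wpp (parity_code v i) Q (m, out)"
proof -
  let ?p = "forest_parity nbrs (m i)"
  \<comment> \<open>Cell 86 is the parity of the number of moves so far: the wanted parity is that
    of the current vertex, flipped if the cell is set. At a root, where the current parity is 0, the
    cell itself is the result.\<close>
  let ?I = "\<lambda>\<mu> out'. out' = out \<and> keep 85 \<mu> m \<and> \<mu> 85 < n \<and> \<mu> 86 \<le> 1 \<and> \<mu> 87 \<le> 1 \<and>
    ?p (m v) = (if \<mu> 87 = 1 then \<mu> 86 else if \<mu> 86 = 0 then ?p (\<mu> 85) else 1 - ?p (\<mu> 85))"
  let ?body = "Basic (Op Add 88 85 2);; Basic (Read 89 88);; Basic (Op Add 89 89 i);;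
        Basic (Op Add 88 88 2);; Basic (Read 88 88);;
        IfLess 89 88
          (Basic (Read 88 89);;
           IfLess 85 88
             (Basic (Copy 85 88);; IfLess 0 86 (Basic (Copy 86 0)) (Basic (Copy 86 2)))
             (Basic (Copy 87 2)))
          (Basic (Copy 87 2))"
  have *: "wpp (WhileLess 87 2 ?body) Q (m(86 := 0, 85 := m v, 87 := 0), out)"
  proof (rule wp_WhileLess[where I = ?I and f = "\<lambda>\<mu>. n - \<mu> 85 + (1 - \<mu> 87)"])
    fix \<mu> out' assume I: "?I \<mu> out'" and less: "\<mu> 87 < \<mu> 2"
    define x where "x = \<mu> 85"
    have x: "x < n" "\<mu> 85 = x" using I by (simp_all add: x_def)
    have k: "keep 85 \<mu> m" and out: "out' = out" using I by auto
    have g: "glob \<mu>" using keeps_glob[OF k] m by simp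
    have i: "\<mu> i = m i" using keeps_less[OF k] reg by simp
    have f87: "\<mu> 87 = 0" using less g by simp
    have p: "?p (m v) = (if \<mu> 86 = 0 then ?p x else 1 - ?p x)" using I f87 by (simp add: x_def)
    have Dq: "D < q" using q_gt by simp
    \<comment> \<open>This address is formed before the test whether the vertex has an
      \<open>i\<close>-th neighbour, so it may lie beyond the list and even beyond the
      input.\<close>
    have "off x + m i < 2 ^ w"
      using off_le[of x] x(1) m(3) Dq big by (simp add: algebra_simps)
    then have tb: "take_bit w (Suc x) = Suc x" "take_bit w (Suc (Suc x)) = Suc (Suc x)"
      "take_bit w (off x) = off x" "take_bit w (off (Suc x)) = off (Suc x)"
      "take_bit w (off x + m i) = off x + m i"
      using x big_simps(1-3) off_le[of x] off_le[of "Suc x"] by (auto intro!: take_bit_nat_eq_self)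
    have offs: "inp ! Suc x = off x" "inp ! Suc (Suc x) = off (Suc x)"
        "Suc x < length inp" "Suc (Suc x) < length inp" "off (Suc x) = off x + length (nbrs ! x)"
      using inp_off[of x] inp_off[of "Suc x"] x off_Suc[of x] by auto
    have p_Suc: "?p x = (if m i < length (nbrs ! x) \<and> x < nbrs ! x ! m i then 1 - ?p (nbrs ! x ! m i) else 0)"
      using x length_nbrs by (subst forest_parity.simps) simp
    show "wpp ?body (\<lambda>(\<mu>', out'). ?I \<mu>' out' \<and> n - \<mu>' 85 + (1 - \<mu>' 87) < n - \<mu> 85 + (1 - \<mu> 87)) (\<mu>, out')"
    proof (cases "m i < length (nbrs ! x)")
      case True
      have nb: "inp ! (off x + m i) = nbrs ! x ! m i" "off x + m i < length inp" "nbrs ! x ! m i < n"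
        using inp_nbr[OF x(1) True] nbr_less[OF x(1) True] by auto
      have tb': "take_bit w (nbrs ! x ! m i) = nbrs ! x ! m i"
        using nb(3) big_simps by (intro take_bit_nat_eq_self) simp
      show ?thesis
        using g k reg i tb offs x(1) out I f87 True nb tb' p p_Suc forest_parity_le_1[of nbrs "m i" "nbrs ! x ! m i"]
        by (simp add: x(2)) arith
    next
      case False
      show ?thesis
        using g k reg i tb offs x(1) out I f87 False p p_Suc by (simp add: x(2))
    qed
  next
    fix \<mu> out' assume I: "?I \<mu> out'" and "\<not> \<mu> 87 < \<mu> 2"
    moreover have "glob \<mu>" using I keeps_glob m by auto
    ultimately show "Q (\<mu>, out')" using Q by auto
  qed (use m in auto)
  show ?thesis
    unfolding parity_code_def using m reg * by simp
qed

lemma wp_label_mod_code: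
  assumes m: "glob m" "m v < n" "1 \<le> m r" "m r \<le> q ^ 2" and reg: "v < 80" "r < 80"
    and Q: "\<And>\<mu>. keep 80 \<mu> m \<Longrightarrow> \<mu> 80 = label nbrs D (m v) mod m r \<Longrightarrow> Q (\<mu>, out)"
  shows "wpp (label_mod_code v r) Q (m, out)"
proof -
  let ?I = "\<lambda>i \<mu> out'. out' = out \<and> keep 80 \<mu> m \<and> \<mu> 80 = label nbrs i (m v) mod m r"
  have *: "wpp (for_code 81 5 (parity_code v 81;; Basic (Op Add 80 80 80);; Basic (Op Add 80 80 86);;
       Basic (Op Mod 80 80 r))) Q (m(80 := 0), out)"
  proof (rule wp_for_code[where I = ?I and N = D])
    fix i \<mu> out' assume I: "?I i \<mu> out'" and i: "\<mu> 81 = i" "i < D"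
    have k: "keep 80 \<mu> m" and out: "out' = out" using I by auto
    have g: "glob \<mu>" using keeps_glob[OF k] m by simp
    have v: "\<mu> v = m v" using keeps_less[OF k] reg by simp
    show "wpp (parity_code v 81;; Basic (Op Add 80 80 80);; Basic (Op Add 80 80 86);;
       Basic (Op Mod 80 80 r)) (\<lambda>(\<mu>', out'). \<mu>' 81 = i \<and> ?I (Suc i) (\<mu>'(81 := Suc i)) out') (\<mu>, out')"
      unfolding wp_Seq
    proof (rule wp_parity_code[OF g])
      fix \<nu> assume \<nu>: "keep 85 \<nu> \<mu>" "\<nu> 86 = forest_parity nbrs (\<mu> 81) (\<mu> v)"
      have g': "glob \<nu>" using keeps_glob[OF \<nu>(1) g] by simp
      have k': "keep 80 \<nu> m" by (rule keeps_trans[OF \<nu>(1) k]) auto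
      have lk: "\<nu> 80 = label nbrs i (m v) mod m r" "\<nu> 81 = i" "\<nu> r = m r" "\<nu> 86 = forest_parity nbrs i (m v)"
        using I i \<nu> keeps_less[OF \<nu>(1)] keeps_less[OF k'] reg v by auto
      let ?a = "label nbrs i (m v) mod m r" and ?b = "forest_parity nbrs i (m v)"
      have "?a < m r" using m by simp
      moreover have "?b \<le> 1" by (rule forest_parity_le_1)
      \<comment> \<open>Doubling happens before the reduction, so the value may exceed the modulus,
        which itself may be \<open>q ^ 2\<close>; the term \<open>4 * q ^ 2\<close> in
        \<open>big\<close> leaves room for it.\<close>
      ultimately have b: "?a + ?a + ?b < 4 * q ^ 2" "?a + ?a < 4 * q ^ 2" using m(4) by linarith+
      have b2: "(?a + ?a + ?b) mod m r < 2 ^ w"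
        using b big_simps(5) mod_less_eq_dividend[of "?a + ?a + ?b" "m r"] by linarith
      have tb: "take_bit w (?a + ?a) = ?a + ?a" "take_bit w (?a + ?a + ?b) = ?a + ?a + ?b"
        "take_bit w ((?a + ?a + ?b) mod m r) = (?a + ?a + ?b) mod m r"
        using b b2 big_simps by (auto intro!: take_bit_nat_eq_self)
      have e: "(?a + ?a + ?b) mod m r = (2 * label nbrs i (m v) + ?b) mod m r"
        by (metis mod_add_left_eq mod_mult_right_eq mult_2)
      show "wpp (Basic (Op Add 80 80 80)) (wpp (Basic (Op Add 80 80 86)) (wpp (Basic (Op Mod 80 80 r))
       (\<lambda>(\<mu>', out'). \<mu>' 81 = i \<and> ?I (Suc i) (\<mu>'(81 := Suc i)) out'))) (\<nu>, out')"
        using lk g' k' tb reg out e by simp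
    qed (use v i reg m in auto)
  next
    fix i \<mu> out' assume "?I i \<mu> out'"
    then show "base \<mu> \<and> \<mu> 5 = D" using keeps_glob m(1) by auto
  next
    show "D < 2 ^ w" using big_simps q_gt by linarith
  qed (use m Q in auto)
  show ?thesis
    unfolding label_mod_code_def using m reg * by simp
qed

lemma wp_test_modulus_code:
  assumes m: "glob m" "m v < n" "1 \<le> m 70" "m 70 \<le> q ^ 2" and reg: "v < 70"
    and Q: "\<And>\<mu>. keep 71 \<mu> m \<Longrightarrow> \<mu> 71 = of_bool (\<forall>u. (m v, u) \<in> E \<longrightarrow>
      label nbrs D u mod m 70 \<noteq> label nbrs D (m v) mod m 70) \<Longrightarrow> Q (\<mu>, out)"
  shows "wpp (test_modulus_code v) Q (m, out)"
proof -
  define r where "r = m 70"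
  define x where "x = m v"
  let ?l = "\<lambda>u. label nbrs D u mod r"
  let ?I = "\<lambda>i \<mu> out'. out' = out \<and> keep 71 \<mu> m \<and> \<mu> 72 = ?l x \<and>
    \<mu> 71 = of_bool (\<forall>u<i. (x, u) \<in> E \<longrightarrow> ?l u \<noteq> ?l x)"
  let ?body = "adj_code v 73;; IfLess 0 92
          (label_mod_code 73 70;; eq_code 74 80 72;; IfLess 0 74 (Basic (Copy 71 0)) Skip) Skip"
  have *: "wpp (for_code 73 4 ?body) Q (\<nu>, out)"
    if \<nu>: "keep 71 \<nu> m" "\<nu> 72 = ?l x" "\<nu> 71 = 1" for \<nu>
  proof (rule wp_for_code[where I = ?I and N = n])
    fix i \<mu> out' assume I: "?I i \<mu> out'" and i: "\<mu> 73 = i" "i < n"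
    have k: "keep 71 \<mu> m" and out: "out' = out" using I by auto
    have g: "glob \<mu>" using keeps_glob[OF k] m by simp
    have v: "\<mu> v = x" "\<mu> 70 = r" using keeps_less[OF k] reg by (simp_all add: x_def r_def)
    have x: "x < n" "1 \<le> r" "r \<le> q ^ 2" using m by (simp_all add: x_def r_def)
    let ?Q = "\<lambda>(\<mu>', out'). \<mu>' 73 = i \<and> ?I (Suc i) (\<mu>'(73 := Suc i)) out'"
    have all_Suc: "(\<forall>u<Suc i. (x, u) \<in> E \<longrightarrow> ?l u \<noteq> ?l x) \<longleftrightarrow>
        (\<forall>u<i. (x, u) \<in> E \<longrightarrow> ?l u \<noteq> ?l x) \<and> ((x, i) \<in> E \<longrightarrow> ?l i \<noteq> ?l x)"
      by (auto simp: less_Suc_eq)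
    show "wpp ?body ?Q (\<mu>, out')"
      unfolding wp_Seq
    proof (rule wp_adj_code[OF g])
      fix \<nu> assume \<nu>: "keep 90 \<nu> \<mu>" "\<nu> 92 = of_bool ((\<mu> v, \<mu> 73) \<in> E)"
      have g': "glob \<nu>" using keeps_glob[OF \<nu>(1) g] by simp
      have k': "keep 71 \<nu> m" by (rule keeps_trans[OF \<nu>(1) k]) auto
      have lk: "\<nu> 71 = \<mu> 71" "\<nu> 72 = \<mu> 72" "\<nu> 73 = i" "\<nu> 70 = r" "\<nu> 92 = of_bool ((x, i) \<in> E)"
        using \<nu> keeps_less[OF \<nu>(1)] v i by auto
      have *: "wpp (label_mod_code 73 70) (wpp (eq_code 74 80 72)
          (wpp (IfLess 0 74 (Basic (Copy 71 0)) Skip) ?Q)) (\<nu>, out')" if e: "(x, i) \<in> E"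
      proof (rule wp_label_mod_code[OF g'])
        fix \<xi> assume \<xi>: "keep 80 \<xi> \<nu>" "\<xi> 80 = label nbrs D (\<nu> 73) mod \<nu> 70"
        have g'': "glob \<xi>" using keeps_glob[OF \<xi>(1) g'] by simp
        have k'': "keep 71 \<xi> m" by (rule keeps_trans[OF \<xi>(1) k']) auto
        have lk': "\<xi> 71 = \<mu> 71" "\<xi> 72 = \<mu> 72" "\<xi> 73 = i" "\<xi> 80 = ?l i"
          using \<xi> keeps_less[OF \<xi>(1)] lk by auto
        show "wpp (eq_code 74 80 72)
          (wpp (IfLess 0 74 (Basic (Copy 71 0)) Skip) ?Q) (\<xi>, out')"
          using g'' k'' lk' e I unfolding all_Suc by simp
      qed (use lk x i in auto)
      show "wpp (IfLess 0 92 (label_mod_code 73 70;; eq_code 74 80 72;;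
          IfLess 0 74 (Basic (Copy 71 0)) Skip) Skip) ?Q (\<nu>, out')"
      proof (cases "(x, i) \<in> E")
        case True
        then show ?thesis using g' lk *[OF True] by simp
      next
        case False
        then show ?thesis using g' lk k' I unfolding all_Suc by simp
      qed
    qed (use v x reg in auto)
  next
    fix i \<mu> out' assume "?I i \<mu> out'"
    then show "base \<mu> \<and> \<mu> 4 = n" using keeps_glob m(1) by auto
  next
    fix \<mu> out' assume I: "?I n \<mu> out'"
    have "(\<forall>u<n. (x, u) \<in> E \<longrightarrow> ?l u \<noteq> ?l x) \<longleftrightarrow> (\<forall>u. (x, u) \<in> E \<longrightarrow> ?l u \<noteq> ?l x)"
      using edge_less by blast
    then show "Q (\<mu>, out')" using I Q by (simp add: x_def r_def)
  qed (use big_simps \<nu> keeps_less[OF \<nu>(1), of 0] m in auto)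
  show ?thesis
    unfolding test_modulus_code_def wp_Seq
  proof (rule wp_label_mod_code[OF m])
    fix \<nu> assume \<nu>: "keep 80 \<nu> m" "\<nu> 80 = label nbrs D (m v) mod m 70"
    have "keep 71 \<nu> m" by (rule keeps_trans[OF \<nu>(1) keeps_refl]) auto
    moreover have "glob \<nu>" using keeps_glob[OF \<nu>(1)] m by simp
    ultimately show "wpp (Basic (Copy 72 80)) (wpp (Basic (Copy 71 2)) (wpp (for_code 73 4 ?body) Q)) (\<nu>, out)"
      using \<nu> by (simp add: * x_def r_def)
  qed (use reg in auto)
qed

lemma wp_modulus_code:
  assumes m: "glob m" "m v < n" and reg: "v < 70"
    and Q: "\<And>\<mu>. keep 70 \<mu> m \<Longrightarrow> \<mu> 70 = separating_modulus (m v) \<Longrightarrow> Q (\<mu>, out)"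
  shows "wpp (modulus_code v) Q (m, out)"
proof -
  define x where "x = m v"
  define S where "S = separating_modulus x"
  have x: "x < n" using m by (simp add: x_def)
  let ?P = "\<lambda>r. \<forall>u. (x, u) \<in> E \<longrightarrow> label nbrs D u mod r \<noteq> label nbrs D x mod r"
  have S: "?P S" "1 \<le> S" "S < q ^ 2"
    using separating_modulus[OF x] separating_modulus_pos[OF x] separating_modulus_less[OF x]
    by (auto simp: S_def)
  have S_le: "S \<le> r" if "1 \<le> r" "?P r" for r
    unfolding S_def separating_modulus_def using that by (intro Least_le) auto
  \<comment> \<open>The search stays below the least separating modulus until it hits it. That this
    modulus is less than \<open>q ^ 2\<close> excludes an overflow.\<close>
  let ?I = "\<lambda>\<mu> out'. out' = out \<and> keep 70 \<mu> m \<and> \<mu> 71 \<le> 1 \<and>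
    (if \<mu> 71 = 1 then \<mu> 70 = S else \<mu> 70 < S)"
  have *: "wpp (WhileLess 71 2 (Basic (Op Add 70 70 2);; test_modulus_code v)) Q
    (m(70 := 0, 71 := 0), out)"
  proof (rule wp_WhileLess[where I = ?I and f = "\<lambda>\<mu>. S - \<mu> 70"])
    fix \<mu> out' assume I: "?I \<mu> out'" and less: "\<mu> 71 < \<mu> 2"
    have k: "keep 70 \<mu> m" and out: "out' = out" using I by auto
    have g: "glob \<mu>" using keeps_glob[OF k] m by simp
    define r where "r = \<mu> 70"
    have r: "r < S" using I less g by (simp add: r_def split: if_splits)
    have "Suc r \<le> 4 * q ^ 2" using r S(3) by linarith
    then have tb: "take_bit w (Suc r) = Suc r"
      using big_simps(5) by (intro take_bit_nat_eq_self) linarith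
    let ?Q = "\<lambda>(\<mu>', out'). ?I \<mu>' out' \<and> S - \<mu>' 70 < S - \<mu> 70"
    have v: "\<mu> v = x" using keeps_less[OF k] reg by (simp add: x_def)
    have "wpp (test_modulus_code v) ?Q (\<mu>(70 := Suc r), out')"
    proof (rule wp_test_modulus_code)
      fix \<nu> assume \<nu>: "keep 71 \<nu> (\<mu>(70 := Suc r))" "\<nu> 71 = of_bool (\<forall>u. ((\<mu>(70 := Suc r)) v, u) \<in> E \<longrightarrow>
        label nbrs D u mod (\<mu>(70 := Suc r)) 70 \<noteq> label nbrs D ((\<mu>(70 := Suc r)) v) mod (\<mu>(70 := Suc r)) 70)"
      have n71: "\<nu> 71 = of_bool (?P (Suc r))" using \<nu>(2) v reg by simp
      have n70: "\<nu> 70 = Suc r" using keeps_less[OF \<nu>(1), of 70] by simp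
      have "keep 70 \<nu> \<mu>" using keeps_trans[OF \<nu>(1), of 70 "\<lambda>_. True" \<mu>] by simp
      then have "keep 70 \<nu> m" by (rule keeps_trans[OF _ k]) auto
      moreover have "Suc r < S" if "\<not> ?P (Suc r)"
        using that S(1) r by (metis Suc_lessI)
      moreover have "Suc r = S" if "?P (Suc r)"
        using S_le[of "Suc r"] that r by simp
      ultimately show "?Q (\<nu>, out')"
        using n71 n70 r out by (cases "?P (Suc r)") (simp_all add: r_def)
    qed (use g v reg x r S in auto)
    then show "wpp (Basic (Op Add 70 70 2);; test_modulus_code v) ?Q (\<mu>, out')"
      using g tb by (simp add: r_def)
  next
    fix \<mu> out' assume I: "?I \<mu> out'" and "\<not> \<mu> 71 < \<mu> 2"
    moreover have "glob \<mu>" using I keeps_glob m by auto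
    ultimately show "Q (\<mu>, out')" using Q by (auto simp: S_def x_def)
  qed (use S in auto)
  show ?thesis
    unfolding modulus_code_def using m * by simp
qed

lemma wp_walk_code:
  assumes m: "glob m" "m v < n" "m t < q" and reg: "v < 60" "t < 60"
    and Q: "\<And>\<mu>. keep 60 \<mu> m \<Longrightarrow> \<mu> 60 = walk (m v) (m t) \<Longrightarrow> Q (\<mu>, out)"
  shows "wpp (walk_code v t) Q (m, out)"
  unfolding walk_code_def wp_Seq
proof (rule wp_modulus_code[OF m(1,2)])
  fix \<mu> assume \<mu>: "keep 70 \<mu> m" "\<mu> 70 = separating_modulus (m v)"
  have g: "glob \<mu>" using keeps_glob[OF \<mu>(1)] m by simp
  have v: "\<mu> v = m v" using keeps_less[OF \<mu>(1)] reg by simp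
  show "wpp (label_mod_code v 70) (wpp (walk_arith_code t) Q) (\<mu>, out)"
  proof (rule wp_label_mod_code[OF g])
    fix \<nu> assume \<nu>: "keep 80 \<nu> \<mu>" "\<nu> 80 = label nbrs D (\<mu> v) mod \<mu> 70"
    have g': "glob \<nu>" using keeps_glob[OF \<nu>(1) g] by simp
    have k: "keep 60 \<nu> m"
      using keeps_trans[OF \<nu>(1) \<mu>(1)] by (rule keeps_trans[OF _ keeps_refl]) auto
    let ?r = "separating_modulus (m v)" and ?y = "residue_label (m v)"
    have lk: "\<nu> 70 = ?r" "\<nu> 80 = ?y" "\<nu> t = m t"
      using \<nu> \<mu> v keeps_less[OF \<nu>(1)] keeps_less[OF k] reg by (auto simp: residue_label_def)
    have d: "?r div q < q" "?y div q < q" "?r mod q < q" "?y mod q < q"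
      using separating_modulus_less[OF m(2)] residue_label_less[OF m(2)] q_pos
      by (simp_all add: less_mult_imp_div_less power2_eq_square)
    \<comment> \<open>Reducing after each multiplication keeps both summands below \<open>q\<close>,
      so no product exceeds \<open>2 * q ^ 2\<close>.\<close>
    have tb: "take_bit w (z + z') = z + z'" "take_bit w ((z + z') * m t) = (z + z') * m t"
      "take_bit w z = z" if "z < q" "z' < q" for z z'
    proof -
      have "(z + z') * m t \<le> (q + q) * q" using that m(3) by (intro mult_mono) auto
      also have "\<dots> \<le> 4 * q ^ 2" by (simp add: power2_eq_square)
      finally have "(z + z') * m t < 2 ^ w" using big_simps(5) by linarith
      moreover have "q + q \<le> 4 * q ^ 2"
        using q_pos mult_le_mono1[of 1 q q] unfolding power2_eq_square by linarith
      then have "z + z' < 2 ^ w" using that big_simps(5) by linarith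
      ultimately show "take_bit w (z + z') = z + z'" "take_bit w ((z + z') * m t) = (z + z') * m t"
        "take_bit w z = z"
        by (auto intro!: take_bit_nat_eq_self)
    qed
    \<comment> \<open>The early reductions are harmless: \<open>walk\<close> reduces only once, at
      the end.\<close>
    have horner: "(z mod q + z') * m t mod q = (z + z') * m t mod q" for z z'
      by (metis mod_add_left_eq mod_mult_left_eq)
    show "wpp (walk_arith_code t) Q (\<nu>, out)"
      unfolding walk_arith_code_def using lk g' reg m d k q_pos
      by (simp add: tb) (rule Q, simp_all add: walk_def horner mod_add_left_eq)
  qed (use \<mu> g v m reg separating_modulus_pos separating_modulus_less in \<open>auto simp: less_imp_le\<close>)
qed (use reg in auto)

lemma wp_valid_code:
  assumes m: "glob m" "m v < n" "m t < q" and reg: "v < 50" "t < 50"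
    and Q: "\<And>\<mu>. keep 50 \<mu> m \<Longrightarrow> \<mu> 50 = of_bool (valid_time (m v) (m t)) \<Longrightarrow> Q (\<mu>, out)"
  shows "wpp (valid_code v t) Q (m, out)"
proof -
  define x where "x = m v"
  define a where "a = m t"
  let ?I = "\<lambda>i \<mu> out'. out' = out \<and> keep 50 \<mu> m \<and> \<mu> 51 = walk x a \<and>
    \<mu> 50 = of_bool (\<forall>u<i. (x, u) \<in> E \<longrightarrow> walk u a \<noteq> walk x a)"
  let ?body = "adj_code v 52;; IfLess 0 92
          (walk_code 52 t;; eq_code 53 60 51;; IfLess 0 53 (Basic (Copy 50 0)) Skip) Skip"
  have *: "wpp (for_code 52 4 ?body) Q (\<nu>, out)"
    if \<nu>: "keep 50 \<nu> m" "\<nu> 51 = walk x a" "\<nu> 50 = 1" for \<nu>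
  proof (rule wp_for_code[where I = ?I and N = n])
    fix i \<mu> out' assume I: "?I i \<mu> out'" and i: "\<mu> 52 = i" "i < n"
    have k: "keep 50 \<mu> m" and out: "out' = out" using I by auto
    have g: "glob \<mu>" using keeps_glob[OF k] m by simp
    have v: "\<mu> v = x" using keeps_less[OF k] reg by (simp add: x_def)
    have x: "x < n" "a < q" using m by (simp_all add: x_def a_def)
    let ?Q = "\<lambda>(\<mu>', out'). \<mu>' 52 = i \<and> ?I (Suc i) (\<mu>'(52 := Suc i)) out'"
    have all_Suc: "(\<forall>u<Suc i. (x, u) \<in> E \<longrightarrow> walk u a \<noteq> walk x a) \<longleftrightarrow>
        (\<forall>u<i. (x, u) \<in> E \<longrightarrow> walk u a \<noteq> walk x a) \<and> ((x, i) \<in> E \<longrightarrow> walk i a \<noteq> walk x a)"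
      by (auto simp: less_Suc_eq)
    show "wpp ?body ?Q (\<mu>, out')"
      unfolding wp_Seq
    proof (rule wp_adj_code[OF g])
      fix \<nu> assume \<nu>: "keep 90 \<nu> \<mu>" "\<nu> 92 = of_bool ((\<mu> v, \<mu> 52) \<in> E)"
      have g': "glob \<nu>" using keeps_glob[OF \<nu>(1) g] by simp
      have k': "keep 50 \<nu> m" by (rule keeps_trans[OF \<nu>(1) k]) auto
      have lk: "\<nu> 50 = \<mu> 50" "\<nu> 51 = \<mu> 51" "\<nu> 52 = i" "\<nu> t = a" "\<nu> 92 = of_bool ((x, i) \<in> E)"
        using \<nu> keeps_less[OF \<nu>(1)] keeps_less[OF k'] v i reg by (auto simp: a_def)
      have *: "wpp (walk_code 52 t) (wpp (eq_code 53 60 51)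
          (wpp (IfLess 0 53 (Basic (Copy 50 0)) Skip) ?Q)) (\<nu>, out')" if e: "(x, i) \<in> E"
      proof (rule wp_walk_code[OF g'])
        fix \<xi> assume \<xi>: "keep 60 \<xi> \<nu>" "\<xi> 60 = walk (\<nu> 52) (\<nu> t)"
        have g'': "glob \<xi>" using keeps_glob[OF \<xi>(1) g'] by simp
        have k'': "keep 50 \<xi> m" by (rule keeps_trans[OF \<xi>(1) k']) auto
        have lk': "\<xi> 50 = \<mu> 50" "\<xi> 51 = \<mu> 51" "\<xi> 52 = i" "\<xi> 60 = walk i a"
          using \<xi> keeps_less[OF \<xi>(1)] lk by auto
        show "wpp (eq_code 53 60 51)
          (wpp (IfLess 0 53 (Basic (Copy 50 0)) Skip) ?Q) (\<xi>, out')"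
          using g'' k'' lk' e I unfolding all_Suc by simp
      qed (use lk x i reg in auto)
      show "wpp (IfLess 0 92 (walk_code 52 t;; eq_code 53 60 51;;
          IfLess 0 53 (Basic (Copy 50 0)) Skip) Skip) ?Q (\<nu>, out')"
      proof (cases "(x, i) \<in> E")
        case True
        then show ?thesis using g' lk *[OF True] by simp
      next
        case False
        then show ?thesis using g' lk k' I unfolding all_Suc by simp
      qed
    qed (use v x reg in auto)
  next
    fix i \<mu> out' assume "?I i \<mu> out'"
    then show "base \<mu> \<and> \<mu> 4 = n" using keeps_glob m(1) by auto
  next
    fix \<mu> out' assume I: "?I n \<mu> out'"
    have "(\<forall>u<n. (x, u) \<in> E \<longrightarrow> walk u a \<noteq> walk x a) \<longleftrightarrow> valid_time x a"
      using edge_less unfolding valid_time_def by blast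
    then show "Q (\<mu>, out')" using I Q by (simp add: x_def a_def)
  qed (use big_simps \<nu> keeps_less[OF \<nu>(1), of 0] m in auto)
  show ?thesis
    unfolding valid_code_def wp_Seq
  proof (rule wp_walk_code[OF m])
    fix \<nu> assume \<nu>: "keep 60 \<nu> m" "\<nu> 60 = walk (m v) (m t)"
    have "keep 50 \<nu> m" by (rule keeps_trans[OF \<nu>(1) keeps_refl]) auto
    moreover have "glob \<nu>" using keeps_glob[OF \<nu>(1)] m by simp
    ultimately show "wpp (Basic (Copy 51 60)) (wpp (Basic (Copy 50 2)) (wpp (for_code 52 4 ?body) Q)) (\<nu>, out)"
      using \<nu> by (simp add: * x_def a_def)
  qed (use reg in auto)
qed

lemma wp_blocks_stop_code:
  assumes m: "glob m" "m x < n * q" "m y < n * q" and reg: "x < 40" "y < 40"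
    and Q: "\<And>\<mu>. keep 40 \<mu> m \<Longrightarrow> \<mu> 40 = of_bool (blocks_stop (m x) (m y)) \<Longrightarrow> Q (\<mu>, out)"
  shows "wpp (blocks_stop_code x y) Q (m, out)"
proof -
  define v t u a where "v = m x div q" and "t = m x mod q" and "u = m y div q" and "a = m y mod q"
  have lt: "v < n" "u < n" "t < q" "a < q"
    using m q_pos by (simp_all add: v_def u_def t_def a_def less_mult_imp_div_less)
  have B: "blocks_stop (m x) (m y) \<longleftrightarrow> a < t \<and> valid_time u a \<and> (u = v \<or> (v, u) \<in> E \<and> walk u a = walk v t)"
    using m by (simp add: blocks_stop_def v_def u_def t_def a_def)
  \<comment> \<open>What survives every subroutine call: the decoded vertices and times in cells 41
    to 44. The stages then treat the nested tests from the innermost outwards.\<close>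
  let ?J = "\<lambda>\<mu>. keep 40 \<mu> m \<and> \<mu> 41 = v \<and> \<mu> 42 = t \<and> \<mu> 43 = u \<and> \<mu> 44 = a \<and> glob \<mu>"
  have J: "?J \<nu>" if "keep l \<nu> \<mu>" "45 \<le> l" "?J \<mu>" for l \<nu> \<mu>
  proof -
    have "keep 40 \<nu> m" by (rule keeps_trans[OF that(1)]) (use that in auto)
    then show ?thesis using that keeps_less[OF that(1)] keeps_glob[OF that(1)] by auto
  qed
  have stage4: "wpp (walk_code 43 44) (wpp (Basic (Copy 45 60)) (wpp (walk_code 41 42) (wpp (eq_code 40 45 60) Q))) (\<mu>, out)"
    if \<mu>: "?J \<mu>" "a < t" "valid_time u a" "u \<noteq> v" "(v, u) \<in> E" for \<mu>
  proof (rule wp_walk_code)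
    fix \<nu> assume \<nu>: "keep 60 \<nu> \<mu>" "\<nu> 60 = walk (\<mu> 43) (\<mu> 44)"
    have J': "?J \<nu>" using J[OF \<nu>(1)] \<mu>(1) by simp
    have "wpp (walk_code 41 42) (wpp (eq_code 40 45 60) Q) (\<nu>(45 := \<nu> 60), out)"
    proof (rule wp_walk_code)
      fix \<xi> assume \<xi>: "keep 60 \<xi> (\<nu>(45 := \<nu> 60))" "\<xi> 60 = walk ((\<nu>(45 := \<nu> 60)) 41) ((\<nu>(45 := \<nu> 60)) 42)"
      have J'': "?J \<xi>" by (rule J[OF \<xi>(1)]) (use J' in auto)
      have "\<xi> 45 = walk u a" using keeps_less[OF \<xi>(1), of 45] \<nu>(2) \<mu>(1) by simp
      moreover have "\<xi> 60 = walk v t" using \<xi>(2) J' by simp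
      ultimately show "wpp (eq_code 40 45 60) Q (\<xi>, out)"
        using J'' \<mu> B Q[of "\<xi>(40 := of_bool (walk u a = walk v t))"] by simp
    qed (use J' lt in auto)
    then show "wpp (Basic (Copy 45 60)) (wpp (walk_code 41 42) (wpp (eq_code 40 45 60) Q)) (\<nu>, out)"
      by simp
  qed (use \<mu> lt in auto)
  have stage3: "wpp (adj_code 41 43) (wpp (IfLess 0 92
      (walk_code 43 44;; Basic (Copy 45 60);; walk_code 41 42;; eq_code 40 45 60) Skip) Q) (\<mu>, out)"
    if \<mu>: "?J \<mu>" "a < t" "valid_time u a" "u \<noteq> v" "\<mu> 40 = 0" for \<mu>
  proof (rule wp_adj_code)
    fix \<nu> assume \<nu>: "keep 90 \<nu> \<mu>" "\<nu> 92 = of_bool ((\<mu> 41, \<mu> 43) \<in> E)"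
    have J': "?J \<nu>" using J[OF \<nu>(1)] \<mu>(1) by simp
    have "\<nu> 40 = 0" using keeps_less[OF \<nu>(1), of 40] \<mu> by simp
    then show "wpp (IfLess 0 92
      (walk_code 43 44;; Basic (Copy 45 60);; walk_code 41 42;; eq_code 40 45 60) Skip) Q (\<nu>, out)"
      using J' \<nu>(2) \<mu> stage4[OF J' \<mu>(2-4)] B Q[of \<nu>] by simp
  qed (use \<mu> lt in auto)
  have stage2: "wpp (valid_code 43 44) (wpp (IfLess 0 50 (eq_code 40 43 41;;
      IfLess 0 40 Skip (adj_code 41 43;; IfLess 0 92
      (walk_code 43 44;; Basic (Copy 45 60);; walk_code 41 42;; eq_code 40 45 60) Skip)) Skip) Q) (\<mu>, out)"
    if \<mu>: "?J \<mu>" "a < t" "\<mu> 40 = 0" for \<mu>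
  proof (rule wp_valid_code)
    fix \<nu> assume \<nu>: "keep 50 \<nu> \<mu>" "\<nu> 50 = of_bool (valid_time (\<mu> 43) (\<mu> 44))"
    have J': "?J \<nu>" using J[OF \<nu>(1)] \<mu>(1) by simp
    have J'': "?J (\<nu>(40 := z))" for z using J' by simp
    have "\<nu> 40 = 0" using keeps_less[OF \<nu>(1), of 40] \<mu> by simp
    moreover have "Q (\<nu>(40 := Suc 0), out)" if "valid_time u a" "u = v"
      by (rule Q) (use J' B \<mu>(2) that in auto)
    ultimately show "wpp (IfLess 0 50 (eq_code 40 43 41;;
      IfLess 0 40 Skip (adj_code 41 43;; IfLess 0 92
      (walk_code 43 44;; Basic (Copy 45 60);; walk_code 41 42;; eq_code 40 45 60) Skip)) Skip) Q (\<nu>, out)"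
      using J' \<nu>(2) \<mu> stage3[OF J'' \<mu>(2), of 0] B Q[of \<nu>] by simp
  qed (use \<mu> lt in auto)
  have le: "v < 2 ^ w" "u < 2 ^ w" "t < 2 ^ w" "a < 2 ^ w" using lt big_simps by linarith+
  then have tb: "take_bit w v = v" "take_bit w u = u" "take_bit w t = t" "take_bit w a = a"
    by (auto intro!: take_bit_nat_eq_self)
  let ?m = "m(40 := 0, 41 := v, 42 := t, 43 := u, 44 := a)"
  have J': "?J ?m" using m by simp
  show ?thesis
    unfolding blocks_stop_code_def
    using m reg tb stage2[OF J'] B Q[of ?m] J'
    by (simp flip: v_def t_def u_def a_def)
qed

end

text \<open>
  Termination measure of the kernel evaluation: the stack entries followed by the next candidate form
  a sequence that increases lexicographically; adding 1 to each digit distinguishes 0 from the end of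
  the sequence.
\<close>

definition remaining :: "nat \<Rightarrow> nat \<Rightarrow> (nat \<Rightarrow> nat) \<Rightarrow> nat" where
  "remaining L N f = (\<Sum>i\<le>L. (N + 1 - f i) * (N + 2) ^ (L - i))"

text \<open>A geometric series: even if all lower digits have the largest value \<open>N + 1\<close>
  in base \<open>N + 2\<close>, they do not make up one unit at position \<open>j\<close>.\<close>

lemma sum_digits_less: "(\<Sum>i\<in>{Suc j..L}. (N + 1) * (N + 2) ^ (L - i)) < (N + 2 :: nat) ^ (L - j)"
proof (induction "L - j" arbitrary: j)
  case 0
  then have "{Suc j..L} = {}" by auto
  then show ?case by simp
next
  case (Suc k)
  then have jL: "j < L" by simp
  then have split: "{Suc j..L} = insert (Suc j) {Suc (Suc j)..L}" by auto
  have "(\<Sum>i\<in>{Suc (Suc j)..L}. (N + 1) * (N + 2) ^ (L - i)) < (N + 2) ^ (L - Suc j)"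
    using Suc(1)[of "Suc j"] Suc(2) by simp
  then have "(\<Sum>i\<in>{Suc j..L}. (N + 1) * (N + 2) ^ (L - i))
      < (N + 1) * (N + 2) ^ (L - Suc j) + (N + 2) ^ (L - Suc j)"
    unfolding split by simp
  also have "\<dots> = (N + 2) ^ Suc (L - Suc j)" by simp
  also have "Suc (L - Suc j) = L - j" using jL by simp
  finally show ?case .
qed

text \<open>The complemented digit at position \<open>j\<close> drops by at least one unit, which
  outweighs arbitrary changes at all later positions.\<close>

lemma remaining_less:
  assumes j: "j \<le> L" and eq: "\<And>i. i < j \<Longrightarrow> f i = g i" and less: "f j < g j" and g: "g j \<le> N + 1"
  shows "remaining L N g < remaining L N f"
proof -
  have split: "{..L} = {..<j} \<union> {j} \<union> {Suc j..L}" using j by auto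
  let ?t = "\<lambda>f i. (N + 1 - f i) * (N + 2) ^ (L - i)"
  have sum: "remaining L N f = (\<Sum>i<j. ?t f i) + ?t f j + (\<Sum>i\<in>{Suc j..L}. ?t f i)" for f
    unfolding remaining_def split by (subst sum.union_disjoint, auto)+
  have "(\<Sum>i\<in>{Suc j..L}. ?t g i) \<le> (\<Sum>i\<in>{Suc j..L}. (N + 1) * (N + 2) ^ (L - i))"
    by (intro sum_mono mult_right_mono) auto
  also have "\<dots> < (N + 2) ^ (L - j)" by (rule sum_digits_less)
  finally have "?t g j + (\<Sum>i\<in>{Suc j..L}. ?t g i) < Suc (N + 1 - g j) * (N + 2) ^ (L - j)"
    by simp
  also have "\<dots> \<le> ?t f j"
    using less g by (intro mult_right_mono) auto
  finally show ?thesis using eq unfolding sum by simp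
qed

section \<open>Depth-first evaluation of kernels\<close>

context mis_program
begin

text \<open>The rank limits the length of a path, hence \<open>q\<close> stack cells suffice, and
  \<open>bounded\<close> makes the candidates below \<open>N\<close> exhaustive. \<open>S'\<close>
  are the stack cells that \<open>body\<close> leaves alone, including the stack
  \<open>b + 2 * d\<close> in use here; \<open>S\<close> are those preserved by the whole
  evaluation, which must avoid this stack.\<close>

lemma wp_kernel_code:
  fixes R :: "nat \<Rightarrow> nat \<Rightarrow> bool" and rank :: "nat \<Rightarrow> nat"
  assumes m: "glob m" "m x < N"
    and hi: "hi < 8" "\<And>\<mu>. glob \<mu> \<Longrightarrow> \<mu> hi = N" and N: "N < 2 ^ w"
    and reg: "8 \<le> r" "x < r" "r + 6 < l" "l \<le> e" "e < 102"
    and stack: "102 \<le> b" "b < 104" "\<And>d. S' (b + 2 * d)" "\<And>a. S a \<Longrightarrow> S' a" "\<And>d. \<not> S (b + 2 * d)"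
    and rank: "\<And>x y. R x y \<Longrightarrow> rank y < rank x" "\<And>x. rank x < q"
    and bounded: "\<And>x y. R x y \<Longrightarrow> y < N"
    and body: "\<And>\<mu> out' Q'. glob \<mu> \<Longrightarrow> \<mu> (r + 5) < N \<Longrightarrow> \<mu> (r + 6) < N \<Longrightarrow>
      (\<And>\<nu>. keeps l S' \<nu> \<mu> \<Longrightarrow> \<nu> e = of_bool (R (\<mu> (r + 5)) (\<mu> (r + 6))) \<Longrightarrow> Q' (\<nu>, out')) \<Longrightarrow>
      wpp body Q' (\<mu>, out')"
    and Q: "\<And>\<mu>. keeps r S \<mu> m \<Longrightarrow> \<mu> r = of_bool (kernel R (m x)) \<Longrightarrow> Q (\<mu>, out)"
  shows "wpp (kernel_code b r x hi e body) Q (m, out)"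
proof -
  define K where "K = kernel R"
  have K: "K z \<longleftrightarrow> (\<forall>y. R z y \<longrightarrow> \<not> K y)" for z
    unfolding K_def by (rule kernel_iff[of R rank, OF rank(1)])
  define p where "p = (\<lambda>d. b + 2 * d)"
  have p: "p d < s" if "d < q" for d
    using that stack(2) s_eq by (simp add: p_def)
  have p_fits: "take_bit w (p d) = p d" if "d < q" for d
    using p[OF that] big_simps(7) by (intro take_bit_nat_eq_self) linarith
  have p_eq [simp]: "p d = p d' \<longleftrightarrow> d = d'" for d d' by (simp add: p_def)
  have p_ge: "102 \<le> p d" for d using stack(1) by (simp add: p_def)
  have low: "a < s" if "a < 102" for a using that by simp
  \<comment> \<open>The stack is an \<open>R\<close>-path from the root. On every level, the
    successors smaller than the one taken, or than the current candidate at the top, are known to be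
    outside the kernel.\<close>
  define Path where "Path = (\<lambda>\<mu> d. \<mu> (r + 1) = p d \<and> \<mu> (p 0) = m x \<and> d < q \<and>
    (\<forall>i\<le>d. \<mu> (p i) < N) \<and>
    (\<forall>i<d. R (\<mu> (p i)) (\<mu> (p (Suc i))) \<and> (\<forall>y<\<mu> (p (Suc i)). R (\<mu> (p i)) y \<longrightarrow> \<not> K y)) \<and>
    (\<forall>y<\<mu> (r + 2). R (\<mu> (p d)) y \<longrightarrow> \<not> K y) \<and> \<mu> (r + 2) \<le> N)"
  define Iv where "Iv = (\<lambda>\<mu> out'. out' = out \<and> keeps r S \<mu> m \<and> \<mu> (r + 4) = b \<and>
    (\<mu> (r + 3) = 0 \<and> (\<exists>d. Path \<mu> d) \<or> \<mu> (r + 3) = 1 \<and> \<mu> r = of_bool (K (m x))))"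
  define digits where "digits = (\<lambda>\<mu> d i. if i < d then \<mu> (p (Suc i)) + 1 else if i = d then \<mu> (r + 2) + 1 else (0 :: nat))"
  \<comment> \<open>The depth is read off the stack pointer. Setting the flag sends the measure to
    0, and \<open>Suc\<close> makes this a decrease from every state of the search.\<close>
  define M where "M = (\<lambda>\<mu>. (1 - \<mu> (r + 3)) * Suc (remaining q N (digits \<mu> ((\<mu> (r + 1) - b) div 2))))"
  have M_path: "M \<mu> = Suc (remaining q N (digits \<mu> d))" if "\<mu> (r + 3) = 0" "\<mu> (r + 1) = p d" for \<mu> d
    using that by (simp add: M_def p_def)
  have M_done: "M \<mu> = 0" if "\<mu> (r + 3) = 1" for \<mu> using that by (simp add: M_def)
  have keeps_stack: "keeps r S (\<mu>(p d := z)) m = keeps r S \<mu> m" for \<mu> d z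
  proof -
    have "a \<noteq> p d" if "S a" for a using stack(5)[of d] that by (auto simp: p_def)
    then show ?thesis using reg p_ge[of d] unfolding keeps_def by auto
  qed
  have glob_stack: "glob (\<mu>(p d := z)) = glob \<mu>" for \<mu> d z
    using p_ge[of d] by simp
  have path_rank: "rank (\<mu> (p i)) + i \<le> rank (\<mu> (p 0))" if "Path \<mu> d" "i \<le> d" for \<mu> d i
    using that(2)
  proof (induction i)
    case (Suc i)
    then have "R (\<mu> (p i)) (\<mu> (p (Suc i)))" using that(1) unfolding Path_def by auto
    from rank(1)[OF this] Suc show ?case by simp
  qed simp
  have p_reg [simp]: "a < 102 \<Longrightarrow> (p d = a) = False" "a < 102 \<Longrightarrow> (a = p d) = False" for a d
    using p_ge[of d] by auto
  have p_Suc: "take_bit w (p d + 2) = p (Suc d)" if "Suc d < q" for d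
    using p_fits[OF that] by (simp add: p_def)
  have p_pred: "take_bit w (2 ^ w + p (Suc d) - 2) = p d" if "d < q" for d
  proof -
    have "2 ^ w + p (Suc d) - 2 = p d + 2 ^ w" by (simp add: p_def)
    then show ?thesis using p_fits[OF that] by (simp add: take_bit_eq_mod)
  qed
  let ?push = "Basic (Op Add (r + 1) (r + 1) 3);; Basic (Store (r + 1) (r + 2));; Basic (Copy (r + 2) 0)"
  let ?next = "Basic (Op Add (r + 2) (r + 2) 2)"
  let ?pop = "IfLess (r + 4) (r + 1)
             (Basic (Op Sub (r + 1) (r + 1) 3);;
              IfLess (r + 4) (r + 1)
                (Basic (Load (r + 2) (r + 1));; Basic (Op Add (r + 2) (r + 2) 2);;
                 Basic (Op Sub (r + 1) (r + 1) 3))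
                (Basic (Copy r 0);; Basic (Copy (r + 3) 2)))
             (Basic (Copy r 2);; Basic (Copy (r + 3) 2))"
  let ?loop = "IfLess (r + 2) hi
          (Basic (Load (r + 5) (r + 1));; Basic (Copy (r + 6) (r + 2));; body;;
           IfLess 0 e ?push ?next) ?pop"
  have regs: "r + 6 < 102" "r < 102" using reg by auto
  note reg_simps = regs reg
  have *: "wpp (WhileLess (r + 3) 2 ?loop) Q (\<nu>, out)"
    if \<nu>: "Iv \<nu> out" for \<nu>
  proof (rule wp_WhileLess[where I = Iv and f = M])
    fix \<mu> out' assume I: "Iv \<mu> out'" and less: "\<mu> (r + 3) < \<mu> 2"
    have k: "keeps r S \<mu> m" and out: "out' = out" and bb: "\<mu> (r + 4) = b"
      using I unfolding Iv_def by auto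
    have g: "glob \<mu>" using keeps_glob[OF k] m reg by simp
    have f: "\<mu> (r + 3) = 0" using less g by simp
    then obtain d where Path: "Path \<mu> d" using I unfolding Iv_def by auto
    note path = Path[unfolded Path_def]
    define y where "y = \<mu> (r + 2)"
    have M\<mu>: "M \<mu> = Suc (remaining q N (digits \<mu> d))" using M_path f path by simp
    define Qn where "Qn = (\<lambda>(\<mu>', out'). Iv \<mu>' out' \<and> M \<mu>' < M \<mu>)"
    have "wpp ?loop Qn (\<mu>, out')"
    proof (cases "y < N")
      case True
      let ?\<mu> = "\<mu>(r + 5 := \<mu> (p d), r + 6 := y)"
      have "wpp body (wpp (IfLess 0 e ?push ?next) Qn) (?\<mu>, out')"
      proof (rule body)
        fix \<nu> assume \<nu>: "keeps l S' \<nu> ?\<mu>" "\<nu> e = of_bool (R (?\<mu> (r + 5)) (?\<mu> (r + 6)))"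
        have g': "glob \<nu>" using keeps_glob[OF \<nu>(1)] g reg by simp
        have lo: "\<nu> a = \<mu> a" if "a < r + 5" for a
          using keeps_less[OF \<nu>(1), of a] that reg by simp
        have pp: "\<nu> (p i) = \<mu> (p i)" for i
          using \<nu>(1) stack(3)[of i] p_ge[of i] reg unfolding keeps_def by (simp add: p_def)
        have k': "keeps r S \<nu> m"
        proof (rule keeps_trans[OF \<nu>(1)])
          show "keeps r S ?\<mu> m" using k reg by simp
        qed (use reg stack(4) in auto)
        have ne: "\<nu> e = of_bool (R (\<mu> (p d)) y)" using \<nu>(2) by simp
        show "wpp (IfLess 0 e ?push ?next) Qn (\<nu>, out')"
        proof (cases "R (\<mu> (p d)) y")
          case True
          \<comment> \<open>Ranks drop along the path, so before a push at least one stack cell is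
            still free.\<close>
          have "rank (\<mu> (p d)) + d \<le> rank (\<mu> (p 0))" by (rule path_rank[OF Path]) simp
          then have d: "Suc d < q" using rank(1)[OF True] rank(2)[of "\<mu> (p 0)"] by linarith
          let ?\<rho> = "\<nu>(r + 1 := p (Suc d), p (Suc d) := y, r + 2 := 0)"
          have path': "Path ?\<rho> (Suc d)"
            unfolding Path_def using path d True \<open>y < N\<close> regs by (auto simp: pp less_Suc_eq le_Suc_eq y_def)
          \<comment> \<open>The digit at \<open>d\<close> is unchanged, since the candidate becomes
            a stack entry; the digit at \<open>Suc d\<close> rises from 0, the end of the sequence,
            to 1.\<close>
          have "remaining q N (digits ?\<rho> (Suc d)) < remaining q N (digits \<mu> d)"
            by (rule remaining_less[of "Suc d"]) (use d regs in \<open>auto simp: digits_def pp y_def less_Suc_eq\<close>)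
          then have "M ?\<rho> < M \<mu>"
            unfolding M\<mu> using M_path[of ?\<rho> "Suc d"] path'[unfolded Path_def] lo f regs by simp
          moreover have "Iv ?\<rho> out'"
            unfolding Iv_def using path' k' out lo[of "r + 3"] lo[of "r + 4"] f bb reg by (auto simp: keeps_stack)
          ultimately have "Qn (?\<rho>, out')" by (simp add: Qn_def)
          then show ?thesis
            using True ne g' regs reg lo[of "r + 1"] lo[of "r + 2"] path p[OF d] p_Suc[OF d] low
            by (simp add: y_def)
        next
          case False
          let ?\<rho> = "\<nu>(r + 2 := Suc y)"
          have path': "Path ?\<rho> d"
            unfolding Path_def using path False \<open>y < N\<close> regs lo[of "r + 1"] by (auto simp: pp less_Suc_eq y_def)
          have "remaining q N (digits ?\<rho> d) < remaining q N (digits \<mu> d)"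
            by (rule remaining_less[of d]) (use path regs \<open>y < N\<close> in \<open>auto simp: digits_def pp y_def\<close>)
          then have "M ?\<rho> < M \<mu>"
            unfolding M\<mu> using M_path[of ?\<rho> d] path'[unfolded Path_def] lo f regs by simp
          moreover have "Iv ?\<rho> out'"
            unfolding Iv_def using path' k' out lo[of "r + 3"] lo[of "r + 4"] f bb reg by auto
          ultimately have "Qn (?\<rho>, out')" by (simp add: Qn_def)
          moreover have "take_bit w (Suc y) = Suc y"
            using \<open>y < N\<close> N by (intro take_bit_nat_eq_self) simp
          ultimately show ?thesis
            using False ne g' regs reg lo[of "r + 2"] low by (simp add: y_def)
        qed
      qed (use g reg path True in auto)
      then show ?thesis
        using True g hi(2)[OF g] path regs reg p[of d] low hi(1) by (simp add: y_def)
    next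
      case False
      then have yN: "y = N" using path by (simp add: y_def)
      \<comment> \<open>All possible successors have been examined and none of them is in the
        kernel.\<close>
      have Kd: "K (\<mu> (p d))"
        using path bounded K[of "\<mu> (p d)"] yN unfolding y_def by auto
      have step: "wpp ?pop Qn (\<mu>, out')"
      proof (cases d)
        case 0
        let ?\<rho> = "\<mu>(r := 1, r + 3 := 1)"
        have "Qn (?\<rho>, out')"
          unfolding Qn_def Iv_def using k out bb reg path Kd 0 M_done[of ?\<rho>] M\<mu> by auto
        moreover have "\<not> \<mu> (r + 4) < \<mu> (r + 1)" using path bb 0 by (simp add: p_def)
        ultimately show ?thesis using g regs reg low by simp
      next
        case (Suc c)
        have b1: "\<mu> (r + 4) < \<mu> (r + 1)" using path bb Suc by (simp add: p_def)
        have R: "R (\<mu> (p c)) (\<mu> (p d))" using path Suc by auto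
        then have Kc: "\<not> K (\<mu> (p c))" using Kd K by blast
        have cq: "c < q" using path Suc by simp
        have pc: "take_bit w (2 ^ w + \<mu> (r + 1) - 2) = p c" using path Suc p_pred[OF cq] by simp
        show ?thesis
        proof (cases c)
          case 0
          let ?\<rho> = "\<mu>(r + 1 := p c, r := 0, r + 3 := 1)"
          have "Qn (?\<rho>, out')"
            unfolding Qn_def Iv_def using k out bb reg path Kc 0 M_done[of ?\<rho>] M\<mu> by auto
          moreover have "\<not> b < p c" using 0 by (simp add: p_def)
          ultimately show ?thesis using g regs reg low b1 bb pc by simp
        next
          case (Suc c')
          let ?\<rho> = "\<mu>(r + 1 := p c', r + 2 := Suc (\<mu> (p c)))"
          have d: "d = Suc (Suc c')" using \<open>d = Suc c\<close> Suc by simp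
          have c'q: "c' < q" using cq Suc by simp
          have xc: "\<mu> (p c) < N" using path d Suc by auto
          have "\<not> K z" if "z < Suc (\<mu> (p c))" "R (\<mu> (p c')) z" for z
            using that path d Suc Kc by (auto simp: less_Suc_eq)
          moreover have "R (\<mu> (p i)) (\<mu> (p (Suc i)))" "z < \<mu> (p (Suc i)) \<Longrightarrow> R (\<mu> (p i)) z \<Longrightarrow> \<not> K z"
            if "i < c'" for i z
          proof -
            have "i < d" using that d by simp
            then show "R (\<mu> (p i)) (\<mu> (p (Suc i)))" "z < \<mu> (p (Suc i)) \<Longrightarrow> R (\<mu> (p i)) z \<Longrightarrow> \<not> K z"
              using path by blast+
          qed
          moreover have "\<mu> (p i) < N" if "i \<le> c'" for i using path d that by simp
          ultimately have path': "Path ?\<rho> c'"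
            unfolding Path_def using path regs xc c'q by auto
          \<comment> \<open>The digit at \<open>c'\<close> grows by one because the refuted entry is
            replaced by its successor as candidate; the deeper digits disappear.\<close>
          have "remaining q N (digits ?\<rho> c') < remaining q N (digits \<mu> d)"
            by (rule remaining_less[of c']) (use c'q d xc Suc regs in \<open>auto simp: digits_def\<close>)
          then have "M ?\<rho> < M \<mu>"
            unfolding M\<mu> using M_path[of ?\<rho> c'] path'[unfolded Path_def] f regs by simp
          moreover have "Iv ?\<rho> out'"
            unfolding Iv_def using path' k out f bb reg by auto
          ultimately have "Qn (?\<rho>, out')" by (simp add: Qn_def)
          moreover have "take_bit w (Suc (\<mu> (p c))) = Suc (\<mu> (p c))"
            using xc N by (intro take_bit_nat_eq_self) simp
          moreover have "b < p c" using Suc by (simp add: p_def)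
          moreover have "take_bit w (2 ^ w + p c - 2) = p c'" using p_pred[OF c'q] Suc by simp
          ultimately show ?thesis using g regs reg low b1 bb pc p[OF cq]
            by (simp add: fun_upd_twist)
        qed
      qed
      then show ?thesis using False g hi(2)[OF g] regs reg low hi(1) by (simp add: y_def)
    qed
    then show "wpp ?loop (\<lambda>(\<mu>', out'). Iv \<mu>' out' \<and> M \<mu>' < M \<mu>) (\<mu>, out')"
      unfolding Qn_def .
  next
    fix \<mu> out' assume I: "Iv \<mu> out'" and "\<not> \<mu> (r + 3) < \<mu> 2"
    moreover have "glob \<mu>" using I keeps_glob m(1) reg unfolding Iv_def by auto
    ultimately show "Q (\<mu>, out')" using Q unfolding Iv_def by (auto simp: K_def)
  qed (use \<nu> reg in auto)
  let ?m = "m(r + 4 := b, r + 1 := b, b := m x, r + 2 := 0, r + 3 := 0)"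
  have p0: "p 0 = b" by (simp add: p_def)
  have "Path ?m 0"
    unfolding Path_def using m regs q_pos p_ge[of 0] p0 by (auto simp: p0)
  moreover have "keeps r S (m(r + 4 := b, r + 1 := b, b := m x)) m"
    using reg keeps_stack[of "m(r + 4 := b, r + 1 := b)" 0] by (simp add: p0)
  then have "keeps r S ?m m" using reg by simp
  ultimately have "Iv ?m out" unfolding Iv_def using regs p_ge[of 0] p0 by auto
  then have "wpp (WhileLess (r + 3) 2 ?loop) Q (?m, out)" by (rule *)
  moreover have "take_bit w b = b" "b < s" using p_fits[of 0] p[of 0] q_pos p0 by auto
  ultimately show ?thesis
    unfolding kernel_code_def using m regs reg low stack(1) by simp
qed

text \<open>The rank of a node is its time. \<open>blocks_stop_code\<close> uses no stack, and the
  evaluation itself writes only to odd stack cells, so the vertex stack survives.\<close>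

lemma wp_stop_kernel_code:
  assumes m: "glob m" "m 23 < n * q"
    and Q: "\<And>\<mu>. keeps 30 even \<mu> m \<Longrightarrow> \<mu> 30 = of_bool (kernel blocks_stop (m 23)) \<Longrightarrow> Q (\<mu>, out)"
  shows "wpp stop_kernel_code Q (m, out)"
  unfolding stop_kernel_code_def
proof (rule wp_kernel_code[where R = blocks_stop and rank = "\<lambda>x. x mod q" and l = 40 and S' = "\<lambda>_. True"
      and S = even and N = "n * q"])
  show "wpp (blocks_stop_code 35 36) Q' (\<mu>, out')"
    if "glob \<mu>" "\<mu> (30 + 5) < n * q" "\<mu> (30 + 6) < n * q"
      "\<And>\<nu>. keep 40 \<nu> \<mu> \<Longrightarrow> \<nu> 40 = of_bool (blocks_stop (\<mu> (30 + 5)) (\<mu> (30 + 6))) \<Longrightarrow> Q' (\<nu>, out')"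
    for \<mu> out' Q'
    using that by (intro wp_blocks_stop_code) auto
qed (use m Q q_pos big_simps in \<open>auto simp: blocks_stop_def\<close>)

lemma wp_colour_code:
  assumes m: "glob m" "m v < n" and reg: "v < 20"
    and Q: "\<And>\<mu>. keeps 20 even \<mu> m \<Longrightarrow> \<mu> 20 = colour (m v) \<Longrightarrow> Q (\<mu>, out)"
  shows "wpp (colour_code v) Q (m, out)"
proof -
  define x where "x = m v"
  have x: "x < n" using m by (simp add: x_def)
  \<comment> \<open>While the flag in cell 21 is unset, the time in cell 22 has not passed the
    stopping time, which is below \<open>q\<close>. The flag is a factor of \<open>M\<close>, so the
    last iteration decreases it, too.\<close>
  define Iv where "Iv = (\<lambda>\<mu> out'. out' = out \<and> keeps 20 even \<mu> m \<and>
    (\<mu> 21 = 1 \<and> \<mu> 20 = colour x \<or> \<mu> 21 = 0 \<and> \<mu> 22 \<le> stop_time x))"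
  define M where "M = (\<lambda>\<mu> :: nat \<Rightarrow> nat. (1 - \<mu> 21) * (q - \<mu> 22))"
  let ?kernel = "Basic (Op Mul 23 v 6);; Basic (Op Add 23 23 22);; stop_kernel_code;;
           IfLess 0 30 (walk_code v 22;; Basic (Copy 20 60);; Basic (Copy 21 2)) Skip"
  let ?next = "Basic (Op Add 22 22 2)"
  let ?body = "valid_code v 22;; IfLess 0 50 (?kernel) Skip;; ?next"
  have *: "wpp (WhileLess 21 2 ?body) Q (m(21 := 0, 22 := 0), out)"
  proof (rule wp_WhileLess[where I = Iv and f = M])
    fix \<mu> out' assume I: "Iv \<mu> out'" and less: "\<mu> 21 < \<mu> 2"
    have k: "keeps 20 even \<mu> m" and out: "out' = out" using I by (auto simp: Iv_def)
    have g: "glob \<mu>" using keeps_glob[OF k] m by simp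
    have v: "\<mu> v = x" using keeps_less[OF k] reg by (simp add: x_def)
    define t where "t = \<mu> 22"
    have f: "\<mu> 21 = 0" and t: "t \<le> stop_time x" using I less g by (auto simp: Iv_def t_def)
    have tq: "t < q" using t stop_time_less[OF x] by simp
    have M\<mu>: "M \<mu> = q - t" using f by (simp add: M_def t_def)
    define Qn where "Qn = (\<lambda>(\<mu>', out'). Iv \<mu>' out' \<and> M \<mu>' < M \<mu>)"
    have tb: "take_bit w (Suc t) = Suc t" using tq big_simps(4) by (intro take_bit_nat_eq_self) simp
    have node: "x * q + t < n * q" by (rule node_less[OF x tq])
    have tb2: "take_bit w (x * q) = x * q" "take_bit w (x * q + t) = x * q + t"
      using node big_simps(6) by (auto intro!: take_bit_nat_eq_self)
    have fail: "wpp ?next Qn (\<nu>, out')"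
      if "keeps 20 even \<nu> m" "glob \<nu>" "\<nu> 21 = 0" "\<nu> 22 = t" "\<not> stops_at x t" for \<nu>
    proof -
      have "t < stop_time x" using t that(5) stops_at_stop_time[OF x] by (cases "t = stop_time x") auto
      then have "Qn (\<nu>(22 := Suc t), out')"
        using that out tq by (simp add: Qn_def Iv_def M\<mu>) (simp add: M_def)
      then show ?thesis using that tb by simp
    qed
    have succeed: "wpp (walk_code v 22) (wpp (Basic (Copy 20 60)) (wpp (Basic (Copy 21 2)) (wpp ?next Qn))) (\<nu>, out')"
      if \<nu>: "keeps 20 even \<nu> m" "glob \<nu>" "\<nu> 22 = t" "stops_at x t" for \<nu>
    proof (rule wp_walk_code)
      fix \<xi> assume \<xi>: "keep 60 \<xi> \<nu>" "\<xi> 60 = walk (\<nu> v) (\<nu> 22)"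
      have "stop_time x \<le> t" unfolding stop_time_def by (rule Least_le[of "stops_at x", OF \<nu>(4)])
      then have "stop_time x = t" using t by simp
      then have "\<xi> 60 = colour x"
        using \<xi>(2) keeps_less[OF \<nu>(1)] reg \<nu>(3) by (simp add: colour_def x_def)
      moreover have "keeps 20 even \<xi> m" by (rule keeps_trans[OF \<xi>(1) \<nu>(1)]) auto
      moreover have "glob \<xi>" using keeps_glob[OF \<xi>(1) \<nu>(2)] by simp
      moreover have "\<xi> 22 = t" using keeps_less[OF \<xi>(1), of 22] \<nu>(3) by simp
      ultimately show "wpp (Basic (Copy 20 60)) (wpp (Basic (Copy 21 2)) (wpp ?next Qn)) (\<xi>, out')"
        using tb out tq by (simp add: Qn_def Iv_def M\<mu>) (simp add: M_def)
    qed (use \<nu> tq reg x keeps_less[OF \<nu>(1), of v] in \<open>auto simp: x_def\<close>)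
    have kern: "wpp ?kernel (wpp ?next Qn) (\<nu>, out')"
      if \<nu>: "keeps 20 even \<nu> m" "glob \<nu>" "\<nu> 21 = 0" "\<nu> 22 = t" "valid_time x t" for \<nu>
    proof -
      let ?\<nu> = "\<nu>(23 := x * q + t)"
      have "wpp stop_kernel_code (wpp (IfLess 0 30 (walk_code v 22;; Basic (Copy 20 60);; Basic (Copy 21 2)) Skip)
        (wpp ?next Qn)) (?\<nu>, out')"
      proof (rule wp_stop_kernel_code)
        fix \<xi> assume \<xi>: "keeps 30 even \<xi> ?\<nu>" "\<xi> 30 = of_bool (kernel blocks_stop (?\<nu> 23))"
        have k': "keeps 20 even \<xi> m" by (rule keeps_trans[OF \<xi>(1)]) (use \<nu> in auto)
        have g': "glob \<xi>" using keeps_glob[OF \<xi>(1)] \<nu> by simp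
        have lk: "\<xi> 21 = 0" "\<xi> 22 = t" "\<xi> 30 = of_bool (stops_at x t)"
          using keeps_less[OF \<xi>(1), of 21] keeps_less[OF \<xi>(1), of 22] \<xi>(2) \<nu> by (auto simp: stops_at_def)
        show "wpp (IfLess 0 30 (walk_code v 22;; Basic (Copy 20 60);; Basic (Copy 21 2)) Skip)
          (wpp ?next Qn) (\<xi>, out')"
          using g' lk fail[OF k' g' lk(1,2)] succeed[OF k' g' lk(2)] by (cases "stops_at x t") simp_all
      qed (use \<nu> node in auto)
      then show ?thesis
        using \<nu> keeps_less[OF \<nu>(1), of v] reg tb2 by (simp add: x_def)
    qed
    have "wpp ?body Qn (\<mu>, out')"
      unfolding wp_Seq[of _ _ _ "valid_code v 22"]
    proof (rule wp_valid_code)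
      fix \<nu> assume \<nu>: "keep 50 \<nu> \<mu>" "\<nu> 50 = of_bool (valid_time (\<mu> v) (\<mu> 22))"
      have k': "keeps 20 even \<nu> m" by (rule keeps_trans[OF \<nu>(1) k]) auto
      have g': "glob \<nu>" using keeps_glob[OF \<nu>(1)] g by simp
      have lk: "\<nu> 21 = 0" "\<nu> 22 = t" "\<nu> 50 = of_bool (valid_time x t)"
        using keeps_less[OF \<nu>(1), of 21] keeps_less[OF \<nu>(1), of 22] \<nu>(2) f v by (auto simp: t_def)
      have "\<not> valid_time x t \<Longrightarrow> \<not> stops_at x t" by (simp add: stops_at_def)
      then show "wpp (IfLess 0 50 (?kernel) Skip;; ?next) Qn (\<nu>, out')"
        unfolding wp_Seq[of _ _ _ "IfLess 0 50 (?kernel) Skip"]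
        using g' lk(3) fail[OF k' g' lk(1,2)] kern[OF k' g' lk(1,2)]
        by (cases "valid_time x t") (simp_all only: wp_IfLess, simp_all)
    qed (use g v x tq reg t_def in auto)
    then show "wpp ?body (\<lambda>(\<mu>', out'). Iv \<mu>' out' \<and> M \<mu>' < M \<mu>) (\<mu>, out')"
      unfolding Qn_def .
  next
    fix \<mu> out' assume I: "Iv \<mu> out'" and "\<not> \<mu> 21 < \<mu> 2"
    moreover have "glob \<mu>" using I keeps_glob m unfolding Iv_def by auto
    ultimately show "Q (\<mu>, out')" using Q unfolding Iv_def by (auto simp: x_def)
  qed (auto simp: Iv_def)
  show ?thesis
    unfolding colour_code_def using m * by simp
qed

lemma wp_blocks_vertex_code:
  assumes m: "glob m" "m v < n" "m u < n" and reg: "v < 16" "u < 16"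
    and Q: "\<And>\<mu>. keeps 16 even \<mu> m \<Longrightarrow> \<mu> 16 = of_bool (blocks_vertex (m v) (m u)) \<Longrightarrow> Q (\<mu>, out)"
  shows "wpp (blocks_vertex_code v u) Q (m, out)"
proof -
  define x y where "x = m v" and "y = m u"
  have lt: "x < n" "y < n" using m by (simp_all add: x_def y_def)
  let ?J = "\<lambda>\<mu>. keeps 16 even \<mu> m \<and> \<mu> v = x \<and> \<mu> u = y \<and> \<mu> 16 = 0 \<and> glob \<mu>"
  have J: "?J \<nu>" if "keeps l S \<nu> \<mu>" "17 \<le> l" "\<And>a. even a \<Longrightarrow> S a" "?J \<mu>" for l \<nu> \<mu> S
  proof -
    have "keeps 16 even \<nu> m" by (rule keeps_trans[OF that(1)]) (use that in auto)
    then show ?thesis using that keeps_less[OF that(1)] keeps_glob[OF that(1)] reg by auto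
  qed
  let ?cmp = "IfLess 20 17 (Basic (Copy 16 2)) Skip"
  have stage: "wpp (colour_code v) (wpp (Basic (Copy 17 20)) (wpp (colour_code u) (wpp ?cmp Q))) (\<mu>, out)"
    if \<mu>: "?J \<mu>" and e: "(x, y) \<in> E" for \<mu>
  proof (rule wp_colour_code)
    fix \<nu> assume \<nu>: "keeps 20 even \<nu> \<mu>" "\<nu> 20 = colour (\<mu> v)"
    have J': "?J \<nu>" by (rule J[OF \<nu>(1)]) (use \<mu> in auto)
    have "wpp (colour_code u) (wpp ?cmp Q) (\<nu>(17 := \<nu> 20), out)"
    proof (rule wp_colour_code)
      fix \<xi> assume \<xi>: "keeps 20 even \<xi> (\<nu>(17 := \<nu> 20))" "\<xi> 20 = colour ((\<nu>(17 := \<nu> 20)) u)"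
      have J'': "?J \<xi>" by (rule J[OF \<xi>(1)]) (use J' reg in auto)
      have lk: "\<xi> 17 = colour x" "\<xi> 20 = colour y"
        using keeps_less[OF \<xi>(1), of 17] \<xi>(2) \<nu>(2) \<mu> J' reg by auto
      have B: "blocks_vertex x y \<longleftrightarrow> colour y < colour x" using e by (simp add: blocks_vertex_def)
      have "Q (\<xi>(16 := 1), out)" if "colour y < colour x"
        by (rule Q) (use J'' B that in \<open>auto simp: x_def y_def\<close>)
      moreover have "Q (\<xi>, out)" if "\<not> colour y < colour x"
        by (rule Q) (use J'' B that in \<open>auto simp: x_def y_def\<close>)
      ultimately show "wpp ?cmp Q (\<xi>, out)" using J'' lk by simp
    qed (use J' lt reg in auto)
    then show "wpp (Basic (Copy 17 20)) (wpp (colour_code u) (wpp ?cmp Q)) (\<nu>, out)" by simp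
  qed (use \<mu> lt reg in auto)
  have "wpp (adj_code v u) (wpp (IfLess 0 92 (colour_code v;; Basic (Copy 17 20);; colour_code u;; ?cmp) Skip) Q)
    (m(16 := 0), out)"
  proof (rule wp_adj_code)
    fix \<nu> assume \<nu>: "keep 90 \<nu> (m(16 := 0))" "\<nu> 92 = of_bool (((m(16 := 0)) v, (m(16 := 0)) u) \<in> E)"
    have J': "?J \<nu>" by (rule J[OF \<nu>(1)]) (use m reg in \<open>auto simp: x_def y_def\<close>)
    have n92: "\<nu> 92 = of_bool ((x, y) \<in> E)" using \<nu>(2) reg by (simp add: x_def y_def)
    have "Q (\<nu>, out)" if "(x, y) \<notin> E"
      by (rule Q) (use J' that in \<open>auto simp: x_def y_def blocks_vertex_def\<close>)
    then show "wpp (IfLess 0 92 (colour_code v;; Basic (Copy 17 20);; colour_code u;; ?cmp) Skip) Q (\<nu>, out)"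
      using J' n92 stage[OF J'] by (cases "(x, y) \<in> E") simp_all
  qed (use m reg in auto)
  then show ?thesis unfolding blocks_vertex_code_def using m by simp
qed

text \<open>Here the rank is the colour. Computing colours in the body destroys odd stack cells, so
  only the even ones are kept by it.\<close>

lemma wp_vertex_kernel_code:
  assumes m: "glob m" "m 8 < n"
    and Q: "\<And>\<mu>. keeps 9 (\<lambda>_. False) \<mu> m \<Longrightarrow> \<mu> 9 = of_bool (kernel blocks_vertex (m 8)) \<Longrightarrow> Q (\<mu>, out)"
  shows "wpp vertex_kernel_code Q (m, out)"
  unfolding vertex_kernel_code_def
proof (rule wp_kernel_code[where R = blocks_vertex and rank = colour and l = 16 and S' = even
      and S = "\<lambda>_. False" and N = n])
  show "wpp (blocks_vertex_code 14 15) Q' (\<mu>, out')"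
    if "glob \<mu>" "\<mu> (9 + 5) < n" "\<mu> (9 + 6) < n"
      "\<And>\<nu>. keeps 16 even \<nu> \<mu> \<Longrightarrow> \<nu> 16 = of_bool (blocks_vertex (\<mu> (9 + 5)) (\<mu> (9 + 6))) \<Longrightarrow> Q' (\<nu>, out')"
    for \<mu> out' Q'
    using that by (intro wp_blocks_vertex_code) auto
qed (use m Q colour_less big_simps edge_less in \<open>auto simp: blocks_vertex_def\<close>)

section \<open>Initialisation and the whole program\<close>

lemma wp_test_prime_code:
  assumes m: "base m" "1 < m 6" "m 6 \<le> q"
    and Q: "\<And>\<mu>. base \<mu> \<Longrightarrow> \<mu> 4 = m 4 \<Longrightarrow> \<mu> 5 = m 5 \<Longrightarrow> \<mu> 6 = m 6 \<Longrightarrow> \<mu> 10 = of_bool (prime (m 6)) \<Longrightarrow> Q (\<mu>, out)"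
  shows "wpp test_prime_code Q (m, out)"
proof -
  define p where "p = m 6"
  let ?I = "\<lambda>\<mu> out'. out' = out \<and> base \<mu> \<and> \<mu> 4 = m 4 \<and> \<mu> 5 = m 5 \<and> \<mu> 6 = p \<and>
    2 \<le> \<mu> 11 \<and> \<mu> 11 \<le> p \<and> \<mu> 10 = of_bool (\<forall>d\<in>{2..<\<mu> 11}. \<not> d dvd p)"
  let ?body = "Basic (Op Mod 12 6 11);; IfLess 12 2 (Basic (Copy 10 0)) Skip;; Basic (Op Add 11 11 2)"
  have "wpp (WhileLess 11 6 ?body) Q (m(10 := 1, 11 := 2), out)"
  proof (rule wp_WhileLess[where I = ?I and f = "\<lambda>\<mu>. p - \<mu> 11"])
    fix \<mu> out' assume I: "?I \<mu> out'" and less: "\<mu> 11 < \<mu> 6"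
    define d where "d = \<mu> 11"
    have d: "2 \<le> d" "d < p" using I less by (simp_all add: d_def)
    have "p mod d \<le> p" "p < 2 ^ w" using m(3) big_simps(4) by (simp_all add: p_def)
    then have tb: "take_bit w (Suc d) = Suc d" "take_bit w (p mod d) = p mod d"
      using d by (intro take_bit_nat_eq_self; linarith)+
    have range: "{2..<Suc d} = insert d {2..<d}" using d by auto
    have dvd: "d dvd p \<longleftrightarrow> p mod d = 0" by (simp add: dvd_eq_mod_eq_0)
    show "wpp ?body (\<lambda>(\<mu>', out'). ?I \<mu>' out' \<and> p - \<mu>' 11 < p - \<mu> 11) (\<mu>, out')"
      using I d tb by (cases "p mod d = 0") (simp_all add: range dvd flip: d_def)
  next
    fix \<mu> out' assume I: "?I \<mu> out'" and "\<not> \<mu> 11 < \<mu> 6"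
    then have "\<mu> 11 = p" by simp
    moreover have "prime p \<longleftrightarrow> 1 < p \<and> (\<forall>d\<in>{2..<p}. \<not> d dvd p)" by (rule prime_nat_iff')
    ultimately have "\<mu> 10 = of_bool (prime p)" using I m(2) by (simp add: p_def)
    then show "Q (\<mu>, out')" using I Q by (simp add: p_def)
  qed (use m in \<open>auto simp: p_def\<close>)
  then show ?thesis unfolding test_prime_code_def using m by simp
qed

lemma wp_init_code:
  assumes Q: "\<And>\<mu>. glob \<mu> \<Longrightarrow> Q (\<mu>, out)"
  shows "wpp init_code Q (\<lambda>_. 0, out)"
proof -
  \<comment> \<open>\<open>Const\<close> truncates its argument; the largest constant loaded here is
    7.\<close>
  have "8 \<le> (2 :: nat) ^ w" using big_simps(7) s_eq by linarith
  then have const: "take_bit w 1 = (1 :: nat)" "take_bit w 2 = (2 :: nat)" "take_bit w 7 = (7 :: nat)"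
    by - (rule take_bit_nat_eq_self, linarith)+
  have tb_n: "take_bit w n = n" "take_bit w (D * 7) = D * 7" "take_bit w (n * q) = n * q"
    using big_simps q_gt by (auto intro!: take_bit_nat_eq_self)
  have inp: "inp ! 0 = n" "inp \<noteq> []" by (simp_all add: inp_eq)
  let ?deg = "\<lambda>i. Max (insert 1 ((\<lambda>v. length (nbrs ! v)) ` {..<i}))"
  have deg_n: "?deg n = D"
  proof (rule Max_eqI)
    show "D \<in> insert 1 ((\<lambda>v. length (nbrs ! v)) ` {..<n})" using D_max by auto
  qed (use D_pos degree_le in auto)
  let ?deg_body = "Basic (Op Add 11 10 2);; Basic (Read 12 11);; Basic (Op Add 11 11 2);; Basic (Read 11 11);;
        Basic (Op Sub 11 11 12);; IfLess 5 11 (Basic (Copy 5 11)) Skip"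
  let ?search = "WhileLess 10 2 (Basic (Op Add 6 6 2);; test_prime_code)"
  have search: "wpp ?search (wpp (Basic (Op Mul 7 4 6)) Q) (m, out)"
    if m: "base m" "m 4 = n" "m 5 = D" "m 6 = 7 * D" "m 10 = 0" for m
  proof (rule wp_WhileLess[where f = "\<lambda>\<mu>. q - \<mu> 6" and I = "\<lambda>\<mu> out'. out' = out \<and> base \<mu> \<and> \<mu> 4 = n \<and> \<mu> 5 = D \<and>
      (\<mu> 10 = 1 \<and> \<mu> 6 = q \<or> \<mu> 10 = 0 \<and> 7 * D \<le> \<mu> 6 \<and> \<mu> 6 < q)"])
    fix \<mu> out' assume I: "out' = out \<and> base \<mu> \<and> \<mu> 4 = n \<and> \<mu> 5 = D \<and>
      (\<mu> 10 = 1 \<and> \<mu> 6 = q \<or> \<mu> 10 = 0 \<and> 7 * D \<le> \<mu> 6 \<and> \<mu> 6 < q)" and less: "\<mu> 10 < \<mu> 2"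
    define p where "p = Suc (\<mu> 6)"
    have p: "7 * D < p" "p \<le> q" "\<mu> 6 = p - 1" using I less by (auto simp: p_def)
    have tb: "take_bit w p = p" using p(2) big_simps(4) by (intro take_bit_nat_eq_self) simp
    have "wpp test_prime_code (\<lambda>(\<mu>', out'). (out' = out \<and> base \<mu>' \<and> \<mu>' 4 = n \<and> \<mu>' 5 = D \<and>
      (\<mu>' 10 = 1 \<and> \<mu>' 6 = q \<or> \<mu>' 10 = 0 \<and> 7 * D \<le> \<mu>' 6 \<and> \<mu>' 6 < q)) \<and> q - \<mu>' 6 < q - \<mu> 6) (\<mu>(6 := p), out')"
    proof (rule wp_test_prime_code)
      fix \<nu> assume \<nu>: "base \<nu>" "\<nu> 4 = (\<mu>(6 := p)) 4" "\<nu> 5 = (\<mu>(6 := p)) 5" "\<nu> 6 = (\<mu>(6 := p)) 6"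
        "\<nu> 10 = of_bool (prime ((\<mu>(6 := p)) 6))"
      \<comment> \<open>All numbers tried lie above \<open>7 * D\<close> and do not exceed
        \<open>q\<close>, the least prime there.\<close>
      have "prime p \<longleftrightarrow> p = q" using q_least[of p] p prime_q by auto
      then show "case (\<nu>, out') of (\<mu>', out') \<Rightarrow> (out' = out \<and> base \<mu>' \<and> \<mu>' 4 = n \<and> \<mu>' 5 = D \<and>
      (\<mu>' 10 = 1 \<and> \<mu>' 6 = q \<or> \<mu>' 10 = 0 \<and> 7 * D \<le> \<mu>' 6 \<and> \<mu>' 6 < q)) \<and> q - \<mu>' 6 < q - \<mu> 6"
        using \<nu> I p D_pos by (cases "p = q") auto
    qed (use I p D_pos in auto)
    then show "wpp (Basic (Op Add 6 6 2);; test_prime_code) (\<lambda>(\<mu>', out'). (out' = out \<and> base \<mu>' \<and> \<mu>' 4 = n \<and> \<mu>' 5 = D \<and>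
      (\<mu>' 10 = 1 \<and> \<mu>' 6 = q \<or> \<mu>' 10 = 0 \<and> 7 * D \<le> \<mu>' 6 \<and> \<mu>' 6 < q)) \<and> q - \<mu>' 6 < q - \<mu> 6) (\<mu>, out')"
      using I tb by (simp add: p_def)
  next
    fix \<mu> out' assume I: "out' = out \<and> base \<mu> \<and> \<mu> 4 = n \<and> \<mu> 5 = D \<and>
      (\<mu> 10 = 1 \<and> \<mu> 6 = q \<or> \<mu> 10 = 0 \<and> 7 * D \<le> \<mu> 6 \<and> \<mu> 6 < q)" and "\<not> \<mu> 10 < \<mu> 2"
    then have \<mu>: "out' = out" "base \<mu>" "\<mu> 4 = n" "\<mu> 5 = D" "\<mu> 6 = q" by auto
    have "glob (\<mu>(7 := n * q))" using \<mu> by (simp add: glob_def del: glob_base glob_simps)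
    then show "wpp (Basic (Op Mul 7 4 6)) Q (\<mu>, out')" using \<mu> Q tb_n by simp
  qed (use m q_gt in auto)
  let ?rest = "wpp (Basic (Const 11 7)) (wpp (Basic (Op Mul 6 5 11)) (wpp (Basic (Copy 10 0))
      (wpp ?search (wpp (Basic (Op Mul 7 4 6)) Q))))"
  have "wpp (for_code 10 4 ?deg_body) ?rest (m, out)" if m: "base m" "m 4 = n" "m 5 = 1" for m
  proof (rule wp_for_code[where N = n and I = "\<lambda>i \<mu> out'. out' = out \<and> base \<mu> \<and> \<mu> 4 = n \<and> \<mu> 5 = ?deg i"])
    fix i \<mu> out' assume I: "out' = out \<and> base \<mu> \<and> \<mu> 4 = n \<and> \<mu> 5 = ?deg i" and i: "\<mu> 10 = i" "i < n"
    have offs: "inp ! Suc i = off i" "inp ! Suc (Suc i) = off (Suc i)"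
        "Suc i < length inp" "Suc (Suc i) < length inp" "off (Suc i) = off i + length (nbrs ! i)"
      using inp_off[of i] inp_off[of "Suc i"] i off_Suc[of i] by auto
    have tb: "take_bit w (Suc i) = Suc i" "take_bit w (Suc (Suc i)) = Suc (Suc i)"
      "take_bit w (off i) = off i" "take_bit w (off (Suc i)) = off (Suc i)"
      using i big_simps(1-3) off_le[of i] off_le[of "Suc i"] by (auto intro!: take_bit_nat_eq_self)
    have "length (nbrs ! i) < 2 ^ w" using degree_le[OF i(2)] big_simps(4) q_gt by linarith
    then have "take_bit w (length (nbrs ! i)) = length (nbrs ! i)" by (rule take_bit_nat_eq_self)
    \<comment> \<open>The machine subtracts modulo \<open>2 ^ w\<close> after adding that power;
      offsets increase, so the reduction gives the true difference.\<close>
    moreover have "2 ^ w + off (Suc i) - off i = length (nbrs ! i) + 2 ^ w" using offs by simp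
    ultimately have sub: "take_bit w (2 ^ w + off (Suc i) - off i) = length (nbrs ! i)"
      by (simp add: take_bit_eq_mod)
    have "?deg (Suc i) = Max (insert (length (nbrs ! i)) (insert 1 ((\<lambda>v. length (nbrs ! v)) ` {..<i})))"
      by (simp only: lessThan_Suc image_insert insert_commute)
    also have "\<dots> = max (length (nbrs ! i)) (?deg i)" by (rule Max_insert) auto
    finally have deg_Suc: "?deg (Suc i) = max (length (nbrs ! i)) (?deg i)" .
    define x where "x = ?deg i"
    show "wpp ?deg_body (\<lambda>(\<mu>', out''). \<mu>' 10 = i \<and> out'' = out \<and> base (\<mu>'(10 := Suc i)) \<and>
        (\<mu>'(10 := Suc i)) 4 = n \<and> (\<mu>'(10 := Suc i)) 5 = ?deg (Suc i)) (\<mu>, out')"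
      unfolding deg_Suc x_def[symmetric] using I[folded x_def] i offs(1-4) tb sub by (simp add: max_def)
  next
    fix \<mu> out' assume "out' = out \<and> base \<mu> \<and> \<mu> 4 = n \<and> \<mu> 5 = ?deg n"
    then show "?rest (\<mu>, out')"
      unfolding deg_n using const tb_n by (simp add: search)
  qed (use m big_simps in auto)
  moreover have "base ((\<lambda>_. 0)(2 := 1, 3 := 2, 4 := n, 5 := 1))" by (simp add: base_def del: base_simps)
  ultimately show ?thesis
    unfolding init_code_def using const tb_n inp by simp
qed

lemma wp_mis_code:
  "wpp mis_code (\<lambda>(m, out). out = filter (kernel blocks_vertex) [0..<n]) (\<lambda>_. 0, [])"
  unfolding mis_code_def wp_Seq
proof (rule wp_init_code)
  let ?K = "kernel blocks_vertex"
  fix m assume m: "glob m"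
  show "wpp (for_code 8 4 (vertex_kernel_code;; IfLess 0 9 (Basic (Write 8)) Skip))
    (\<lambda>(m, out). out = filter ?K [0..<n]) (m, [])"
  proof (rule wp_for_code[where I = "\<lambda>i \<mu> out. glob \<mu> \<and> out = filter ?K [0..<i]" and N = n])
    fix i \<mu> out assume I: "glob \<mu> \<and> out = filter ?K [0..<i]" and i: "\<mu> 8 = i" "i < n"
    show "wpp (vertex_kernel_code;; IfLess 0 9 (Basic (Write 8)) Skip)
      (\<lambda>(\<mu>', out'). \<mu>' 8 = i \<and> glob (\<mu>'(8 := Suc i)) \<and> out' = filter ?K [0..<Suc i]) (\<mu>, out)"
      unfolding wp_Seq
    proof (rule wp_vertex_kernel_code)
      fix \<nu> assume \<nu>: "keeps 9 (\<lambda>_. False) \<nu> \<mu>" "\<nu> 9 = of_bool (?K (\<mu> 8))"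
      have "glob \<nu>" using keeps_glob[OF \<nu>(1)] I by simp
      moreover have "\<nu> 8 = i" using keeps_less[OF \<nu>(1), of 8] i by simp
      ultimately show "wpp (IfLess 0 9 (Basic (Write 8)) Skip)
        (\<lambda>(\<mu>', out'). \<mu>' 8 = i \<and> glob (\<mu>'(8 := Suc i)) \<and> out' = filter ?K [0..<Suc i]) (\<nu>, out)"
        using \<nu>(2) I i by simp
    qed (use I i in auto)
  qed (use m big_simps in auto)
qed

lemma mis_code_correct:
  "\<exists>t xs. halts_with w inp (compile 0 mis_code) t s xs \<and> distinct xs \<and>
    maximal_independent_set n E (set xs) \<and>
    t \<le> length (compile 0 mis_code) * (2 ^ w) ^ s"
proof -
  let ?xs = "filter (kernel blocks_vertex) [0..<n]"
  obtain t where t: "halts_with w inp (compile 0 mis_code) t s ?xs"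
    using wp_halts[OF wp_mis_code] by blast
  moreover have "set ?xs = {v. v < n \<and> kernel blocks_vertex v}" by auto
  ultimately show ?thesis
    using maximal_independent_set_kernel halting_time_le[OF t] by (metis distinct_filter distinct_upt)
qed

end

section \<open>Word length and the final bounds\<close>

lemma power_two_word_length: "(n + 2) ^ k \<le> 2 ^ word_length k n"
proof -
  define c where "c = nat \<lceil>log 2 (real n + 2)\<rceil>"
  have "log 2 (real n + 2) \<le> real c" unfolding c_def by linarith
  then have "2 powr log 2 (real n + 2) \<le> 2 powr real c" by (intro powr_mono) auto
  then have "real (n + 2) \<le> real (2 ^ c)" by (simp add: powr_realpow)
  then have "n + 2 \<le> 2 ^ c" by (simp only: of_nat_le_iff)
  then have "(n + 2) ^ k \<le> (2 ^ c) ^ k" by (rule power_mono) simp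
  then show ?thesis by (simp add: word_length_def c_def mult.commute flip: power_mult)
qed

text \<open>From \<open>n + 2 \<le> n ^ 2\<close> the logarithm at most doubles, and rounding up
  costs at most 1, which is again at most \<open>log 2 (real n)\<close>; this makes the factor
  3.\<close>

lemma word_length_le_log:
  assumes "2 \<le> n"
  shows "real (word_length k n) \<le> 3 * real k * log 2 (real n)"
proof -
  have "n + 2 \<le> n ^ 2" using assms mult_le_mono1[of 2 n n] unfolding power2_eq_square by linarith
  then have "real n + 2 \<le> real n ^ 2" by (metis of_nat_add of_nat_le_iff of_nat_numeral of_nat_power)
  then have "log 2 (real n + 2) \<le> log 2 (real n ^ 2)" using assms by simp
  also have "\<dots> = 2 * log 2 (real n)" using assms by (simp add: log_nat_power)
  finally have "log 2 (real n + 2) \<le> 2 * log 2 (real n)" .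
  moreover have "1 \<le> log 2 (real n)" using assms by (simp add: le_log_iff)
  ultimately have "real (nat \<lceil>log 2 (real n + 2)\<rceil>) \<le> 3 * log 2 (real n)" by linarith
  from mult_left_mono[OF this, of "real k"] show ?thesis by (simp add: word_length_def mult_ac)
qed

text \<open>The program and both constants are chosen before the graph.
  \<open>max 1 \<Delta>\<close> keeps the bounds meaningful for edgeless graphs, and
  \<open>2 \<le> n\<close> is required since the logarithm of 1 is 0.\<close>

theorem theorem4:
  "\<exists>(P :: instr list) (k :: nat) (C :: nat). 0 < k \<and>
     (\<forall>(n :: nat) (E :: (nat \<times> nat) set) (\<Delta> :: nat) (inp :: nat list).
       simple_graph n E \<and> max_degree n E = \<Delta> \<and> encodes_graph inp n E \<longrightarrow>
       (\<exists>t s xs.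
          halts_with (word_length k n) inp P t s xs \<and>
          distinct xs \<and> maximal_independent_set n E (set xs) \<and>
          (2 \<le> n \<longrightarrow>
             t \<le> n ^ (C * max 1 \<Delta>) \<and>
             real (s * word_length k n) \<le> real C * real (max 1 \<Delta>) * log 2 (real n))))"
proof -
  define P where "P = compile 0 mis_code"
  \<comment> \<open>\<open>459360 = 5104 * 90\<close>: at most \<open>5104 * D\<close> cells of at
    most \<open>90 * log 2 (real n)\<close> bits each. The summand \<open>length P\<close> accounts
    for the values of the program counter in the time bound.\<close>
  define C where "C = length P + 459360"
  have main: "\<exists>t s xs. halts_with (word_length 30 n) inp P t s xs \<and>
      distinct xs \<and> maximal_independent_set n E (set xs) \<and>
      (2 \<le> n \<longrightarrow> t \<le> n ^ (C * max 1 \<Delta>) \<and>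
         real (s * word_length 30 n) \<le> real C * real (max 1 \<Delta>) * log 2 (real n))"
    if G: "simple_graph n E" "max_degree n E = \<Delta>" "encodes_graph inp n E" for n E \<Delta> inp
  proof -
    obtain nbrs where nbrs: "length nbrs = n" "\<And>v. v < n \<Longrightarrow> distinct (nbrs ! v) \<and> set (nbrs ! v) = E `` {v}"
      and inp: "inp = [n] @ map (\<lambda>v. n + 2 + sum_list (map length (take v nbrs))) [0..<n + 1] @ concat nbrs"
      using G(3) unfolding encodes_graph_def by blast
    define D where "D = max 1 \<Delta>"
    define w where "w = word_length 30 n"
    define N where "N = n + 2"
    have len: "length (nbrs ! v) = vertex_degree E v" if "v < n" for v
      using nbrs(2)[OF that] distinct_card[of "nbrs ! v"] by (simp add: vertex_degree_def)
    have deg_le: "length (nbrs ! v) \<le> D" if "v < n" for v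
    proof -
      have "vertex_degree E v \<le> \<Delta>"
        unfolding G(2)[symmetric] max_degree_def using that by (intro Max_ge) auto
      then show ?thesis using len[OF that] by (simp add: D_def)
    qed
    have \<Delta>: "\<Delta> \<in> insert 0 (vertex_degree E ` {..<n})"
      unfolding G(2)[symmetric] max_degree_def by (intro Max_in) auto
    then have D_max: "D = 1 \<or> (\<exists>v<n. length (nbrs ! v) = D)"
      using len unfolding D_def by (cases "\<Delta> \<le> 1") auto
    have deg_n: "vertex_degree E v \<le> n" for v
    proof -
      have "E `` {v} \<subseteq> {..<n}" using G(1) by (auto simp: simple_graph_def)
      then show ?thesis unfolding vertex_degree_def using card_mono[of "{..<n}"] by fastforce
    qed
    then have DN: "D \<le> N" using \<Delta> by (auto simp: D_def N_def intro: le_trans[OF deg_n])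
    have D1: "1 \<le> D" by (simp add: D_def)
    define q where "q = (LEAST p. prime p \<and> 7 * D < p)"
    obtain p0 where p0: "prime p0 \<and> 7 * D < p0" "p0 \<le> 2500 * D"
      using ex_prime_between_linear[OF D1] by blast
    have q: "prime q \<and> 7 * D < q"
      unfolding q_def by (rule LeastI[of "\<lambda>p. prime p \<and> 7 * D < p", OF p0(1)])
    have q_least: "q \<le> p" if "prime p" "7 * D < p" for p
      unfolding q_def by (rule Least_le) (use that in simp)
    have q_le: "q \<le> 2500 * D" using q_least[of p0] p0 by linarith
    define s where "s = 104 + 2 * q"
    have "length inp \<le> N + N * N"
    proof -
      have "length (concat nbrs) = (\<Sum>v<n. length (nbrs ! v))"
        using nbrs(1) by (simp add: length_concat sum_list_sum_nth lessThan_atLeast0)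
      also have "\<dots> \<le> (\<Sum>v<n. D)" by (intro sum_mono deg_le) simp
      also have "\<dots> \<le> N * N" using DN mult_le_mono[of n N D N] by (simp add: N_def)
      finally show ?thesis unfolding inp by (simp add: N_def)
    qed
    moreover have "q \<le> 2500 * N" using q_le DN by linarith
    then have "N * q \<le> N * (2500 * N)" "4 * q ^ 2 \<le> 4 * (2500 * N) ^ 2"
      by (intro mult_left_mono power_mono; simp)+
    then have "N * q \<le> 2500 * (N * N)" "4 * q ^ 2 \<le> 25000000 * (N * N)"
      by (simp_all add: power2_eq_square algebra_simps)
    moreover have "N \<le> N * N" "1 \<le> N * N" by (simp_all add: N_def)
    \<comment> \<open>As \<open>N\<close> is at least 2, the constant \<open>2 ^ 25\<close> is at
      most \<open>N ^ 25\<close> and the sum at most \<open>N ^ 27\<close>; words with factor 30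
      have room for this.\<close>
    ultimately have "N * q + 4 * q ^ 2 + length inp + s + n \<le> 2 ^ 25 * (N * N)"
      using q_le DN unfolding s_def N_def[symmetric] by (simp add: N_def)
    also have "\<dots> \<le> N ^ 25 * (N * N)" by (intro mult_right_mono power_mono) (auto simp: N_def)
    also have "\<dots> = N ^ 27" by (simp flip: power2_eq_square power_add)
    also have "\<dots> < N ^ 30" by (rule power_strict_increasing) (auto simp: N_def)
    also have "\<dots> \<le> 2 ^ w" unfolding N_def w_def by (rule power_two_word_length)
    finally have big: "(n + 2) * q + 4 * q ^ 2 + length inp + s + n < 2 ^ w" by (simp only: N_def)
    interpret mis_program n E nbrs D q inp w s
      by unfold_locales (use G(1) nbrs inp deg_le D_max D1 q q_least big in \<open>auto simp: s_def\<close>)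
    obtain t xs where t: "halts_with w inp P t s xs" "distinct xs" "maximal_independent_set n E (set xs)"
        "t \<le> length P * (2 ^ w) ^ s"
      using mis_code_correct unfolding P_def by blast
    have bounds: "t \<le> n ^ (C * D) \<and> real (s * w) \<le> real C * real D * log 2 (real n)" if n: "2 \<le> n"
    proof
      have s_le: "s \<le> 5104 * D" using q_le D1 unfolding s_def by linarith
      have log: "1 \<le> log 2 (real n)" using n by (simp add: le_log_iff)
      have "real (s * w) \<le> real (5104 * D) * (90 * log 2 (real n))"
        unfolding of_nat_mult[of s] w_def using s_le word_length_le_log[OF n, of 30]
        by (intro mult_mono) auto
      then have sw: "real (s * w) \<le> 459360 * real D * log 2 (real n)" by simp
      also have "\<dots> \<le> real C * real D * log 2 (real n)"
        using log by (intro mult_right_mono) (auto simp: C_def)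
      finally show "real (s * w) \<le> real C * real D * log 2 (real n)" .
      have "real (2 ^ (s * w)) = 2 powr real (s * w)" using powr_realpow[of 2 "s * w"] by simp
      also have "\<dots> \<le> 2 powr (459360 * real D * log 2 (real n))" using sw by (intro powr_mono) auto
      also have "\<dots> = (2 powr log 2 (real n)) powr real (459360 * D)"
        by (simp add: powr_powr mult_ac)
      also have "\<dots> = real n powr real (459360 * D)" using n by simp
      also have "\<dots> = real (n ^ (459360 * D))" using n powr_realpow[of "real n" "459360 * D"] by simp
      finally have "2 ^ (s * w) \<le> n ^ (459360 * D)" by (simp only: of_nat_le_iff)
      moreover have "length P \<le> n ^ (length P * D)"
      proof -
        have "length P \<le> 2 ^ length P" by (simp add: less_imp_le)
        also have "\<dots> \<le> n ^ length P" using n by (rule power_mono) simp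
        also have "\<dots> \<le> n ^ (length P * D)" using n D1 by (intro power_increasing) auto
        finally show ?thesis .
      qed
      ultimately have "length P * 2 ^ (s * w) \<le> n ^ (length P * D) * n ^ (459360 * D)"
        by (rule mult_le_mono[rotated])
      also have "\<dots> = n ^ (C * D)" by (simp add: C_def distrib_right flip: power_add)
      finally show "t \<le> n ^ (C * D)" using t(4) by (simp add: mult.commute flip: power_mult)
    qed
    show ?thesis
      using t(1-3) bounds unfolding w_def D_def by blast
  qed
  show ?thesis
    by (rule exI[of _ P], rule exI[of _ 30], rule exI[of _ C], intro conjI allI impI, simp)
      (elim conjE, rule main)
qed

end
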